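(* Let $m_1,m_2$ be positive integers, $n\ge 0$ an integer, and $\alpha_1,\alpha_2$ real numbers with $\alpha_1\alpha_2\neq 0$ and $\alpha_1=\alpha_2$. Let $\Omega=\{(x,y)\in\mathbb{R}^2 : (1-\alpha_1x)^{m_1}(1-\alpha_2x)^{m_2}\neq 0\}$. Let $K>0$, let $V\subset\Omega$ be compact, and let $D$ be a compact subset of $B_K=\{(a_{ij},b_{ij})_{0\le i+j\le n} : |a_{ij}|\le K,\ |b_{ij}|\le K\}$ such that for every $(a_{ij},b_{ij})\in D$ the first order Melnikov function $\Phi(h)$, $0\le h<H_0$ (defined in the context), is not identically zero. Then there exists $\varepsilon_0>0$ such that for all $\varepsilon$ with $0<|\varepsilon|<\varepsilon_0$ and all $(a_{ij},b_{ij})\in D$, the system $$\dot x=y+\frac{\varepsilon}{(1-\alpha_1x)^{m_1}(1-\alpha_2x)^{m_2}}\sum_{0\le i+j\le n}a_{ij}x^iy^j,\qquad \dot y=-x+\frac{\varepsilon}{(1-\alpha_1x)^{m_1}(1-\alpha_2x)^{m_2}}\sum_{0\le i+j\le n}b_{ij}x^iy^j$$ on $\Omega$ has at most $n$ limit cycles in $V$.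
   Context: The indices $i,j$ are nonnegative integers, and the coefficients $a_{ij},b_{ij}$ are real. Put $H_0=\min\left(\frac{1}{\alpha_1^2},\frac{1}{\alpha_2^2}\right)$. For $0\le h<H_0$ let $L_h$ be the circle $x=\sqrt h\,\sin t,\ y=\sqrt h\,\cos t$, $t\in[0,2\pi]$ (a periodic orbit of the system with $\varepsilon=0$; for $h=0$, the origin). The first order Melnikov function of the system is $$\Phi(h)=\oint_{L_h}\frac{1}{(1-\alpha_1x)^{m_1}(1-\alpha_2x)^{m_2}}\sum_{0\le i+j\le n}\left(a_{ij}x^{i+1}y^j+b_{ij}x^iy^{j+1}\right)dt,\qquad 0\le h<H_0 .$$ A limit cycle is an isolated periodic orbit; a limit cycle is in $V$ if it is contained in $V$. *)

theory Defs
  imports "HOL-Analysis.Analysis"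
begin

text \<open>
  A coefficient family \<open>(a\<^sub>i\<^sub>j)\<close>, \<open>i + j \<le> n\<close>, is a function \<open>nat \<Rightarrow> nat \<Rightarrow> real\<close> extended by zero
  outside \<open>{(i, j). i + j \<le> n}\<close>. On such functions the product topology of the function type is the
  Euclidean topology of the finite-dimensional coefficient space.
\<close>

type_synonym coeffs = "nat \<Rightarrow> nat \<Rightarrow> real"

definition coeff_box :: "nat \<Rightarrow> real \<Rightarrow> (coeffs \<times> coeffs) set" where
  "coeff_box n K = {(a, b).
     (\<forall>i j. i + j \<le> n \<longrightarrow> \<bar>a i j\<bar> \<le> K \<and> \<bar>b i j\<bar> \<le> K) \<and>
     (\<forall>i j. n < i + j \<longrightarrow> a i j = 0 \<and> b i j = 0)}"

definition indices :: "nat \<Rightarrow> (nat \<times> nat) set" where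
  "indices n = {(i, j). i + j \<le> n}"

lemma finite_indices: "finite (indices n)"
  by (rule finite_subset[of _ "{..n} \<times> {..n}"]) (auto simp: indices_def)

definition denom :: "nat \<Rightarrow> nat \<Rightarrow> real \<Rightarrow> real \<Rightarrow> real \<Rightarrow> real" where
  "denom m1 m2 \<alpha>1 \<alpha>2 x = (1 - \<alpha>1 * x) ^ m1 * (1 - \<alpha>2 * x) ^ m2"

definition Omega :: "nat \<Rightarrow> nat \<Rightarrow> real \<Rightarrow> real \<Rightarrow> (real \<times> real) set" where
  "Omega m1 m2 \<alpha>1 \<alpha>2 = {(x, y). denom m1 m2 \<alpha>1 \<alpha>2 x \<noteq> 0}"

definition vector_field ::
  "nat \<Rightarrow> nat \<Rightarrow> real \<Rightarrow> real \<Rightarrow> nat \<Rightarrow> coeffs \<Rightarrow> coeffs \<Rightarrow> real \<Rightarrow> real \<times> real \<Rightarrow> real \<times> real" where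
  "vector_field m1 m2 \<alpha>1 \<alpha>2 n a b \<epsilon> = (\<lambda>(x, y).
     (y + \<epsilon> / denom m1 m2 \<alpha>1 \<alpha>2 x * (\<Sum>(i, j)\<in>indices n. a i j * x ^ i * y ^ j),
      - x + \<epsilon> / denom m1 m2 \<alpha>1 \<alpha>2 x * (\<Sum>(i, j)\<in>indices n. b i j * x ^ i * y ^ j)))"

definition H0 :: "real \<Rightarrow> real \<Rightarrow> real" where
  "H0 \<alpha>1 \<alpha>2 = min (1 / \<alpha>1\<^sup>2) (1 / \<alpha>2\<^sup>2)"

definition melnikov ::
  "nat \<Rightarrow> nat \<Rightarrow> real \<Rightarrow> real \<Rightarrow> nat \<Rightarrow> coeffs \<Rightarrow> coeffs \<Rightarrow> real \<Rightarrow> real" where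
  "melnikov m1 m2 \<alpha>1 \<alpha>2 n a b h =
     integral {0..2 * pi} (\<lambda>t. let x = sqrt h * sin t; y = sqrt h * cos t in
       1 / denom m1 m2 \<alpha>1 \<alpha>2 x *
       (\<Sum>(i, j)\<in>indices n. a i j * x ^ (i + 1) * y ^ j + b i j * x ^ i * y ^ (j + 1)))"

definition is_solution ::
  "(real \<times> real \<Rightarrow> real \<times> real) \<Rightarrow> (real \<times> real) set \<Rightarrow> (real \<Rightarrow> real \<times> real) \<Rightarrow> bool" where
  "is_solution f S z \<longleftrightarrow>
     (\<forall>t. z t \<in> S \<and> (z has_vector_derivative f (z t)) (at t))"

text \<open>Equilibria are not periodic orbits.\<close>

definition periodic_orbit ::
  "(real \<times> real \<Rightarrow> real \<times> real) \<Rightarrow> (real \<times> real) set \<Rightarrow> (real \<times> real) set \<Rightarrow> bool" where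
  "periodic_orbit f S \<gamma> \<longleftrightarrow>
     (\<exists>z T. is_solution f S z \<and> T > 0 \<and> (\<forall>t. z (t + T) = z t) \<and>
            \<not> z constant_on UNIV \<and> \<gamma> = range z)"

definition limit_cycle ::
  "(real \<times> real \<Rightarrow> real \<times> real) \<Rightarrow> (real \<times> real) set \<Rightarrow> (real \<times> real) set \<Rightarrow> bool" where
  "limit_cycle f S \<gamma> \<longleftrightarrow>
     periodic_orbit f S \<gamma> \<and>
     (\<exists>U. open U \<and> \<gamma> \<subseteq> U \<and> (\<forall>\<gamma>'. periodic_orbit f S \<gamma>' \<and> \<gamma>' \<subseteq> U \<longrightarrow> \<gamma>' = \<gamma>))"

end

theory Submission
  imports Defs "HOL-Complex_Analysis.Complex_Analysis"
begin

text \<open>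
  For small \<open>\<epsilon>\<close> every periodic orbit in \<open>V\<close> is, in polar coordinates centred at the perturbed
  equilibrium, a \<open>2\<pi>\<close>-periodic solution of \<open>dr/d\<theta> = \<epsilon> f(r, \<theta>)\<close> with \<open>f\<close> holomorphic in \<open>r\<close> on
  a complex disc. The displacement map divided by \<open>\<epsilon>\<close> is holomorphic on that disc and tends uniformly
  to \<open>\<Phi>(r\<^sup>2) / r\<close> as \<open>\<epsilon> \<rightarrow> 0\<close>. Each orbit gives two zeros of it, one positive and one negative, whose
  limits are opposite. So if there were \<open>n + 1\<close> orbits for arbitrarily small \<open>\<epsilon>\<close>, then, by compactness
  of \<open>D\<close>, for some coefficients in \<open>D\<close> the function \<open>\<Phi>(h) / h\<close> would have \<open>n + 1\<close> zeros with
  multiplicity in \<open>[0, H\<^sub>0)\<close>, the zero \<open>h = 0\<close> included.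

  This forces \<open>\<Phi> = 0\<close>. Up to positive factors, the Taylor coefficients of \<open>\<Phi>(h) / h\<close> from index \<open>L\<close> on
  are the values of a polynomial of degree at most \<open>n - L\<close>, where \<open>L = (n + 1 - m\<^sub>1 - m\<^sub>2) div 2\<close>
  (\<open>0\<close> if \<open>n + 1 \<le> m\<^sub>1 + m\<^sub>2\<close>). Hence the number of initial vanishing coefficients plus the number of sign
  changes is at most \<open>n\<close>, and Descartes' rule of signs, in the version for power series, bounds the
  number of zeros.
\<close>

section \<open>Sign changes of power series coefficients\<close>

text \<open>The count must be uniform up to both ends of the range of radii. At the outer end, the
  line x = 1/\<alpha> is singular. Beyond it, for small \<epsilon>, \<open>\<alpha> * y\<close>
  decreases strictly along an orbit, so no periodic orbit lies there. On the near side, an orbit in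
  V keeps a fixed distance from the line, and as the radius hardly changes during a turn, it is at
  most some \<rho> < 1/|\<alpha>|. At the inner end, orbits may shrink to the equilibrium as
  \<epsilon> tends to 0. Centring the coordinates there makes the perturbation divisible by the
  radius, so r = 0 becomes an interior point of the disc and such orbits survive as zeros of the
  limit. The negative zeros come from the reflection of (r, \<theta>) to (-r, \<theta> + \<pi>),
  which describes the same point. They are indispensable: k orbits collapsing to the origin would by
  themselves give only a factor z^k, whereas k zeros in h = z^2 require z^(2k). The index L marks
  where the denominators become harmless: those that do not cancel are 2(l + 1) - e with e odd and
  at most n + 1 - m1 - m2, and they are positive from l = L on.\<close>

fun alternates :: "(nat \<Rightarrow> real) \<Rightarrow> real \<Rightarrow> nat \<Rightarrow> nat \<Rightarrow> bool" where
  "alternates c \<sigma> 0 a \<longleftrightarrow> (\<exists>i\<ge>a. \<sigma> * c i > 0)"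
| "alternates c \<sigma> (Suc k) a \<longleftrightarrow> (\<exists>i\<ge>a. \<sigma> * c i > 0 \<and> alternates c (- \<sigma>) k (Suc i))"

lemma alternates_antimono: "alternates c \<sigma> k b \<Longrightarrow> a \<le> b \<Longrightarrow> alternates c \<sigma> k a"
  by (cases k) (auto intro: order_trans)

text \<open>The factor \<open>\<tau>\<close> admits a global change of sign, which occurs when
  multiplication by h - x is rewritten as taking differences.\<close>

lemma alternates_cong:
  assumes "alternates c \<sigma> k a" "\<And>i \<sigma>. i \<ge> a \<Longrightarrow> \<sigma> * c i > 0 \<Longrightarrow> \<sigma> * \<tau> * e i > 0"
  shows "alternates e (\<sigma> * \<tau>) k a"
  using assms
proof (induction k arbitrary: \<sigma> a)
  case (Suc k)
  then obtain i where i: "i \<ge> a" "\<sigma> * c i > 0" "alternates c (- \<sigma>) k (Suc i)" by auto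
  have "alternates e (- \<sigma> * \<tau>) k (Suc i)"
    by (rule Suc.IH) (use i Suc.prems in auto)
  then show ?case using i Suc.prems by auto
qed auto

lemma alternates_Suc_shift: "alternates (\<lambda>i. c (Suc i)) \<sigma> k a \<Longrightarrow> alternates c \<sigma> k (Suc a)"
proof (induction k arbitrary: \<sigma> a)
  case 0
  then show ?case by (auto intro: exI[of _ "Suc _"])
next
  case (Suc k)
  then obtain i where "i \<ge> a" "\<sigma> * c (Suc i) > 0" "alternates (\<lambda>i. c (Suc i)) (- \<sigma>) k (Suc i)" by auto
  with Suc.IH show ?case by (auto intro!: exI[of _ "Suc i"])
qed

text \<open>\<open>k\<close> counts sign changes, so \<open>k + 1\<close> entries are involved.
  Advancing the start by one index discards at most one of these entries, hence at most one change,
  though the sign of the first entry may flip.\<close>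

lemma alternates_drop:
  assumes "alternates c \<sigma> k a" "a \<le> b" "b - a \<le> k"
  shows "\<exists>\<sigma>'. alternates c \<sigma>' (k - (b - a)) b"
  using assms(2,3,1)
proof (induction b rule: dec_induct)
  case (step b)
  have "b - a \<le> k" using step by linarith
  with step obtain \<sigma>' where *: "alternates c \<sigma>' (k - (b - a)) b" by blast
  obtain k' where k': "k - (b - a) = Suc k'" using step by (metis Suc_diff_le Suc_le_D diff_diff_cancel diff_is_0_eq diff_le_self le_diff_iff le_eq_less_or_eq not0_implies_Suc not_less_eq_eq)
  then obtain i where "i \<ge> b" "alternates c (- \<sigma>') k' (Suc i)" using * by auto
  then have "alternates c (- \<sigma>') k' (Suc b)" by (auto intro: alternates_antimono)
  moreover have "k - (Suc b - a) = k'" using k' step by linarith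
  ultimately show ?case by auto
qed auto

text \<open>Multiplication by the variable: if \<open>u\<close> is the coefficient sequence of a
  power series in h, then \<open>u l - shifted u l\<close> is that of the series times 1 -
  h.\<close>

definition shifted :: "(nat \<Rightarrow> real) \<Rightarrow> nat \<Rightarrow> real" where
  "shifted u l = (case l of 0 \<Rightarrow> 0 | Suc j \<Rightarrow> u j)"

text \<open>Between consecutive terms of opposite sign the sequence has to move towards the later
  one, which preserves the \<open>k\<close> changes. The additional change comes from the end: after
  its last counted term the sequence returns to 0, so some difference there has the opposite sign.
  The hypothesis on \<open>shifted u a\<close> says that sign \<open>\<sigma>\<close> has not been
  reached before the count starts; in the induction the count restarts at \<open>Suc i\<close>,
  where the preceding term is \<open>u i\<close>.\<close>

lemma alternates_differences:
  assumes "u \<longlonglongrightarrow> 0" "alternates u \<sigma> k a" "\<sigma> * shifted u a \<le> 0"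
  shows "alternates (\<lambda>l. u l - shifted u l) \<sigma> (Suc k) a"
proof -
  let ?d = "\<lambda>l. u l - shifted u l"
  have rise: "\<exists>j\<ge>a. j \<le> i \<and> \<sigma> * ?d j > 0"
    if "a \<le> i" "\<sigma> * u i > 0" "\<sigma> * shifted u a \<le> 0" for a i \<sigma>
    using that
  proof (induction i rule: dec_induct)
    case base
    then show ?case by (auto simp: algebra_simps intro!: exI[of _ a])
  next
    case (step i)
    show ?case
    proof (cases "\<sigma> * u i > 0")
      case True
      then show ?thesis using step by (metis le_SucI)
    next
      case False
      then have "\<sigma> * ?d (Suc i) > 0" using step by (auto simp: shifted_def algebra_simps)
      then show ?thesis using step by (intro exI[of _ "Suc i"]) auto
    qed
  qed
  show ?thesis using assms(2,3)
  proof (induction k arbitrary: \<sigma> a)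
    case 0
    then obtain i where i: "i \<ge> a" "\<sigma> * u i > 0" by auto
    obtain j where j: "j \<ge> a" "j \<le> i" "\<sigma> * ?d j > 0" using rise i 0 by blast
    have "(\<lambda>l. \<sigma> * u l) \<longlonglongrightarrow> 0" using tendsto_mult_left[OF assms(1)] by simp
    then have "eventually (\<lambda>l. \<sigma> * u l < \<sigma> * u i) sequentially"
      using i(2) by (rule order_tendstoD)
    then obtain l where l: "l \<ge> Suc i" "\<sigma> * u l < \<sigma> * u i"
      by (auto simp: eventually_sequentially) (meson le_cases le_refl)
    have "\<exists>j'\<ge>Suc i. - \<sigma> * ?d j' > 0"
    proof (rule ccontr)
      assume H: "\<not> ?thesis"
      have "\<sigma> * u i \<le> \<sigma> * u l" using l(1)
      proof (induction l rule: dec_induct)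
        case base
        from H have "\<not> (- \<sigma> * ?d (Suc i) > 0)" by blast
        then show ?case by (simp add: shifted_def algebra_simps)
      next
        case (step l)
        from H step have "\<not> (- \<sigma> * ?d (Suc l) > 0)" by (metis le_SucI)
        with step show ?case by (simp add: shifted_def algebra_simps)
      qed
      with l show False by simp
    qed
    then obtain j' where "j' \<ge> Suc i" "- \<sigma> * ?d j' > 0" by blast
    then show ?case using j unfolding alternates.simps by (meson Suc_le_mono order_trans)
  next
    case (Suc k)
    then obtain i where i: "i \<ge> a" "\<sigma> * u i > 0" "alternates u (- \<sigma>) k (Suc i)" by auto
    obtain j where j: "j \<ge> a" "j \<le> i" "\<sigma> * ?d j > 0" using rise i Suc.prems by blast
    have "alternates ?d (- \<sigma>) (Suc k) (Suc i)"
      by (rule Suc.IH) (use i in \<open>auto simp: shifted_def\<close>)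
    then have "alternates ?d (- \<sigma>) (Suc k) (Suc j)"
      using j alternates_antimono by (metis Suc_le_mono)
    then show ?case using j alternates.simps(2) by blast
  qed
qed

text \<open>Initial zeros count on a par with sign changes, because a zero of the series at h = 0
  produces the former and a positive zero the latter. The zero sequence qualifies for every
  \<open>N\<close>, as the zero function has zeros of any multiplicity.\<close>

definition vanishes_or_varies :: "(nat \<Rightarrow> real) \<Rightarrow> nat \<Rightarrow> bool" where
  "vanishes_or_varies c N \<longleftrightarrow> (\<forall>l. c l = 0) \<or>
     (\<exists>N0 K \<sigma>. N \<le> N0 + K \<and> (\<forall>l<N0. c l = 0) \<and> alternates c \<sigma> K N0)"

lemma vanishes_or_varies_0: "vanishes_or_varies c 0"
proof (cases "\<forall>l. c l = 0")
  case False
  then obtain l where "c l \<noteq> 0" by auto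
  then have "alternates c (sgn (c l)) 0 0" by (auto intro!: exI[of _ l] simp: sgn_if)
  then show ?thesis unfolding vanishes_or_varies_def
    by (intro disjI2 exI[of _ 0] exI[of _ "sgn (c l)"]) auto
qed (auto simp: vanishes_or_varies_def)

text \<open>After scaling by powers of \<open>x\<close>, multiplication by \<open>h - x\<close> takes differences of a null sequence.\<close>

lemma vanishes_or_varies_mult:
  assumes q: "vanishes_or_varies q N" and "x \<ge> 0" and lim: "(\<lambda>l. q l * x ^ l) \<longlonglongrightarrow> 0"
    and c: "\<And>l. c l = shifted q l - x * q l"
  shows "vanishes_or_varies c (Suc N)"
proof (cases "\<forall>l. q l = 0")
  case True
  then show ?thesis using c by (auto simp: vanishes_or_varies_def shifted_def split: nat.splits)
next
  case False
  then obtain N0 K \<sigma> where N: "N \<le> N0 + K" "\<forall>l<N0. q l = 0" "alternates q \<sigma> K N0"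
    using q by (auto simp: vanishes_or_varies_def)
  show ?thesis
  proof (cases "x = 0")
    case True
    have "alternates (\<lambda>i. c (Suc i)) \<sigma> K N0"
      using N(3) by (simp add: c True shifted_def)
    then have "alternates c \<sigma> K (Suc N0)" by (rule alternates_Suc_shift)
    moreover have "\<forall>l<Suc N0. c l = 0" using N True by (auto simp: c shifted_def split: nat.splits)
    ultimately show ?thesis unfolding vanishes_or_varies_def
      using N(1) by (intro disjI2 exI[of _ "Suc N0"] exI[of _ K] exI[of _ \<sigma>]) auto
  next
    case False
    with \<open>x \<ge> 0\<close> have x: "x > 0" by simp
    let ?u = "\<lambda>l. q l * x ^ l"
    have "alternates ?u (\<sigma> * 1) K N0"
    proof (rule alternates_cong[OF N(3)])
      show "\<sigma> * 1 * (q i * x ^ i) > 0" if "\<sigma> * q i > 0" for i \<sigma>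
        using mult_pos_pos[OF that zero_less_power[OF x, of i]] by (simp add: mult.assoc)
    qed
    then have "alternates (\<lambda>l. ?u l - shifted ?u l) \<sigma> (Suc K) N0"
      by (intro alternates_differences lim) (use N in \<open>auto simp: shifted_def split: nat.splits\<close>)
    moreover have "?u l - shifted ?u l = - c l * x ^ l / x" for l
      using x by (cases l) (auto simp: shifted_def c field_simps)
    ultimately have "alternates (\<lambda>l. - c l * x ^ l / x) \<sigma> (Suc K) N0" by simp
    then have "alternates c (\<sigma> * (- 1)) (Suc K) N0"
      by (rule alternates_cong) (use x in \<open>auto simp: zero_less_mult_iff zero_less_divide_iff divide_less_0_iff mult_less_0_iff not_less\<close>)
    moreover have "\<forall>l<N0. c l = 0" using N by (auto simp: c shifted_def split: nat.splits)
    ultimately show ?thesis unfolding vanishes_or_varies_def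
      using N(1) by (intro disjI2 exI[of _ N0] exI[of _ "Suc K"] exI[of _ "- \<sigma>"]) auto
  qed
qed

section \<open>Descartes' bound for coefficients given by a polynomial\<close>

text \<open>The intermediate value theorem puts a root between two consecutive alternating values.
  The index \<open>i\<close> and the sign there are part of the conclusion because the induction
  needs them to separate the next root from those already counted.\<close>

lemma alternates_poly_roots:
  fixes p :: "real poly"
  assumes "alternates (\<lambda>l. poly p (real l)) \<sigma> k a"
  shows "\<exists>i\<ge>a. \<sigma> * poly p (real i) > 0 \<and> k \<le> card {x. x > real i \<and> poly p x = 0}"
  using assms
proof (induction k arbitrary: \<sigma> a)
  case (Suc k)
  then obtain i where i: "i \<ge> a" "\<sigma> * poly p (real i) > 0" 
    "alternates (\<lambda>l. poly p (real l)) (- \<sigma>) k (Suc i)" by auto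
  then obtain i' where i': "i' \<ge> Suc i" "- \<sigma> * poly p (real i') > 0" 
    "k \<le> card {x. x > real i' \<and> poly p x = 0}" using Suc.IH by blast
  have "poly p (real i) * poly p (real i') < 0"
    using i(2) i'(2) by (auto simp: zero_less_mult_iff mult_less_0_iff)
  then obtain x where x: "real i < x" "x < real i'" "poly p x = 0"
    using i' poly_IVT[of "real i" "real i'" p] by auto
  have "p \<noteq> 0" using i by auto
  then have fin: "finite {x. x > real i \<and> poly p x = 0}"
    by (auto intro: finite_subset[OF _ poly_roots_finite[of p]])
  have fin': "finite {x. x > real i' \<and> poly p x = 0}"
    by (rule finite_subset[OF _ fin]) (use i' in auto)
  have "Suc k \<le> card (insert x {x. x > real i' \<and> poly p x = 0})"
    using i' x fin' by auto
  also have "\<dots> \<le> card {x. x > real i \<and> poly p x = 0}"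
    by (rule card_mono[OF fin]) (use x i' in auto)
  finally show ?case using i by blast
qed auto

text \<open>Both contributions to \<open>N\<close> are roots of \<open>p\<close>: a vanishing
  coefficient with index at least \<open>L\<close> is a root at that index, and a sign change gives
  a root further right. At most \<open>L\<close> units of \<open>N\<close> are spent on indices
  below \<open>L\<close>, where nothing is known, so the degree condition leaves too many
  roots.\<close>

lemma descartes_bound:
  fixes p :: "real poly"
  assumes "vanishes_or_varies c N"
    and pos: "\<And>l. l \<ge> L \<Longrightarrow> W l > 0"
    and c: "\<And>l. l \<ge> L \<Longrightarrow> c l = W l * poly p (real l)"
    and deg: "degree p + L < N"
  shows "c l = 0"
proof -
  have False if N: "N \<le> N0 + K" "\<forall>l<N0. c l = 0" "alternates c \<sigma> K N0" for N0 K \<sigma>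
  proof -
    have to_p: "alternates (\<lambda>l. poly p (real l)) (\<sigma> * 1) k a" if "alternates c \<sigma> k a" "a \<ge> L" for \<sigma> k a
      by (rule alternates_cong[OF that(1)]) (use pos c \<open>a \<ge> L\<close> in \<open>auto simp: zero_less_mult_iff mult_less_0_iff, (metis order.trans order_less_asym)+\<close>)
    obtain i \<sigma>' k where *: "\<sigma>' * poly p (real i) > 0" "k \<le> card {x. x > real i \<and> poly p x = 0}"
       "N0 \<le> i" "(N0 - L) + k \<ge> N - L"
    proof (cases "N0 \<le> L")
      case True
      with N deg alternates_drop[OF N(3) True] obtain \<sigma>' where "alternates c \<sigma>' (K - (L - N0)) L" by fastforce
      then have "alternates (\<lambda>l. poly p (real l)) \<sigma>' (K - (L - N0)) L" using to_p by fastforce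
      from alternates_poly_roots[OF this] show ?thesis using True N deg that by fastforce
    next
      case False
      then have "alternates (\<lambda>l. poly p (real l)) \<sigma> K N0" using to_p[OF N(3)] by fastforce
      from alternates_poly_roots[OF this] show ?thesis using False N deg that by fastforce
    qed
    have "p \<noteq> 0" using * by auto
    note fin = poly_roots_finite[OF this]
    have "poly p (real l) = 0" if "L \<le> l" "l < N0" for l
      using N(2) c[of l] pos[of l] that by auto
    then have sub: "real ` {L..<N0} \<union> {x. x > real i \<and> poly p x = 0} \<subseteq> {x. poly p x = 0}" by auto
    have "N - L \<le> card (real ` {L..<N0}) + card {x. x > real i \<and> poly p x = 0}"
      using * by (simp add: card_image)
    also have "\<dots> = card (real ` {L..<N0} \<union> {x. x > real i \<and> poly p x = 0})"
      by (rule card_Un_disjoint[symmetric]) (use * in \<open>auto intro: finite_subset[OF _ fin]\<close>)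
    also have "\<dots> \<le> card {x. poly p x = 0}" by (rule card_mono[OF fin sub])
    also have "\<dots> \<le> degree p" by (rule card_poly_roots_bound[OF \<open>p \<noteq> 0\<close>])
    finally show False using deg by linarith
  qed
  then show ?thesis using assms(1) by (auto simp: vanishes_or_varies_def)
qed

section \<open>Zeros of a holomorphic function and its odd Taylor coefficients\<close>

text \<open>On the coefficients of odd index, read as a series in h, multiplication by z^2 - x^2 is
  multiplication by h - x^2, so each factor is one application of
  \<open>vanishes_or_varies_mult\<close>. Real parts can be taken because the factors have real
  coefficients. The null sequence required there comes from \<open>x i < r\<close>, which puts
  \<open>x i\<close> inside the disc of convergence of the remaining product.\<close>

lemma even_factors_odd_coeffs:
  assumes "finite I" "\<And>i. i \<in> I \<Longrightarrow> 0 \<le> x i \<and> x i < r"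
    and Q: "Q holomorphic_on ball 0 r"
    and F: "F has_fps_expansion f" "\<And>z. z \<in> ball 0 r \<Longrightarrow> F z = (\<Prod>i\<in>I. z\<^sup>2 - (of_real (x i))\<^sup>2) * Q z"
    and "r > 0"
  shows "vanishes_or_varies (\<lambda>l. Re (fps_nth f (2 * l + 1))) (card I)"
  using assms(1,2) F
proof (induction I arbitrary: F f rule: finite_induct)
  case empty
  then show ?case by (simp add: vanishes_or_varies_0)
next
  case (insert a I)
  let ?H = "\<lambda>z. (\<Prod>i\<in>I. z\<^sup>2 - (of_real (x i))\<^sup>2) * Q z"
  have hol: "?H holomorphic_on ball 0 r" by (intro holomorphic_intros Q)
  define h where "h = fps_expansion ?H 0"
  have h: "?H has_fps_expansion h" unfolding h_def
    by (rule has_fps_expansion_fps_expansion[OF _ _ hol]) (use \<open>r > 0\<close> in auto)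
  have IH: "vanishes_or_varies (\<lambda>l. Re (fps_nth h (2 * l + 1))) (card I)"
    by (rule insert.IH[OF _ h]) (use insert in auto)
  have *: "(\<lambda>z. (z\<^sup>2 - (of_real (x a))\<^sup>2) * ?H z) has_fps_expansion (fps_X^2 - fps_const ((of_real (x a))\<^sup>2)) * h"
    by (intro fps_expansion_intros h)
  have "eventually (\<lambda>z. F z = (z\<^sup>2 - (of_real (x a))\<^sup>2) * ?H z) (nhds 0)"
    using eventually_nhds_in_open[of "ball 0 r" 0] \<open>r > 0\<close>
    by (auto elim!: eventually_mono simp: insert mult.assoc)
  from has_fps_expansion_cong[OF this refl] *
  have "F has_fps_expansion (fps_X^2 - fps_const ((of_real (x a))\<^sup>2)) * h"
    by simp
  then have f: "f = (fps_X^2 - fps_const ((of_real (x a))\<^sup>2)) * h"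
    using insert.prems(2) fps_expansion_unique_complex by blast
  have "summable (\<lambda>k. fps_nth h k * of_real (x a) ^ k)"
  proof (rule summable_in_conv_radius)
    have "ereal (norm (complex_of_real (x a))) < ereal r" using insert by auto
    also have "ereal r \<le> fps_conv_radius h" unfolding h_def
      by (rule conv_radius_fps_expansion) (use hol in \<open>auto simp: eball_def\<close>)
    finally show "ereal (norm (complex_of_real (x a))) < conv_radius (fps_nth h)"
      by (simp add: fps_conv_radius_def)
  qed
  then have "(\<lambda>k. fps_nth h k * of_real (x a) ^ k) \<longlonglongrightarrow> 0" by (rule summable_LIMSEQ_zero)
  then have "(\<lambda>k. Re (fps_nth h k * of_real (x a) ^ k)) \<longlonglongrightarrow> 0" using tendsto_Re by fastforce
  then have "(\<lambda>k. Re (fps_nth h k) * x a ^ k) \<longlonglongrightarrow> 0" by (simp flip: of_real_power)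
  then have lim0: "(\<lambda>l. Re (fps_nth h (2 * l + 1)) * x a ^ (2 * l + 1)) \<longlonglongrightarrow> 0"
    by (rule filterlim_compose) (auto intro!: filterlim_subseq strict_monoI)
  \<comment> \<open>The known null sequence carries odd powers of \<open>x a\<close>, so one factor
    has to be divided off. For \<open>x a = 0\<close> the terms are 0 from index 1 on.\<close>
  have lim: "(\<lambda>l. Re (fps_nth h (2 * l + 1)) * ((x a)\<^sup>2) ^ l) \<longlonglongrightarrow> 0"
  proof (cases "x a = 0")
    case True
    have "eventually (\<lambda>l. Re (fps_nth h (2 * l + 1)) * ((x a)\<^sup>2) ^ l = 0) sequentially"
      using eventually_gt_at_top[of 0] by eventually_elim (simp add: True power_0_left)
    then show ?thesis by (rule tendsto_eventually)
  next
    case False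
    then show ?thesis using tendsto_divide[OF lim0 tendsto_const[of "x a"]]
      by (simp add: power_mult power2_eq_square power_mult_distrib mult.commute)
  qed
  show ?case unfolding card_insert_disjoint[OF insert(1,2)]
  proof (rule vanishes_or_varies_mult[OF IH _ lim])
    fix l
    have X2: "fps_nth (fps_X ^ 2 * h) (2 * l + 1) = (case l of 0 \<Rightarrow> 0 | Suc j \<Rightarrow> fps_nth h (2 * j + 1))"
      by (auto simp: fps_X_power_mult_nth split: nat.splits)
    show "Re (fps_nth f (2 * l + 1)) = shifted (\<lambda>l. Re (fps_nth h (2 * l + 1))) l - (x a)\<^sup>2 * Re (fps_nth h (2 * l + 1))"
      unfolding f left_diff_distrib fps_sub_nth X2
      by (auto simp: shifted_def simp flip: of_real_power split: nat.splits)
  qed (use insert in auto)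
qed

section \<open>Trigonometric moments\<close>

definition trig_moment :: "nat \<Rightarrow> nat \<Rightarrow> real" where
  "trig_moment p q = integral {0..2 * pi} (\<lambda>t. sin t ^ p * cos t ^ q)"

lemma trig_moment_integrable: "(\<lambda>t::real. sin t ^ p * cos t ^ q) integrable_on {0..2 * pi}"
  by (intro integrable_continuous_real continuous_intros)

lemma trig_moment_has_integral:
  "((\<lambda>t. sin t ^ p * cos t ^ q) has_integral trig_moment p q) {0..2 * pi}"
  unfolding trig_moment_def by (rule integrable_integral[OF trig_moment_integrable])

lemma DERIV_sin_power: "((\<lambda>t::real. sin t ^ (p + 1)) has_real_derivative (real p + 1) * (sin t ^ p * cos t)) (at t within S)"
  using DERIV_power_Suc[OF DERIV_subset[OF DERIV_sin[of t]], of S p] by (simp add: algebra_simps)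

lemma DERIV_cos_power: "((\<lambda>t::real. cos t ^ (q + 1)) has_real_derivative - (real q + 1) * (cos t ^ q * sin t)) (at t within S)"
  using DERIV_power_Suc[OF DERIV_subset[OF DERIV_cos[of t]], of S q] by (simp add: algebra_simps)

text \<open>The derivative of sin^(p+1) cos^(q+1) integrates to 0 over a period.\<close>

lemma trig_moment_parts: "(real p + 1) * trig_moment p (q + 2) = (real q + 1) * trig_moment (p + 2) q"
proof -
  have "((\<lambda>t. (real p + 1) * (sin t ^ p * cos t ^ (q + 2)) - (real q + 1) * (sin t ^ (p + 2) * cos t ^ q))
     has_integral (sin (2 * pi) ^ (p + 1) * cos (2 * pi) ^ (q + 1) - sin 0 ^ (p + 1) * cos 0 ^ (q + 1))) {0..2 * pi}"
  proof (rule fundamental_theorem_of_calculus)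
    fix t :: real
    have "((\<lambda>t. sin t ^ (p + 1) * cos t ^ (q + 1)) has_real_derivative
       (real p + 1) * (sin t ^ p * cos t) * cos t ^ (q + 1) + (- (real q + 1) * (cos t ^ q * sin t)) * sin t ^ (p + 1))
       (at t within {0..2 * pi})"
      by (rule DERIV_mult[OF DERIV_sin_power DERIV_cos_power])
    then show "((\<lambda>t. sin t ^ (p + 1) * cos t ^ (q + 1)) has_vector_derivative
      (real p + 1) * (sin t ^ p * cos t ^ (q + 2)) - (real q + 1) * (sin t ^ (p + 2) * cos t ^ q)) (at t within {0..2 * pi})"
      by (simp add: has_real_derivative_iff_has_vector_derivative algebra_simps)
  qed auto
  moreover have "((\<lambda>t. (real p + 1) * (sin t ^ p * cos t ^ (q + 2)) - (real q + 1) * (sin t ^ (p + 2) * cos t ^ q))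
     has_integral ((real p + 1) * trig_moment p (q + 2) - (real q + 1) * trig_moment (p + 2) q)) {0..2 * pi}"
    by (intro has_integral_diff has_integral_mult_right trig_moment_has_integral)
  ultimately show ?thesis by (auto dest: has_integral_unique)
qed

lemma trig_moment_odd_cos: "odd q \<Longrightarrow> trig_moment p q = 0"
proof (induction q arbitrary: p rule: nat_induct2)
  case 1
  have "((\<lambda>t. sin t ^ p * cos t ^ 1) has_integral (sin (2 * pi) ^ (p + 1) / (real p + 1) - sin 0 ^ (p + 1) / (real p + 1))) {0..2 * pi}"
  proof (rule fundamental_theorem_of_calculus)
    fix t :: real
    have "real p + 1 \<noteq> 0" by linarith
    with DERIV_cdivide[OF DERIV_sin_power[of p t "{0..2 * pi}"], of "real p + 1"]
    show "((\<lambda>t. sin t ^ (p + 1) / (real p + 1)) has_vector_derivative sin t ^ p * cos t ^ 1) (at t within {0..2 * pi})"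
      by (simp add: has_real_derivative_iff_has_vector_derivative)
  qed auto
  then show ?case using has_integral_unique[OF trig_moment_has_integral] by fastforce
next
  case (step q)
  have "(real p + 1) * trig_moment p (q + 2) = 0"
    using step by (subst trig_moment_parts) auto
  moreover have "real p + 1 \<noteq> 0" by linarith
  ultimately show ?case by simp
qed auto

text \<open>The reduction to a pure power of sine keeps the total exponent \<open>p + 2 * v\<close>.
  Moments with the same even total exponent therefore share one positive factor, and for fixed
  \<open>v\<close> the rest is a rational function of that exponent. This is the source of the
  polynomials behind the Taylor coefficients.\<close>

lemma trig_moment_even_cos:
  "trig_moment p (2 * v) = trig_moment (p + 2 * v) 0 * (\<Prod>i<v. (2 * real i + 1) / (real (p + 2 * v) - 1 - 2 * real i))"
proof (induction v arbitrary: p)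
  case (Suc v)
  have "real p + 1 \<noteq> 0" by linarith
  then have "trig_moment p (2 * Suc v) = (2 * real v + 1) / (real p + 1) * trig_moment (p + 2) (2 * v)"
    using trig_moment_parts[of p "2 * v"] by (simp add: field_simps)
  also have "\<dots> = trig_moment (p + 2 * Suc v) 0 * ((\<Prod>i<v. (2 * real i + 1) / (real (p + 2 * Suc v) - 1 - 2 * real i))
     * ((2 * real v + 1) / (real (p + 2 * Suc v) - 1 - 2 * real v)))"
  proof -
    have e: "p + 2 + 2 * v = p + 2 * Suc v" "real (p + 2 * Suc v) - 1 - 2 * real v = real p + 1" by simp_all
    have "a * (b * c) = b * (c * a)" for a b c :: real by simp
    then show ?thesis unfolding Suc.IH e .
  qed
  finally show ?case by simp
qed simp

lemma trig_moment_sin_rec: "(real p + 2) * trig_moment (p + 2) 0 = (real p + 1) * trig_moment p 0"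
proof -
  have "((\<lambda>t. sin t ^ p * cos t ^ 0 - sin t ^ (p + 2) * cos t ^ 0) has_integral (trig_moment p 0 - trig_moment (p + 2) 0)) {0..2 * pi}"
    by (intro has_integral_diff trig_moment_has_integral)
  moreover have "(\<lambda>t::real. sin t ^ p * cos t ^ 0 - sin t ^ (p + 2) * cos t ^ 0) = (\<lambda>t. sin t ^ p * cos t ^ 2)"
    by (rule ext, unfold cos_squared_eq power_add right_diff_distrib) simp
  ultimately have "trig_moment p 2 = trig_moment p 0 - trig_moment (p + 2) 0"
    using has_integral_unique[OF trig_moment_has_integral] by metis
  moreover have "(real p + 1) * trig_moment p 2 = trig_moment (p + 2) 0"
    using trig_moment_parts[of p 0] by (simp add: numeral_2_eq_2)
  ultimately have "(real p + 1) * (trig_moment p 0 - trig_moment (p + 2) 0) = trig_moment (p + 2) 0" by simp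
  then show ?thesis by (simp add: algebra_simps)
qed

lemma trig_moment_sin_pos: "trig_moment (2 * l) 0 > 0"
proof (induction l)
  case 0
  then show ?case by (simp add: trig_moment_def)
next
  case (Suc l)
  have "(real (2 * l) + 2) * trig_moment (2 * l + 2) 0 > 0"
    unfolding trig_moment_sin_rec by (rule mult_pos_pos) (use Suc in auto)
  then show ?case by (simp add: zero_less_mult_iff)
qed

lemma trig_moment_sin_odd: "odd p \<Longrightarrow> trig_moment p 0 = 0"
proof (induction p rule: nat_induct2)
  case 1
  have "((\<lambda>t. sin t ^ 1 * cos t ^ 0) has_integral (- cos (2 * pi) - - cos 0)) {0..2 * pi}"
    by (rule fundamental_theorem_of_calculus)
       (auto intro!: derivative_eq_intros simp: has_real_derivative_iff_has_vector_derivative[symmetric])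
  then show ?case using has_integral_unique[OF trig_moment_has_integral] by fastforce
next
  case (step p)
  then have "(real p + 2) * trig_moment (p + 2) 0 = 0" by (subst trig_moment_sin_rec) auto
  moreover have "real p + 2 \<noteq> 0" by linarith
  ultimately show ?case by simp
qed auto

lemma trig_moment_odd: "odd (p + q) \<Longrightarrow> trig_moment p q = 0"
  by (cases "odd q") (auto simp: trig_moment_odd_cos trig_moment_even_cos trig_moment_sin_odd elim!: evenE)

section \<open>Expansion of the trigonometric quotients in the radius\<close>

lemma sums_inverse_power:
  fixes w :: complex
  assumes "norm w < 1"
  shows "(\<lambda>k. of_nat (m + k choose k) * w ^ k) sums (1 / (1 - w) ^ Suc m)"
proof -
  have "(\<lambda>k. ((- of_nat (Suc m)) gchoose k) * (- w) ^ k) sums (1 + (- w)) powr (- of_nat (Suc m))"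
    by (rule gen_binomial_complex) (use assms in auto)
  moreover have "((- of_nat (Suc m)) gchoose k) * (- w) ^ k = of_nat (m + k choose k) * w ^ k" for k
  proof -
    have "of_nat (Suc m) + of_nat k - 1 = (of_nat (m + k) :: complex)" by simp
    then have "((- of_nat (Suc m)) gchoose k) = (- 1) ^ k * (of_nat (m + k choose k) :: complex)"
      unfolding binomial_gbinomial using gbinomial_minus[of "of_nat (Suc m) :: complex" k] by metis
    moreover have "(- 1) ^ k * c * (- w) ^ k = c * w ^ k" for c
      by (metis (no_types, lifting) mult.assoc mult.commute mult_minus1 mult_minus_left power_mult_distrib minus_minus)
    ultimately show ?thesis by metis
  qed
  moreover have "(1 + (- w)) powr (- of_nat (Suc m)) = 1 / (1 - w) ^ Suc m"
  proof -
    have "1 - w \<noteq> 0" using assms by auto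
    then have a: "(1 - w) powr of_nat (Suc m) = (1 - w) ^ Suc m" by (intro powr_nat') auto
    have "(1 - w) powr (- of_nat (Suc m)) = 1 / (1 - w) ^ Suc m"
      unfolding powr_minus a by (rule inverse_eq_divide)
    then show ?thesis by (simp only: diff_conv_add_uminus)
  qed
  ultimately show ?thesis by (simp only:)
qed

lemma sums_trig_quotient:
  fixes z :: complex
  assumes "norm (of_real \<alpha> * z) < 1"
  shows "(\<lambda>k. of_nat (m + k choose k) * (of_real \<alpha> * z) ^ k * of_real (trig_moment (p + k) q)) sums
    integral {0..2 * pi} (\<lambda>t. of_real (sin t ^ p * cos t ^ q) / (1 - of_real \<alpha> * z * of_real (sin t)) ^ Suc m)"
    (is "_ sums integral _ ?g")
proof -
  let ?w = "of_real \<alpha> * z"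
  let ?f = "\<lambda>k t. of_real (sin t ^ p * cos t ^ q) * (of_nat (m + k choose k) * (?w * of_real (sin t)) ^ k)"
  have small: "norm (?w * of_real (sin t)) \<le> norm ?w" for t :: real
    by (simp add: norm_mult mult_left_le)
  have sums: "(\<lambda>k. ?f k t) sums ?g t" for t
  proof -
    have "(\<lambda>k. ?f k t) sums (of_real (sin t ^ p * cos t ^ q) * (1 / (1 - ?w * of_real (sin t)) ^ Suc m))"
      by (intro sums_mult sums_inverse_power) (use small[of t] assms in linarith)
    then show ?thesis by simp
  qed
  \<comment> \<open>The negative binomial series has radius of convergence at least 1, so it
    converges absolutely at \<open>norm ?w\<close>; these terms dominate the integrands for every
    angle.\<close>
  have M: "summable (\<lambda>k. real (m + k choose k) * norm ?w ^ k)"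
  proof -
    have "summable (\<lambda>k. norm (of_nat (m + k choose k) * of_real (norm ?w) ^ k :: complex))"
    proof (rule abs_summable_in_conv_radius)
      have "ereal (norm (of_real (norm ?w) :: complex)) < 1" using assms by simp
      also have "1 \<le> conv_radius (\<lambda>k. of_nat (m + k choose k) :: complex)"
      proof (rule conv_radius_geI_ex)
        fix r :: real assume "0 < r" "ereal r < 1"
        then have "norm (of_real r :: complex) = r" "summable (\<lambda>k. of_nat (m + k choose k) * (of_real r :: complex) ^ k)"
          using sums_inverse_power[of "of_real r" m] by (auto simp: sums_iff)
        then show "\<exists>z::complex. norm z = r \<and> summable (\<lambda>k. of_nat (m + k choose k) * z ^ k)" by blast
      qed
      finally show "ereal (norm (of_real (norm ?w) :: complex)) < conv_radius (\<lambda>k. of_nat (m + k choose k) :: complex)" .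
    qed
    then show ?thesis by (simp add: norm_mult norm_power)
  qed
  have "uniform_limit {0..2 * pi} (\<lambda>n t. \<Sum>k<n. ?f k t) (\<lambda>t. \<Sum>k. ?f k t) sequentially"
  proof (rule Weierstrass_m_test[OF _ M])
    fix k and t :: real
    have "norm (?f k t) = \<bar>sin t ^ p * cos t ^ q\<bar> * (real (m + k choose k) * norm (?w * of_real (sin t)) ^ k)"
      by (simp add: norm_mult norm_power power_mult_distrib abs_mult power_abs)
    also have "\<dots> \<le> 1 * (real (m + k choose k) * norm ?w ^ k)"
    proof (intro mult_mono mult_left_mono power_mono small)
      show "\<bar>sin t ^ p * cos t ^ q\<bar> \<le> 1"
        unfolding abs_mult power_abs by (intro mult_le_one power_le_one) auto
    qed auto
    finally show "norm (?f k t) \<le> real (m + k choose k) * norm ?w ^ k" by simp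
  qed
  then obtain I J where IJ: "\<And>n. ((\<lambda>t. \<Sum>k<n. ?f k t) has_integral I n) {0..2 * pi}"
     "((\<lambda>t. \<Sum>k. ?f k t) has_integral J) {0..2 * pi}" "I \<longlonglongrightarrow> J"
    by (rule uniform_limit_integral) (auto intro!: continuous_intros)
  have fk: "(?f k has_integral (of_nat (m + k choose k) * ?w ^ k * of_real (trig_moment (p + k) q))) {0..2 * pi}" for k
  proof -
    have "((\<lambda>t. of_nat (m + k choose k) * ?w ^ k * of_real (sin t ^ (p + k) * cos t ^ q)) has_integral
      (of_nat (m + k choose k) * ?w ^ k * of_real (trig_moment (p + k) q))) {0..2 * pi}"
      by (intro has_integral_mult_right has_integral_of_real trig_moment_has_integral)
    then show ?thesis by (simp add: power_mult_distrib power_add mult_ac)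
  qed
  have "((\<lambda>t. \<Sum>k<n. ?f k t) has_integral (\<Sum>k<n. of_nat (m + k choose k) * ?w ^ k * of_real (trig_moment (p + k) q))) {0..2 * pi}" for n
    by (intro has_integral_sum fk) auto
  then have "I = (\<lambda>n. \<Sum>k<n. of_nat (m + k choose k) * ?w ^ k * of_real (trig_moment (p + k) q))"
    using IJ(1) has_integral_unique by blast
  moreover have "J = integral {0..2 * pi} ?g"
    using IJ(2) sums by (simp add: sums_iff integral_unique)
  ultimately show ?thesis using IJ(3) by (simp only: sums_def)
qed

section \<open>Taylor coefficients as values of polynomials\<close>

text \<open>Stated as a sum so that N/2 rounded up, the number of odd roots, and N/2 rounded down,
  the threshold index, cancel exactly in the degree count.\<close>

lemma card_odd_ints: "card {e::int. 1 \<le> e \<and> e \<le> int N \<and> odd e} + N div 2 = N"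
proof -
  have "{e::int. 1 \<le> e \<and> e \<le> int N \<and> odd e} = (\<lambda>i. 2 * int i + 1) ` {..<(N + 1) div 2}"
  proof (intro equalityI subsetI)
    fix e :: int assume e: "e \<in> {e. 1 \<le> e \<and> e \<le> int N \<and> odd e}"
    then obtain k where k: "e = 2 * k + 1" by (auto elim: oddE)
    with e have "k \<ge> 0" "nat k < (N + 1) div 2" by auto
    then show "e \<in> (\<lambda>i. 2 * int i + 1) ` {..<(N + 1) div 2}"
      using k by (intro image_eqI[of _ _ "nat k"]) auto
  qed auto
  then have "card {e::int. 1 \<le> e \<and> e \<le> int N \<and> odd e} = (N + 1) div 2"
    by (simp add: card_image inj_on_def)
  then show ?thesis by presburger
qed

text \<open>The variable is \<open>l\<close>, but the roots \<open>e\<close> refer to 2(l + 1), the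
  exponent of the radius in \<Phi>.\<close>

definition root_poly :: "int set \<Rightarrow> real poly" where
  "root_poly A = (\<Prod>e\<in>A. [:2 - of_int e, 2:])"

lemma poly_root_poly: "poly (root_poly A) (real l) = (\<Prod>e\<in>A. 2 * real (Suc l) - of_int e)"
  unfolding root_poly_def poly_prod by (intro prod.cong) (auto simp: algebra_simps)

lemma degree_root_poly: "degree (root_poly A) \<le> card A"
proof -
  have "degree (root_poly A) \<le> (\<Sum>e\<in>A. degree [:2 - of_int e, 2 :: real:])"
    unfolding root_poly_def using degree_prod_sum_le[of A "\<lambda>e. [:2 - of_int e, 2 :: real:]"]
    by (cases "finite A") (auto simp: o_def)
  then show ?thesis by simp
qed

lemma binomial_prod: "real (m + k choose k) * fact m = (\<Prod>r\<in>{1..m}. real (k + r))"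
proof -
  have "real (m + k choose k) * fact m = fact (m + k) / fact k"
    by (simp add: binomial_fact)
  also have "\<dots> = (\<Prod>r\<in>{1..m}. real (k + r))"
  proof (induction m)
    case (Suc m)
    have "fact (Suc m + k) / fact k = real (k + Suc m) * (fact (m + k) / fact k)"
      by (simp add: algebra_simps)
    then show ?case unfolding Suc.IH by simp
  qed simp
  finally show ?thesis .
qed

text \<open>Coefficient of z^(2L) in z^(p + q) times the trigonometric quotient with \<alpha> = 1:
  the term of index k = 2L - (p + q) has sine exponent p + k = 2L - q.\<close>

definition moment_coeff :: "nat \<Rightarrow> nat \<Rightarrow> nat \<Rightarrow> nat \<Rightarrow> real" where
  "moment_coeff m p q L = (if p + q \<le> 2 * L
     then real (m + (2 * L - (p + q)) choose (2 * L - (p + q))) * trig_moment (2 * L - q) q else 0)"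

text \<open>As a function of \<open>L\<close>, \<open>moment_coeff m p q L\<close> is a positive weight times a rational function. Its
  numerator has the roots \<open>2 L = d - m, \<dots>, d - 1\<close> with \<open>d = p + q\<close>, its denominator the roots
  \<open>2 L = 1, 3, \<dots>, q - 1\<close>. For \<open>1 \<le> d \<le> n + 1\<close> the odd numbers up to \<open>n - m\<close> are a common denominator,
  and the integers in \<open>[n - m + 1, 0]\<close> are common roots.\<close>

definition odd_roots :: "nat \<Rightarrow> nat \<Rightarrow> int set" where
  "odd_roots m n = {e. 1 \<le> e \<and> e \<le> int (n - m) \<and> odd e}"

definition common_roots :: "nat \<Rightarrow> nat \<Rightarrow> int set" where
  "common_roots m n = {int n - int m + 1..0}"

definition moment_weight :: "nat \<Rightarrow> nat \<Rightarrow> nat \<Rightarrow> real" where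
  "moment_weight m n l = trig_moment (2 * Suc l) 0 / fact m *
     ((\<Prod>e\<in>common_roots m n. 2 * real (Suc l) - of_int e) / (\<Prod>e\<in>odd_roots m n. 2 * real (Suc l) - of_int e))"

lemma finite_odd_roots: "finite (odd_roots m n)"
  by (rule finite_subset[of _ "{1..int (n - m)}"]) (auto simp: odd_roots_def)

text \<open>From the threshold on, 2(l + 1) exceeds n - m and hence every odd root in the
  denominator; the common roots are not positive anyway.\<close>

lemma moment_weight_pos: "(n - m) div 2 \<le> l \<Longrightarrow> moment_weight m n l > 0"
  unfolding moment_weight_def
  by (intro mult_pos_pos divide_pos_pos prod_pos trig_moment_sin_pos)
     (auto simp: odd_roots_def common_roots_def)

text \<open>After cancellation at most
  \<open>m - card (common_roots m n) + card (odd_roots m n)\<close> linear factors remain. For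
  \<open>m \<le> n\<close> this is m plus half of n - m rounded up, and for \<open>n < m\<close> it
  is n. Either way the sum with \<open>(n - m) div 2\<close> is at most n.\<close>

lemma moment_coeff_poly:
  assumes d: "1 \<le> p + q" "p + q \<le> n + 1"
  shows "\<exists>P. degree P + (n - m) div 2 \<le> n \<and>
    (\<forall>l\<ge>(n - m) div 2. moment_coeff m p q (Suc l) = moment_weight m n l * poly P (real l))"
proof (cases "odd q")
  case True
  then show ?thesis by (intro exI[of _ 0]) (auto simp: moment_coeff_def trig_moment_odd_cos)
next
  case False
  then obtain v where q: "q = 2 * v" by auto
  define d where "d = p + q"
  define A where "A = {int d - int m..int d - 1}"
  define B where "B = (\<lambda>i. 2 * int i + 1) ` {..<v}"
  let ?O = "odd_roots m n" and ?Z = "common_roots m n"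
  have fin: "finite A" "finite B" "finite ?O" "finite ?Z"
    by (auto simp: A_def B_def finite_odd_roots common_roots_def)
  have ZA: "?Z \<subseteq> A" using d by (auto simp: A_def d_def common_roots_def)
  have ZB: "?Z \<inter> B = {}" by (auto simp: B_def common_roots_def)
  \<comment> \<open>An odd root of the denominator that exceeds n - m is at least d - m and less
    than d, so the numerator cancels it.\<close>
  have BO: "B - A \<subseteq> ?O" using d by (auto simp: A_def B_def odd_roots_def d_def q)
  have cA: "card A = m" by (simp add: A_def)
  define P where "P = root_poly (A - (?Z \<union> B)) * root_poly (?O - (B - A))"
  have "degree P \<le> card (A - (?Z \<union> B)) + card (?O - (B - A))"
    unfolding P_def using degree_mult_le degree_root_poly add_mono order_trans by metis
  also have "\<dots> \<le> (card A - card ?Z) + card ?O"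
    using card_Diff_subset[OF fin(4) ZA] fin by (intro add_mono card_mono) (metis Diff_mono Un_upper1 card_mono finite_Diff order_refl, auto)
  finally have deg: "degree P + (n - m) div 2 \<le> n"
    using card_odd_ints[of "n - m"] cA unfolding odd_roots_def[symmetric] by (auto simp: common_roots_def)
  let ?c = "\<Prod>i<v. 2 * real i + 1"
  show ?thesis
  proof (intro exI[of _ "smult ?c P"] conjI allI impI)
    show "degree (smult ?c P) + (n - m) div 2 \<le> n" using deg degree_smult_le[of ?c P] by linarith
    fix l assume l: "(n - m) div 2 \<le> l"
    let ?t = "\<lambda>e. 2 * real (Suc l) - of_int e"
    have nzO: "prod ?t ?O \<noteq> 0" using l finite_odd_roots by (auto simp: odd_roots_def)
    have nzB: "prod ?t B \<noteq> 0"
    proof -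
      have "2 * real (Suc l) \<noteq> of_int (2 * int i + 1)" for i
      proof
        assume "2 * real (Suc l) = of_int (2 * int i + 1)"
        then have "2 * Suc l = 2 * i + 1" by linarith
        then show False by presburger
      qed
      then show ?thesis using fin by (auto simp: B_def)
    qed
    \<comment> \<open>The identity A / B = (Z / O) * P between the products, cleared of
      denominators.\<close>
    have key: "prod ?t A * prod ?t ?O = prod ?t ?Z * prod ?t B * poly P (real l)"
    proof -
      have "prod ?t A = prod ?t (A - (?Z \<union> B)) * prod ?t (?Z \<union> (A \<inter> B))"
        using ZA fin by (subst prod.subset_diff[of "?Z \<union> (A \<inter> B)" A]) (auto intro!: arg_cong2[where f = "(*)"] prod.cong)
      also have "prod ?t (?Z \<union> (A \<inter> B)) = prod ?t ?Z * prod ?t (A \<inter> B)"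
        using ZB fin by (intro prod.union_disjoint) auto
      finally have 1: "prod ?t A = prod ?t (A - (?Z \<union> B)) * (prod ?t ?Z * prod ?t (A \<inter> B))" .
      have 2: "prod ?t ?O = prod ?t (?O - (B - A)) * prod ?t (B - A)"
        by (rule prod.subset_diff[OF BO]) (use fin in auto)
      have "B = (A \<inter> B) \<union> (B - A)" by auto
      then have 3: "prod ?t B = prod ?t (A \<inter> B) * prod ?t (B - A)"
        using fin prod.union_disjoint[of "A \<inter> B" "B - A" ?t] by auto
      show ?thesis unfolding 1 2 3 P_def poly_mult poly_root_poly by simp
    qed
    have A_eq: "prod ?t A = (if d \<le> 2 * Suc l then real (m + (2 * Suc l - d) choose (2 * Suc l - d)) * fact m else 0)"
    proof (cases "d \<le> 2 * Suc l")
      case True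
      have "prod ?t A = (\<Prod>r\<in>{1..m}. real (2 * Suc l - d + r))"
        by (rule prod.reindex_bij_witness[of _ "\<lambda>r. int d - int r" "\<lambda>e. nat (int d - e)"])
           (use True in \<open>auto simp: A_def of_nat_diff\<close>)
      then show ?thesis using True by (simp only: binomial_prod if_True)
    next
      case False
      \<comment> \<open>Below the first power of z that occurs, \<open>moment_coeff\<close> is 0 by
        definition. The formula agrees there because 2(l + 1) is one of the \<open>m\<close> roots
        of the numerator; this is a second place where \<open>l\<close> has to be past the
        threshold.\<close>
      then have "2 * int (Suc l) \<in> A" using l d by (auto simp: A_def d_def)
      then show ?thesis using False fin by (auto intro!: bexI[of _ "2 * int (Suc l)"])
    qed
    have B_eq: "prod ?t B = (\<Prod>i<v. 2 * real (Suc l) - 1 - 2 * real i)"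
      unfolding B_def by (subst prod.reindex) (auto simp: inj_on_def algebra_simps)
    show "moment_coeff m p q (Suc l) = moment_weight m n l * poly (smult ?c P) (real l)"
    proof (cases "d \<le> 2 * Suc l")
      case True
      have "2 * Suc l - q + 2 * v = 2 * Suc l" using True by (simp add: d_def q)
      then have tm: "trig_moment (2 * Suc l - q) q = trig_moment (2 * Suc l) 0 * (?c / prod ?t B)"
        unfolding q trig_moment_even_cos B_eq prod_dividef by simp
      have "moment_coeff m p q (Suc l) = prod ?t A / fact m * trig_moment (2 * Suc l - q) q"
        unfolding A_eq moment_coeff_def using True by (simp add: d_def)
      also have "prod ?t A = prod ?t ?Z * prod ?t B * poly P (real l) / prod ?t ?O"
        using key nzO by (simp add: field_simps)
      finally have "moment_coeff m p q (Suc l) =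
         prod ?t ?Z * prod ?t B * poly P (real l) / prod ?t ?O / fact m *
         (trig_moment (2 * Suc l) 0 * (?c / prod ?t B))" unfolding tm .
      moreover have "z * b * p / o' / f * (t * (c / b)) = t / f * (z / o') * (c * p)" if "b \<noteq> 0" for z b p o' f t c :: real
        using that by (simp add: mult_ac)
      ultimately show ?thesis unfolding moment_weight_def poly_smult using nzB by metis
    next
      case False
      then have "prod ?t ?Z * poly P (real l) = 0" using key nzB A_eq by simp
      then show ?thesis using False by (auto simp: moment_coeff_def moment_weight_def d_def)
    qed
  qed
qed

section \<open>The averaged function\<close>

text \<open>Coefficient of z^N in z^(p + q - 1) times the trigonometric quotient. The exponent is
  one lower than in \<Phi>, since \<open>averaged\<close> stands for \<Phi>(r^2) / r.\<close>

definition averaged_coeff :: "nat \<Rightarrow> real \<Rightarrow> nat \<Rightarrow> nat \<Rightarrow> nat \<Rightarrow> real" where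
  "averaged_coeff m \<alpha> p q N = (if p + q \<le> N + 1
     then real (m + (N + 1 - (p + q)) choose (N + 1 - (p + q))) * \<alpha> ^ (N + 1 - (p + q)) * trig_moment (N + 1 - q) q else 0)"

definition trig_quotient :: "nat \<Rightarrow> real \<Rightarrow> nat \<Rightarrow> nat \<Rightarrow> complex \<Rightarrow> complex" where
  "trig_quotient m \<alpha> p q z =
     integral {0..2 * pi} (\<lambda>t. of_real (sin t ^ p * cos t ^ q) / (1 - of_real \<alpha> * z * of_real (sin t)) ^ Suc m)"

text \<open>For real \<open>r\<close> this is \<open>\<Phi>(r\<^sup>2) / r\<close>, extended holomorphically to complex \<open>r\<close>; the exponent of
  the denominator is \<open>m + 1\<close>.\<close>

definition averaged :: "nat \<Rightarrow> real \<Rightarrow> nat \<Rightarrow> coeffs \<Rightarrow> coeffs \<Rightarrow> complex \<Rightarrow> complex" where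
  "averaged m \<alpha> n a b z = (\<Sum>(i, j)\<in>indices n. z ^ (i + j) *
     (of_real (a i j) * trig_quotient m \<alpha> (i + 1) j z + of_real (b i j) * trig_quotient m \<alpha> i (j + 1) z))"

definition averaged_series :: "nat \<Rightarrow> real \<Rightarrow> nat \<Rightarrow> coeffs \<Rightarrow> coeffs \<Rightarrow> nat \<Rightarrow> real" where
  "averaged_series m \<alpha> n a b N = (\<Sum>(i, j)\<in>indices n.
     a i j * averaged_coeff m \<alpha> (i + 1) j N + b i j * averaged_coeff m \<alpha> i (j + 1) N)"

lemma sums_trig_quotient_shifted:
  assumes "norm (of_real \<alpha> * z) < 1" and d: "p + q = Suc s"
  shows "(\<lambda>N. of_real (averaged_coeff m \<alpha> p q N) * z ^ N) sums (z ^ s * trig_quotient m \<alpha> p q z)"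
proof -
  have "(\<lambda>k. z ^ s * (of_nat (m + k choose k) * (of_real \<alpha> * z) ^ k * of_real (trig_moment (p + k) q)))
    sums (z ^ s * trig_quotient m \<alpha> p q z)"
    unfolding trig_quotient_def by (intro sums_mult sums_trig_quotient assms)
  moreover have "z ^ s * (of_nat (m + k choose k) * (of_real \<alpha> * z) ^ k * of_real (trig_moment (p + k) q))
    = of_real (averaged_coeff m \<alpha> p q (k + s)) * z ^ (k + s)" for k
  proof -
    have "k + s + 1 - q = p + k" using d by simp
    then show ?thesis using d by (simp add: averaged_coeff_def power_add power_mult_distrib)
  qed
  ultimately have "(\<lambda>k. of_real (averaged_coeff m \<alpha> p q (k + s)) * z ^ (k + s))
    sums (z ^ s * trig_quotient m \<alpha> p q z)" by simp
  then show ?thesis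
    by (subst (asm) sums_zero_iff_shift) (use d in \<open>auto simp: averaged_coeff_def\<close>)
qed

lemma sums_averaged:
  assumes "norm (of_real \<alpha> * z) < 1"
  shows "(\<lambda>N. of_real (averaged_series m \<alpha> n a b N) * z ^ N) sums averaged m \<alpha> n a b z"
proof -
  have "(\<lambda>N. \<Sum>(i, j)\<in>indices n. of_real (a i j) * (of_real (averaged_coeff m \<alpha> (i + 1) j N) * z ^ N) +
       of_real (b i j) * (of_real (averaged_coeff m \<alpha> i (j + 1) N) * z ^ N)) sums
    (\<Sum>(i, j)\<in>indices n. of_real (a i j) * (z ^ (i + j) * trig_quotient m \<alpha> (i + 1) j z) +
       of_real (b i j) * (z ^ (i + j) * trig_quotient m \<alpha> i (j + 1) z))"
    unfolding case_prod_beta by (intro sums_sum sums_add sums_mult sums_trig_quotient_shifted assms) auto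
  then show ?thesis
    by (simp add: averaged_def averaged_series_def case_prod_beta sum_distrib_left sum_distrib_right algebra_simps)
qed

lemma averaged_has_fps_expansion:
  "averaged m \<alpha> n a b has_fps_expansion Abs_fps (\<lambda>N. of_real (averaged_series m \<alpha> n a b N))"
proof (rule has_fps_expansionI)
  have "eventually (\<lambda>z::complex. norm (of_real \<alpha> * z) < 1) (nhds 0)"
    by (rule order_tendstoD) (auto intro!: tendsto_eq_intros filterlim_ident)
  then show "eventually (\<lambda>z. (\<lambda>N. fps_nth (Abs_fps (\<lambda>N. of_real (averaged_series m \<alpha> n a b N))) N * z ^ N)
     sums averaged m \<alpha> n a b z) (nhds 0)"
    by eventually_elim (simp add: sums_averaged)
qed

lemma averaged_series_even: "even N \<Longrightarrow> averaged_series m \<alpha> n a b N = 0"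
proof -
  assume "even N"
  then have "averaged_coeff m \<alpha> p q N = 0" for p q
    using trig_moment_odd[of "N + 1 - q" q] by (auto simp: averaged_coeff_def)
  then show ?thesis by (auto simp: averaged_series_def intro: sum.neutral)
qed

text \<open>The index \<open>2 * l + 1\<close> belongs to the power 2(l + 1) of r in \<Phi>, hence
  \<open>Suc l\<close> in \<open>moment_coeff\<close>. The even power of \<alpha> is positive for
  either sign of \<alpha>; the remaining factor \<alpha>^(-(p + q)) does not depend on
  \<open>l\<close> and is absorbed into the polynomial.\<close>

lemma averaged_series_odd:
  assumes "\<alpha> \<noteq> 0"
  shows "\<exists>P. degree P + (n - m) div 2 \<le> n \<and> (\<forall>l\<ge>(n - m) div 2.
    averaged_series m \<alpha> n a b (2 * l + 1) = \<alpha> ^ (2 * Suc l) * moment_weight m n l * poly P (real l))"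
proof -
  have "\<exists>P. degree P + (n - m) div 2 \<le> n \<and> (\<forall>l\<ge>(n - m) div 2.
     averaged_coeff m \<alpha> p q (2 * l + 1) = \<alpha> ^ (2 * Suc l) * moment_weight m n l * poly P (real l))"
    if d: "1 \<le> p + q" "p + q \<le> n + 1" for p q
  proof -
    obtain P where P: "degree P + (n - m) div 2 \<le> n" "\<forall>l\<ge>(n - m) div 2.
      moment_coeff m p q (Suc l) = moment_weight m n l * poly P (real l)"
      using moment_coeff_poly[OF d] by blast
    have "averaged_coeff m \<alpha> p q (2 * l + 1) = \<alpha> ^ (2 * Suc l) * (1 / \<alpha> ^ (p + q)) * moment_coeff m p q (Suc l)" for l
      using assms by (auto simp: averaged_coeff_def moment_coeff_def power_diff)
    then show ?thesis using P degree_smult_le[of "1 / \<alpha> ^ (p + q)" P]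
      by (intro exI[of _ "smult (1 / \<alpha> ^ (p + q)) P"]) auto
  qed
  then obtain P where P: "\<And>p q. 1 \<le> p + q \<Longrightarrow> p + q \<le> n + 1 \<Longrightarrow> degree (P p q) + (n - m) div 2 \<le> n \<and> (\<forall>l\<ge>(n - m) div 2.
     averaged_coeff m \<alpha> p q (2 * l + 1) = \<alpha> ^ (2 * Suc l) * moment_weight m n l * poly (P p q) (real l))"
    by metis
  define R where "R = (\<Sum>(i, j)\<in>indices n. smult (a i j) (P (i + 1) j) + smult (b i j) (P i (j + 1)))"
  have deg: "degree (smult c (P p q)) \<le> n - (n - m) div 2" if "1 \<le> p + q" "p + q \<le> n + 1" for p q c
    using P[OF that] degree_smult_le[of c "P p q"] by linarith
  have "degree R \<le> n - (n - m) div 2"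
    unfolding R_def case_prod_beta
    by (intro degree_sum_le degree_add_le deg finite_indices) (auto simp: indices_def)
  then have "degree R + (n - m) div 2 \<le> n" by (auto simp: le_diff_conv2)
  moreover have "averaged_series m \<alpha> n a b (2 * l + 1) = \<alpha> ^ (2 * Suc l) * moment_weight m n l * poly R (real l)"
    if l: "(n - m) div 2 \<le> l" for l
  proof -
    have "averaged_series m \<alpha> n a b (2 * l + 1) = (\<Sum>(i, j)\<in>indices n. \<alpha> ^ (2 * Suc l) * moment_weight m n l *
      (a i j * poly (P (i + 1) j) (real l) + b i j * poly (P i (j + 1)) (real l)))"
      unfolding averaged_series_def
    proof (rule sum.cong[OF refl], clarify)
      fix i j assume "(i, j) \<in> indices n"
      then have "averaged_coeff m \<alpha> (i + 1) j (2 * l + 1) = \<alpha> ^ (2 * Suc l) * moment_weight m n l * poly (P (i + 1) j) (real l)"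
        "averaged_coeff m \<alpha> i (j + 1) (2 * l + 1) = \<alpha> ^ (2 * Suc l) * moment_weight m n l * poly (P i (j + 1)) (real l)"
        using P[of "i + 1" j] P[of i "j + 1"] l by (auto simp: indices_def)
      then show "a i j * averaged_coeff m \<alpha> (i + 1) j (2 * l + 1) + b i j * averaged_coeff m \<alpha> i (j + 1) (2 * l + 1) =
         \<alpha> ^ (2 * Suc l) * moment_weight m n l * (a i j * poly (P (i + 1) j) (real l) + b i j * poly (P i (j + 1)) (real l))"
        by (simp only: distrib_left mult_ac)
    qed
    also have "\<dots> = \<alpha> ^ (2 * Suc l) * moment_weight m n l * poly R (real l)"
      unfolding R_def poly_sum sum_distrib_left case_prod_beta by simp
    finally show ?thesis .
  qed
  ultimately show ?thesis by blast
qed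

text \<open>The \<open>n + 1\<close> quadratic factors exceed by one what
  \<open>descartes_bound\<close> tolerates, so all odd coefficients vanish; the even ones vanish by
  parity of the moments.\<close>

lemma averaged_eq_0:
  assumes "\<alpha> \<noteq> 0" "r > 0" and x: "\<And>i. i \<le> n \<Longrightarrow> 0 \<le> x i \<and> x i < r"
    and Q: "Q holomorphic_on ball 0 r"
    and H: "\<And>z. z \<in> ball 0 r \<Longrightarrow> averaged m \<alpha> n a b z = (\<Prod>i\<le>n. z\<^sup>2 - (of_real (x i))\<^sup>2) * Q z"
    and z: "norm (of_real \<alpha> * z) < 1"
  shows "averaged m \<alpha> n a b z = 0"
proof -
  have "vanishes_or_varies (\<lambda>l. Re (fps_nth (Abs_fps (\<lambda>N. of_real (averaged_series m \<alpha> n a b N) :: complex)) (2 * l + 1))) (card {..n})"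
    by (rule even_factors_odd_coeffs[OF _ _ Q averaged_has_fps_expansion H \<open>r > 0\<close>]) (use x in auto)
  then have v: "vanishes_or_varies (\<lambda>l. averaged_series m \<alpha> n a b (2 * l + 1)) (Suc n)" by simp
  obtain P where P: "degree P + (n - m) div 2 \<le> n" "\<And>l. l \<ge> (n - m) div 2 \<Longrightarrow>
    averaged_series m \<alpha> n a b (2 * l + 1) = \<alpha> ^ (2 * Suc l) * moment_weight m n l * poly P (real l)"
    using averaged_series_odd[OF assms(1)] by blast
  have odd: "averaged_series m \<alpha> n a b (2 * l + 1) = 0" for l
  proof (rule descartes_bound[OF v _ P(2)])
    fix l assume "(n - m) div 2 \<le> l"
    moreover have "\<alpha> ^ (2 * Suc l) > 0" using \<open>\<alpha> \<noteq> 0\<close> by (simp only: zero_less_power_eq) simp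
    ultimately show "\<alpha> ^ (2 * Suc l) * moment_weight m n l > 0" by (intro mult_pos_pos moment_weight_pos)
  qed (use P in auto)
  have "averaged_series m \<alpha> n a b N = 0" for N
    using odd averaged_series_even by (cases "even N") (auto elim!: oddE)
  then show ?thesis using sums_averaged[OF z, of m n a b] by (simp add: sums_iff)
qed

lemma melnikov_averaged:
  assumes "0 \<le> h" "h < H0 \<alpha> \<alpha>" "m1 + m2 = Suc m" "\<alpha> \<noteq> 0"
  shows "of_real (melnikov m1 m2 \<alpha> \<alpha> n a b h) = of_real (sqrt h) * averaged m \<alpha> n a b (of_real (sqrt h))"
    and "norm (of_real \<alpha> * (of_real (sqrt h) :: complex)) < 1"
proof -
  have "h * \<alpha>\<^sup>2 < 1" using assms by (simp add: H0_def field_simps)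
  then have "(\<bar>\<alpha>\<bar> * sqrt h)\<^sup>2 < 1\<^sup>2" using assms by (simp add: power_mult_distrib mult.commute)
  then have small: "\<bar>\<alpha>\<bar> * sqrt h < 1" by (rule power2_less_imp_less) simp
  then show "norm (of_real \<alpha> * (of_real (sqrt h) :: complex)) < 1" using assms by (simp add: norm_mult)
  let ?r = "sqrt h"
  have nz: "1 - \<alpha> * (?r * sin t) \<noteq> 0" for t
  proof -
    have "\<bar>\<alpha> * (?r * sin t)\<bar> \<le> \<bar>\<alpha>\<bar> * ?r" using assms by (simp add: abs_mult mult_left_le mult.assoc[symmetric])
    then show ?thesis using small by linarith
  qed
  define I where "I p q = integral {0..2 * pi} (\<lambda>t. sin t ^ p * cos t ^ q / (1 - \<alpha> * (?r * sin t)) ^ Suc m)" for p q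
  have I: "((\<lambda>t. sin t ^ p * cos t ^ q / (1 - \<alpha> * (?r * sin t)) ^ Suc m) has_integral I p q) {0..2 * pi}" for p q
    unfolding I_def using nz by (intro integrable_integral integrable_continuous_real continuous_intros) auto
  have T: "trig_quotient m \<alpha> p q (of_real ?r) = of_real (I p q)" for p q
  proof -
    have "((\<lambda>t. complex_of_real (sin t ^ p * cos t ^ q / (1 - \<alpha> * (?r * sin t)) ^ Suc m)) has_integral of_real (I p q)) {0..2 * pi}"
      by (rule has_integral_of_real[OF I])
    then show ?thesis unfolding trig_quotient_def by (simp add: mult.assoc integral_unique)
  qed
  have "((\<lambda>t. \<Sum>(i, j)\<in>indices n. ?r ^ (i + j + 1) * (a i j * (sin t ^ (i + 1) * cos t ^ j / (1 - \<alpha> * (?r * sin t)) ^ Suc m) +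
     b i j * (sin t ^ i * cos t ^ (j + 1) / (1 - \<alpha> * (?r * sin t)) ^ Suc m))) has_integral
    (\<Sum>(i, j)\<in>indices n. ?r ^ (i + j + 1) * (a i j * I (i + 1) j + b i j * I i (j + 1)))) {0..2 * pi}"
    unfolding case_prod_beta
    by (intro has_integral_sum finite_indices has_integral_mult_right has_integral_add I)
  moreover have "(\<Sum>(i, j)\<in>indices n. ?r ^ (i + j + 1) * (a i j * (sin t ^ (i + 1) * cos t ^ j / (1 - \<alpha> * (?r * sin t)) ^ Suc m) +
     b i j * (sin t ^ i * cos t ^ (j + 1) / (1 - \<alpha> * (?r * sin t)) ^ Suc m))) =
     (let x = ?r * sin t; y = ?r * cos t in
       1 / denom m1 m2 \<alpha> \<alpha> x *
       (\<Sum>(i, j)\<in>indices n. a i j * x ^ (i + 1) * y ^ j + b i j * x ^ i * y ^ (j + 1)))" for t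
    unfolding Let_def sum_distrib_left denom_def power_add[symmetric] assms(3)
    by (intro sum.cong refl) (auto simp: power_mult_distrib power_add add_divide_distrib distrib_left mult_ac)
  ultimately have "melnikov m1 m2 \<alpha> \<alpha> n a b h = (\<Sum>(i, j)\<in>indices n. ?r ^ (i + j + 1) * (a i j * I (i + 1) j + b i j * I i (j + 1)))"
    unfolding melnikov_def by (simp only: integral_unique)
  then show "of_real (melnikov m1 m2 \<alpha> \<alpha> n a b h) = of_real (sqrt h) * averaged m \<alpha> n a b (of_real (sqrt h))"
    unfolding averaged_def T sum_distrib_left by (simp add: case_prod_beta mult.assoc)
qed

section \<open>Zeros in a uniform limit\<close>

text \<open>Limits of different zeros may coincide, and \<open>h\<close> may vanish identically, so
  zeros are divided out one at a time. On the circle of radius \<open>r\<close> the divisors are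
  bounded away from 0, because all zeros have norm at most \<open>s < r\<close>; hence the quotients
  converge uniformly there, and the maximum modulus principle carries this to the disc.\<close>

lemma divide_out_converging_zero:
  fixes H :: "nat \<Rightarrow> complex \<Rightarrow> complex"
  assumes hol: "\<And>k. H k holomorphic_on ball 0 r'" "h holomorphic_on ball 0 r'" and r: "s < r" "r < r'"
    and unif: "uniform_limit (cball 0 r) H h sequentially"
    and z: "z \<longlonglongrightarrow> \<zeta>" "\<And>k. norm (z k) \<le> s" "\<And>k. H k (z k) = 0"
  obtains H' h' where "\<And>k. H' k holomorphic_on ball 0 r'" "h' holomorphic_on ball 0 r'"
    "uniform_limit (cball 0 r) H' h' sequentially"
    "\<And>k w. H k w = (w - z k) * H' k w" "\<And>w. h w = (w - \<zeta>) * h' w"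
proof -
  have \<zeta>: "norm \<zeta> \<le> s" by (rule LIMSEQ_le_const2[OF tendsto_norm[OF z(1)]]) (use z in auto)
  have s: "0 \<le> s" using z(2)[of 0] norm_ge_zero order_trans by blast
  have "continuous_on (cball 0 r) h"
    by (rule continuous_on_subset[OF holomorphic_on_imp_continuous_on[OF hol(2)]]) (use r in auto)
  then have "(\<lambda>k. h (z k)) \<longlonglongrightarrow> h \<zeta>"
    by (rule continuous_on_tendsto_compose[OF _ z(1)]) (use \<zeta> z(2) r in \<open>auto intro!: always_eventually intro: order_trans[OF _ less_imp_le]\<close>)
  moreover have "(\<lambda>k. h (z k)) \<longlonglongrightarrow> 0"
  proof (rule tendstoI)
    fix e :: real assume "e > 0"
    show "eventually (\<lambda>k. dist (h (z k)) 0 < e) sequentially"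
      using uniform_limitD[OF unif \<open>e > 0\<close>]
    proof eventually_elim
      case (elim k)
      have "z k \<in> cball 0 r" using z(2)[of k] r by auto
      with elim have "dist (H k (z k)) (h (z k)) < e" by blast
      then show ?case using z(3)[of k] by (simp add: dist_commute)
    qed
  qed
  ultimately have h0: "h \<zeta> = 0" using LIMSEQ_unique by blast
  define Q where "Q f a = (\<lambda>w. if w = a then deriv f a else (f w - f a) / (w - a))" for f :: "complex \<Rightarrow> complex" and a
  have Qhol: "Q f a holomorphic_on ball 0 r'" if "f holomorphic_on ball 0 r'" for f a
    unfolding Q_def by (rule pole_lemma_open[OF that]) auto
  have Qeq: "f w = (w - a) * Q f a w" if "f a = 0" for f a w
    using that by (auto simp: Q_def)
  have lim: "uniform_limit (sphere 0 r) (\<lambda>k w. H k w / (w - z k)) (\<lambda>w. h w / (w - \<zeta>)) sequentially"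
  proof (rule uniform_lim_divide)
    show "uniform_limit (sphere 0 r) H h sequentially"
      by (rule uniform_limit_on_subset[OF unif]) auto
    show "uniform_limit (sphere 0 r) (\<lambda>k w. w - z k) (\<lambda>w. w - \<zeta>) sequentially"
      unfolding uniform_limit_iff using tendstoD[OF z(1)] by (auto simp: dist_norm norm_minus_commute)
    have "compact (h ` sphere 0 r)"
      by (rule compact_continuous_image) (use \<open>continuous_on (cball 0 r) h\<close> in \<open>auto intro: continuous_on_subset\<close>)
    then show "bounded (h ` sphere 0 r)" by (rule compact_imp_bounded)
    show "r - s \<le> norm (w - \<zeta>)" if "w \<in> sphere 0 r" for w
      using that \<zeta> norm_triangle_ineq2[of w \<zeta>] by simp
    show "r - s > 0" using r by simp
  qed
  have "uniform_limit (cball 0 r) (\<lambda>k. Q (H k) (z k)) (Q h \<zeta>) sequentially"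
  proof (rule uniform_limitI)
    fix e :: real assume e: "e > 0"
    show "eventually (\<lambda>k. \<forall>w\<in>cball 0 r. dist (Q (H k) (z k) w) (Q h \<zeta> w) < e) sequentially"
      using uniform_limitD[OF lim half_gt_zero[OF e]]
    proof eventually_elim
      case (elim k)
      let ?D = "\<lambda>w. Q (H k) (z k) w - Q h \<zeta> w"
      have hD: "?D holomorphic_on ball 0 r'" by (intro holomorphic_intros Qhol hol)
      have "norm (?D w) \<le> e / 2" if "w \<in> cball 0 r" for w
      proof (rule maximum_modulus_frontier[of ?D "cball 0 r"])
        show "?D holomorphic_on interior (cball 0 r)"
          by (rule holomorphic_on_subset[OF hD]) (use r in auto)
        show "continuous_on (closure (cball 0 r)) ?D"
          by (rule continuous_on_subset[OF holomorphic_on_imp_continuous_on[OF hD]]) (use r in auto)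
        fix w assume "w \<in> frontier (cball (0::complex) r)"
        then have w: "w \<in> sphere 0 r" by auto
        have "w \<noteq> z k" "w \<noteq> \<zeta>" using w z(2)[of k] \<zeta> r by auto
        then show "norm (?D w) \<le> e / 2"
          using elim w z(3) h0 by (auto simp: Q_def dist_norm less_imp_le)
      qed (use that in auto)
      then show ?case using e by (force simp: dist_norm)
    qed
  qed
  then show ?thesis using that[of "\<lambda>k. Q (H k) (z k)" "Q h \<zeta>"] Qhol Qeq hol z(3) h0 by blast
qed

text \<open>Injectivity of \<open>z k\<close> ensures that, after one zero has been divided out, the
  others are still zeros of the quotient. Their limits are allowed to coincide, and this is how
  multiplicities arise.\<close>

lemma converging_zeros_factor:
  fixes H :: "nat \<Rightarrow> complex \<Rightarrow> complex"
  assumes "finite I" and "\<And>k. H k holomorphic_on ball 0 r'" "h holomorphic_on ball 0 r'" and "s < r" "r < r'"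
    and "uniform_limit (cball 0 r) H h sequentially"
    and "\<And>i. i \<in> I \<Longrightarrow> (\<lambda>k. z k i) \<longlonglongrightarrow> \<zeta> i" "\<And>k i. i \<in> I \<Longrightarrow> norm (z k i) \<le> s"
      "\<And>k i. i \<in> I \<Longrightarrow> H k (z k i) = 0" "\<And>k. inj_on (z k) I"
  shows "\<exists>Q. Q holomorphic_on ball 0 r' \<and> (\<forall>w. h w = (\<Prod>i\<in>I. w - \<zeta> i) * Q w)"
  using assms
proof (induction I arbitrary: H h rule: finite_induct)
  case empty
  then show ?case by auto
next
  case (insert a I)
  obtain H' h' where H': "\<And>k. H' k holomorphic_on ball 0 r'" "h' holomorphic_on ball 0 r'"
    "uniform_limit (cball 0 r) H' h' sequentially"
    "\<And>k w. H k w = (w - z k a) * H' k w" "\<And>w. h w = (w - \<zeta> a) * h' w"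
    using divide_out_converging_zero[of H r' h s r "\<lambda>k. z k a" "\<zeta> a"] insert.prems
    by (metis insertI1)
  have "\<exists>Q. Q holomorphic_on ball 0 r' \<and> (\<forall>w. h' w = (\<Prod>i\<in>I. w - \<zeta> i) * Q w)"
  proof (rule insert.IH[OF H'(1,2)])
    fix k i assume i: "i \<in> I"
    then have "z k i \<noteq> z k a" using insert.prems(9)[of k] insert.hyps by (metis inj_onD insertI1 insertI2)
    moreover have "H k (z k i) = 0" using insert.prems i by auto
    ultimately show "H' k (z k i) = 0" using H'(4)[of k "z k i"] by auto
  qed (use insert.prems H' in \<open>auto intro: inj_on_subset\<close>)
  then show ?case using H'(5) insert.hyps by (auto simp: mult.assoc)
qed

section \<open>Holomorphic dependence on initial values\<close>

text \<open>Differentiation under the integral needs a jointly continuous z-derivative. Cauchy's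
  formula expresses this derivative by the values of \<open>F\<close> on a circle, where joint
  continuity is given.\<close>

lemma holomorphic_integral_param:
  fixes F :: "complex \<Rightarrow> real \<Rightarrow> complex"
  assumes U: "open U" and cont: "continuous_on (U \<times> {a..b}) (\<lambda>(z, t). F z t)"
    and hol: "\<And>t. t \<in> {a..b} \<Longrightarrow> (\<lambda>z. F z t) holomorphic_on U"
  shows "(\<lambda>z. integral {a..b} (F z)) holomorphic_on U"
proof -
  have "(\<lambda>z. integral {a..b} (F z)) field_differentiable at z0" if "z0 \<in> U" for z0
  proof -
    obtain r where r: "r > 0" "cball z0 r \<subseteq> U" using U \<open>z0 \<in> U\<close> open_contains_cball by blast
    let ?B = "ball z0 (r / 2)"
    let ?g = "circlepath z0 r"
    define fz where "fz z t = 1 / (2 * of_real pi * \<i>) * integral {0..1}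
       (\<lambda>u. F (?g u) t / (?g u - z)^2 * vector_derivative ?g (at u))" for z t
    have "?B \<subseteq> cball z0 r" using r(1) by auto
    with r(2) have sub: "?B \<subseteq> U" by blast
    have "(\<lambda>z. integral (cbox a b) (F z)) holomorphic_on ?B"
    proof (rule leibniz_rule_holomorphic[where fx = fz])
      fix z t assume zt: "z \<in> ?B" "t \<in> cbox a b"
      have h: "(\<lambda>z. F z t) holomorphic_on U" using hol zt by auto
      have "((\<lambda>z. F z t) has_field_derivative
         (1 / (2 * of_real pi * \<i>) * contour_integral ?g (\<lambda>u. F u t / (u - z)^2))) (at z)"
        by (rule Cauchy_derivative_integral_circlepath(2))
           (use r zt in \<open>auto intro!: continuous_on_subset[OF holomorphic_on_imp_continuous_on[OF h]]
              holomorphic_on_subset[OF h] subset_trans[OF ball_subset_cball]\<close>)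
      then show "((\<lambda>z. F z t) has_field_derivative fz z t) (at z within ?B)"
        unfolding fz_def contour_integral_integral by (rule has_field_derivative_at_within)
    next
      fix z assume z: "z \<in> ?B"
      have "continuous_on {a..b} (\<lambda>t. (\<lambda>(z, t). F z t) (z, t))"
        by (rule continuous_on_compose2[OF cont]) (use z sub in \<open>auto intro!: continuous_intros\<close>)
      then show "F z integrable_on cbox a b" by (auto intro: integrable_continuous_real)
    next
      have "continuous_on (?B \<times> {a..b}) (\<lambda>x. integral (cbox 0 1)
        (\<lambda>u. F (?g u) (snd x) / (?g u - fst x)^2 * vector_derivative ?g (at u)))"
      proof (rule integral_continuous_on_param)
        have "continuous_on ((?B \<times> {a..b}) \<times> cbox 0 1)
          (\<lambda>p. (\<lambda>(z, t). F z t) (?g (snd p), snd (fst p)))"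
        proof (rule continuous_on_compose2[OF cont])
          show "continuous_on ((?B \<times> {a..b}) \<times> cbox 0 1) (\<lambda>p. (?g (snd p), snd (fst p)))"
            unfolding circlepath by (intro continuous_intros)
          have "?g u \<in> U" if "u \<in> {0..1}" for u
          proof -
            have "?g u \<in> path_image ?g" using that by (auto simp: path_image_def)
            then show ?thesis using r by auto
          qed
          then show "(\<lambda>p. (?g (snd p), snd (fst p))) ` ((?B \<times> {a..b}) \<times> cbox 0 1) \<subseteq> U \<times> {a..b}" by auto
        qed
        moreover have "?g u \<noteq> z" if "u \<in> {0..1}" "z \<in> ?B" for u z
        proof -
          have "?g u \<in> path_image ?g" using that by (auto simp: path_image_def)
          then show ?thesis using r that by auto
        qed
        moreover have "continuous_on ((?B \<times> {a..b}) \<times> cbox 0 1) (\<lambda>p. ?g (snd p))"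
          unfolding circlepath by (intro continuous_intros)
        ultimately show "continuous_on ((?B \<times> {a..b}) \<times> cbox 0 1)
          (\<lambda>(x, u). F (?g u) (snd x) / (?g u - fst x)^2 * vector_derivative ?g (at u))"
          unfolding case_prod_beta vector_derivative_circlepath
          by (intro continuous_intros) auto
      qed
      then have "continuous_on (?B \<times> {a..b}) (\<lambda>x. fz (fst x) (snd x))"
        unfolding fz_def by (intro continuous_intros) auto
      then show "continuous_on (?B \<times> cbox a b) (\<lambda>(x, t). fz x t)"
        by (simp add: case_prod_beta)
    qed auto
    then show ?thesis using r by (auto simp: holomorphic_on_open field_differentiable_def)
  qed
  then show ?thesis by (simp add: holomorphic_on_def field_differentiable_at_within)
qed

text \<open>The substitution s = t u moves the variable endpoint into the integrand, which leaves a
  parameter integral over a fixed interval.\<close>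

lemma continuous_on_indefinite_integral_param:
  fixes F :: "complex \<Rightarrow> real \<Rightarrow> complex"
  assumes cont: "continuous_on (U \<times> {0..T}) (\<lambda>(z, t). F z t)"
  shows "continuous_on (U \<times> {0..T}) (\<lambda>(z, t). integral {0..t} (F z))"
proof -
  have eq: "integral {0..t} (F z) = of_real t * integral (cbox 0 1) (\<lambda>u. F z (t * u))"
    if "z \<in> U" "t \<in> {0..T}" for z t
  proof (cases "t = 0")
    case False
    with that have t: "t > 0" by auto
    have "continuous_on {0..t} (\<lambda>t. (\<lambda>(z, t). F z t) (z, t))"
      by (rule continuous_on_compose2[OF cont]) (use that in \<open>auto intro!: continuous_intros\<close>)
    then have "F z integrable_on {0..t}" by (auto intro: integrable_continuous_real)
    then have "(F z has_integral integral {0..t} (F z)) {0..t}" by (rule integrable_integral)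
    from has_integral_stretch_real[OF this, of t] t
    have "((\<lambda>u. F z (t * u)) has_integral (1 / t) *\<^sub>R integral {0..t} (F z)) ((\<lambda>x. x / t) ` {0..t})" by simp
    moreover have "(\<lambda>x. x / t) ` {0..t} = {0..1}"
      using t by (auto simp: image_iff intro!: bexI[of _ "_ * t"])
    ultimately have "integral {0..1} (\<lambda>u. F z (t * u)) = (1 / t) *\<^sub>R integral {0..t} (F z)"
      by (simp add: integral_unique)
    then show ?thesis using t by (simp add: scaleR_conv_of_real)
  qed auto
  have "continuous_on (U \<times> {0..T}) (\<lambda>x. integral (cbox 0 1) (\<lambda>u. F (fst x) (snd x * u)))"
  proof (rule integral_continuous_on_param)
    have "continuous_on ((U \<times> {0..T}) \<times> cbox 0 1) (\<lambda>p. (\<lambda>(z, t). F z t) (fst (fst p), snd (fst p) * snd p))"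
      by (rule continuous_on_compose2[OF cont])
         (auto intro!: continuous_intros mult_left_le order_trans[OF mult_right_le_one_le])
    then show "continuous_on ((U \<times> {0..T}) \<times> cbox 0 1) (\<lambda>(x, u). F (fst x) (snd x * u))"
      by (simp add: case_prod_beta)
  qed
  then have "continuous_on (U \<times> {0..T}) (\<lambda>x. of_real (snd x) * integral (cbox 0 1) (\<lambda>u. F (fst x) (snd x * u)))"
    by (intro continuous_intros)
  moreover have "continuous_on (U \<times> {0..T}) (\<lambda>x. of_real (snd x) * integral (cbox 0 1) (\<lambda>u. F (fst x) (snd x * u)))
    \<longleftrightarrow> continuous_on (U \<times> {0..T}) (\<lambda>(z, t). integral {0..t} (F z))"
    by (rule continuous_on_cong) (use eq in auto)
  ultimately show ?thesis by blast
qed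

text \<open>Cauchy's estimate on circles of radius \<open>(R - r) / 2\<close>. Lipschitz constants
  of the complexified equation are thus obtained from bounds on its values alone.\<close>

lemma holomorphic_lipschitz:
  fixes f :: "complex \<Rightarrow> complex"
  assumes hol: "f holomorphic_on ball 0 R" and bd: "\<And>z. z \<in> ball 0 R \<Longrightarrow> norm (f z) \<le> C"
    and "r < R" "z \<in> cball 0 r" "w \<in> cball 0 r"
  shows "norm (f z - f w) \<le> 2 * C / (R - r) * norm (z - w)"
proof (rule field_differentiable_bound[of "cball 0 r" _ "deriv f"])
  fix z :: complex assume z: "z \<in> cball 0 r"
  then have zR: "z \<in> ball 0 R" using \<open>r < R\<close> by auto
  then have "(f has_field_derivative deriv f z) (at z)"
    using hol holomorphic_derivI open_ball by blast
  then show "(f has_field_derivative deriv f z) (at z within cball 0 r)"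
    by (rule has_field_derivative_at_within)
  let ?d = "(R - r) / 2"
  have sub: "cball z ?d \<subseteq> ball 0 R"
  proof
    fix w assume "w \<in> cball z ?d"
    then have "norm (w - z) \<le> ?d" by (simp add: dist_norm norm_minus_commute)
    moreover have "norm w \<le> norm z + norm (w - z)" using norm_triangle_ineq[of z "w - z"] by simp
    ultimately have "norm w \<le> norm z + ?d" by linarith
    moreover have "norm z \<le> r" using z by simp
    ultimately have "norm w < R"  using \<open>r < R\<close> by (simp add: field_simps)
    then show "w \<in> ball 0 R" by simp
  qed
  have "norm ((deriv ^^ 1) f z) \<le> fact 1 * C / ?d ^ 1"
  proof (rule Cauchy_inequality)
    show "f holomorphic_on ball z ?d" 
      by (rule holomorphic_on_subset[OF hol]) (use sub ball_subset_cball in blast)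
    show "continuous_on (cball z ?d) f"
      by (rule continuous_on_subset[OF holomorphic_on_imp_continuous_on[OF hol] sub])
    fix x assume "norm (z - x) = ?d"
    then have "x \<in> cball z ?d" by (simp add: dist_norm)
    then show "norm (f x) \<le> C" using sub bd by blast
  qed (use \<open>r < R\<close> in auto)
  then show "norm (deriv f z) \<le> 2 * C / (R - r)" by (simp add: field_simps)
qed (use assms in auto)

primrec picard_iterate :: "(complex \<Rightarrow> real \<Rightarrow> complex) \<Rightarrow> real \<Rightarrow> nat \<Rightarrow> complex \<Rightarrow> real \<Rightarrow> complex" where
  "picard_iterate F \<epsilon> 0 z t = z"
| "picard_iterate F \<epsilon> (Suc k) z t = z + \<epsilon> * integral {0..t} (\<lambda>s. F (picard_iterate F \<epsilon> k z s) s)"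

lemma norm_integral_le:
  fixes f :: "real \<Rightarrow> complex"
  assumes "continuous_on {0..T} f" "\<And>s. s \<in> {0..T} \<Longrightarrow> norm (f s) \<le> B" "t \<in> {0..T}"
  shows "norm (integral {0..t} f) \<le> B * T"
proof -
  have "norm (integral {0..t} f) \<le> B * (t - 0)"
    by (rule integral_bound) (use assms in \<open>auto intro: continuous_on_subset\<close>)
  also have "\<dots> \<le> B * T"
    using assms order_trans[OF norm_ge_zero assms(2)[of t]] by (intro mult_left_mono) auto
  finally show ?thesis .
qed

text \<open>Time is real and only the initial value is complex. Each iterate is holomorphic in the
  initial value, and so is the uniform limit. The smallness condition serves twice: iterates that
  start within radius \<open>r1\<close> stay within \<open>rm\<close>, halfway to \<open>r2\<close>,
  and with the Lipschitz constant \<open>4 * C / (r2 - r1)\<close> valid there, consecutive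
  differences shrink by the factor 1/2.\<close>

lemma picard_flow:
  fixes F :: "complex \<Rightarrow> real \<Rightarrow> complex"
  assumes r: "0 < r1" "r1 < r2" and T: "T \<ge> 0"
    and cont: "continuous_on (cball 0 r2 \<times> {0..T}) (\<lambda>(z, t). F z t)"
    and hol: "\<And>t. t \<in> {0..T} \<Longrightarrow> (\<lambda>z. F z t) holomorphic_on ball 0 r2"
    and bd: "\<And>z t. z \<in> cball 0 r2 \<Longrightarrow> t \<in> {0..T} \<Longrightarrow> norm (F z t) \<le> C"
    and small: "8 * \<bar>\<epsilon>\<bar> * C * T \<le> r2 - r1"
  obtains R where "(\<lambda>z. R z T) holomorphic_on ball 0 r1"
    "\<And>z. z \<in> ball 0 r1 \<Longrightarrow> continuous_on {0..T} (R z)"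
    "\<And>z t. z \<in> ball 0 r1 \<Longrightarrow> t \<in> {0..T} \<Longrightarrow> norm (R z t) \<le> (r1 + r2) / 2"
    "\<And>z t. z \<in> ball 0 r1 \<Longrightarrow> t \<in> {0..T} \<Longrightarrow> R z t = z + of_real \<epsilon> * integral {0..t} (\<lambda>s. F (R z s) s)"
proof -
  define rm where "rm = (r1 + r2) / 2"
  have rm: "r1 < rm" "rm < r2" "rm > 0" using r by (auto simp: rm_def)
  let ?S = "ball (0::complex) r1 \<times> {0..T}"
  let ?P = "picard_iterate F \<epsilon>"
  have C: "C \<ge> 0" using order_trans[OF norm_ge_zero bd[of 0 0]] T r by simp
  have lip: "norm (F z t - F w t) \<le> 4 * C / (r2 - r1) * norm (z - w)"
    if "z \<in> cball 0 rm" "w \<in> cball 0 rm" "t \<in> {0..T}" for z w t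
  proof -
    have "norm (F z t - F w t) \<le> 2 * C / (r2 - rm) * norm (z - w)"
      by (rule holomorphic_lipschitz[OF hol]) (use that bd rm in auto)
    also have "2 * C / (r2 - rm) = 4 * C / (r2 - r1)" using r by (auto simp: rm_def field_simps)
    finally show ?thesis .
  qed
  have compose: "continuous_on ?S (\<lambda>(z, t). F (G z t) t)"
    if "continuous_on ?S (\<lambda>(z, t). G z t)" "\<And>z t. (z, t) \<in> ?S \<Longrightarrow> norm (G z t) \<le> rm" for G
  proof -
    have "continuous_on ?S (\<lambda>p. (\<lambda>(z, t). F z t) (G (fst p) (snd p), snd p))"
      by (rule continuous_on_compose2[OF cont])
        (use that rm in \<open>force intro!: continuous_intros simp: case_prod_beta\<close>)+
    then show ?thesis by (simp add: case_prod_beta)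
  qed
  have slice: "continuous_on {0..T} (G z)"
    if "continuous_on ?S (\<lambda>(z, t). G z t)" "z \<in> ball 0 r1" for G and z
  proof -
    have "continuous_on {0..T} (\<lambda>t. (\<lambda>(z, t). G z t) (z, t))"
      by (rule continuous_on_compose2[OF that(1)]) (use that in \<open>auto intro!: continuous_intros\<close>)
    then show ?thesis by simp
  qed
  have inv: "continuous_on ?S (\<lambda>(z, t). ?P k z t) \<and> (\<forall>z t. (z, t) \<in> ?S \<longrightarrow> norm (?P k z t) \<le> rm) \<and>
    (\<forall>t\<in>{0..T}. (\<lambda>z. ?P k z t) holomorphic_on ball 0 r1)" for k
  proof (induction k)
    case 0
    have "continuous_on ?S (\<lambda>(z, t). z)" by (simp add: case_prod_beta continuous_intros)
    then show ?case using rm by (auto intro!: holomorphic_intros)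
  next
    case (Suc k)
    then have cG: "continuous_on ?S (\<lambda>(z, t). F (?P k z t) t)" by (intro compose) auto
    have "continuous_on ?S (\<lambda>(z, t). integral {0..t} (\<lambda>s. F (?P k z s) s))"
      by (rule continuous_on_indefinite_integral_param[OF cG])
    then have 1: "continuous_on ?S (\<lambda>(z, t). ?P (Suc k) z t)"
      by (auto simp: case_prod_beta intro!: continuous_intros)
    have 2: "norm (?P (Suc k) z t) \<le> rm" if zt: "(z, t) \<in> ?S" for z t
    proof -
      have "norm (integral {0..t} (\<lambda>s. F (?P k z s) s)) \<le> C * T"
      proof (rule norm_integral_le[OF slice[OF cG]])
        fix s assume s: "s \<in> {0..T}"
        then have "norm (?P k z s) \<le> rm" using zt Suc by auto
        then show "norm (F (?P k z s) s) \<le> C" using rm s by (intro bd) auto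
      qed (use zt in auto)
      then have "\<bar>\<epsilon>\<bar> * norm (integral {0..t} (\<lambda>s. F (?P k z s) s)) \<le> \<bar>\<epsilon>\<bar> * (C * T)"
        by (rule mult_left_mono) auto
      also have "\<dots> \<le> (r2 - r1) / 8" using small by (simp add: field_simps)
      finally have "norm (of_real \<epsilon> * integral {0..t} (\<lambda>s. F (?P k z s) s)) \<le> (r2 - r1) / 8"
        by (simp add: norm_mult)
      then have "norm (?P (Suc k) z t) \<le> norm z + (r2 - r1) / 8"
        unfolding picard_iterate.simps using norm_triangle_ineq order_trans add_left_mono by metis
      moreover have "norm z < r1" using zt by simp
      ultimately show ?thesis using r unfolding rm_def by argo
    qed
    have 3: "(\<lambda>z. ?P (Suc k) z t) holomorphic_on ball 0 r1" if t: "t \<in> {0..T}" for t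
    proof -
      have "(\<lambda>z. integral {0..t} (\<lambda>s. F (?P k z s) s)) holomorphic_on ball 0 r1"
      proof (rule holomorphic_integral_param)
        show "continuous_on (ball 0 r1 \<times> {0..t}) (\<lambda>(z, s). F (?P k z s) s)"
          by (rule continuous_on_subset[OF cG]) (use t in auto)
        fix s assume s: "s \<in> {0..t}"
        have "((\<lambda>z. F z s) \<circ> (\<lambda>z. ?P k z s)) holomorphic_on ball 0 r1"
        proof (rule holomorphic_on_compose_gen)
          show "(\<lambda>z. ?P k z s) holomorphic_on ball 0 r1" using Suc s t by auto
          show "(\<lambda>z. F z s) holomorphic_on ball 0 r2" using hol s t by auto
          show "(\<lambda>z. ?P k z s) ` ball 0 r1 \<subseteq> ball 0 r2" using Suc s t rm by fastforce
        qed
        then show "(\<lambda>z. F (?P k z s) s) holomorphic_on ball 0 r1" by (simp add: o_def)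
      qed auto
      then show ?thesis by (auto intro!: holomorphic_intros)
    qed
    show ?case using 1 2 3 by blast
  qed
  have bnd: "norm (?P k z t) \<le> rm" if "z \<in> ball 0 r1" "t \<in> {0..T}" for k z t using inv that by auto
  have contP: "continuous_on ?S (\<lambda>(z, t). ?P k z t)" for k using inv by auto
  have contFP: "continuous_on {0..T} (\<lambda>s. F (?P k z s) s)" if "z \<in> ball 0 r1" for z k
    by (rule slice[OF compose that]) (use inv in auto)
  have step: "norm (?P (Suc k) z t - ?P k z t) \<le> r2 * (1 / 2) ^ k" if z: "z \<in> ball 0 r1" and "t \<in> {0..T}" for k z t
    using that(2)
  proof (induction k arbitrary: t)
    case 0
    have "norm (integral {0..t} (\<lambda>s. F z s)) \<le> C * T"
      using contFP[OF z, of 0] by (intro norm_integral_le) (use z 0 r in \<open>auto intro!: bd\<close>)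
    then have "\<bar>\<epsilon>\<bar> * norm (integral {0..t} (\<lambda>s. F z s)) \<le> \<bar>\<epsilon>\<bar> * (C * T)"
      by (rule mult_left_mono) auto
    also have "\<dots> \<le> r2" using small r by (simp add: field_simps)
    finally show ?case by (simp add: norm_mult)
  next
    case (Suc k)
    have "norm (integral {0..t} (\<lambda>s. F (?P (Suc k) z s) s - F (?P k z s) s)) \<le> 4 * C / (r2 - r1) * (r2 * (1 / 2) ^ k) * T"
    proof (rule norm_integral_le)
      show "continuous_on {0..T} (\<lambda>s. F (?P (Suc k) z s) s - F (?P k z s) s)"
        by (intro continuous_on_diff contFP z)
      fix s assume s: "s \<in> {0..T}"
      have "norm (F (?P (Suc k) z s) s - F (?P k z s) s) \<le> 4 * C / (r2 - r1) * norm (?P (Suc k) z s - ?P k z s)"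
        by (rule lip) (use s z bnd in \<open>auto simp del: picard_iterate.simps\<close>)
      also have "\<dots> \<le> 4 * C / (r2 - r1) * (r2 * (1 / 2) ^ k)"
        using Suc.IH[OF s] C r by (intro mult_left_mono) auto
      finally show "norm (F (?P (Suc k) z s) s - F (?P k z s) s) \<le> 4 * C / (r2 - r1) * (r2 * (1 / 2) ^ k)" .
    qed (use Suc in auto)
    then have "\<bar>\<epsilon>\<bar> * norm (integral {0..t} (\<lambda>s. F (?P (Suc k) z s) s - F (?P k z s) s)) \<le>
       \<bar>\<epsilon>\<bar> * (4 * C / (r2 - r1) * (r2 * (1 / 2) ^ k) * T)" by (rule mult_left_mono) auto
    also have "\<dots> = (8 * \<bar>\<epsilon>\<bar> * C * T) * (r2 / (r2 - r1) * (1 / 2) ^ Suc k)" using r by (simp add: field_simps)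
    also have "\<dots> \<le> (r2 - r1) * (r2 / (r2 - r1) * (1 / 2) ^ Suc k)"
      using r by (intro mult_right_mono small) auto
    also have "\<dots> = r2 * (1 / 2) ^ Suc k" using r by (simp add: field_simps)
    finally have *: "\<bar>\<epsilon>\<bar> * norm (integral {0..t} (\<lambda>s. F (?P (Suc k) z s) s - F (?P k z s) s)) \<le> r2 * (1 / 2) ^ Suc k" .
    have int: "(\<lambda>s. F (?P k z s) s) integrable_on {0..t}" for k
      using continuous_on_subset[OF contFP[OF z, of k], of "{0..t}"] Suc.prems by (auto intro: integrable_continuous_real)
    have "?P (Suc (Suc k)) z t - ?P (Suc k) z t = 
      \<epsilon> * integral {0..t} (\<lambda>s. F (?P (Suc k) z s) s - F (?P k z s) s)"
      unfolding Henstock_Kurzweil_Integration.integral_diff[OF int int]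
      by (simp add: algebra_simps)
    then show ?case using * by (simp add: norm_mult del: picard_iterate.simps)
  qed
  define R where "R z t = z + (\<Sum>k. ?P (Suc k) z t - ?P k z t)" for z t
  have unif: "uniform_limit ?S (\<lambda>n (z, t). ?P n z t) (\<lambda>(z, t). R z t) sequentially"
  proof -
    have "uniform_limit ?S (\<lambda>n x. \<Sum>k<n. ?P (Suc k) (fst x) (snd x) - ?P k (fst x) (snd x)) 
      (\<lambda>x. \<Sum>k. ?P (Suc k) (fst x) (snd x) - ?P k (fst x) (snd x)) sequentially"
    proof (rule Weierstrass_m_test)
      show "summable (\<lambda>k. r2 * (1 / 2) ^ k :: real)" by (intro summable_mult summable_geometric) auto
    qed (use step in \<open>auto simp del: picard_iterate.simps\<close>)
    then have "uniform_limit ?S (\<lambda>n x. fst x + (\<Sum>k<n. ?P (Suc k) (fst x) (snd x) - ?P k (fst x) (snd x)))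
      (\<lambda>x. fst x + (\<Sum>k. ?P (Suc k) (fst x) (snd x) - ?P k (fst x) (snd x))) sequentially"
      by (intro uniform_limit_add uniform_limit_const)
    moreover have "(\<Sum>k<n. ?P (Suc k) z t - ?P k z t) = ?P n z t - z" for n z t
      using sum_lessThan_telescope[of "\<lambda>k. ?P k z t" n] by simp
    ultimately show ?thesis unfolding R_def by (simp add: case_prod_beta' del: picard_iterate.simps)
  qed
  have unifz: "uniform_limit {0..T} (\<lambda>n. ?P n z) (R z) sequentially" if "z \<in> ball 0 r1" for z
  proof (rule uniform_limitI)
    fix e :: real assume "e > 0"
    from uniform_limitD[OF unif this]
    show "eventually (\<lambda>k. \<forall>t\<in>{0..T}. dist (?P k z t) (R z t) < e) sequentially"
      by eventually_elim (use that in force)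
  qed
  have R_cont: "continuous_on {0..T} (R z)" if z: "z \<in> ball 0 r1" for z
    by (rule uniform_limit_theorem[OF _ unifz[OF z]]) (auto intro!: always_eventually slice[OF contP z])
  have R_bound: "norm (R z t) \<le> rm" if "z \<in> ball 0 r1" "t \<in> {0..T}" for z t
    by (rule LIMSEQ_le_const2[OF tendsto_norm[OF tendsto_uniform_limitI[OF unifz]]]) (use that bnd in auto)
  show ?thesis
  proof
    show "(\<lambda>z. R z T) holomorphic_on ball 0 r1"
    proof (rule holomorphic_uniform_sequence)
      show "(\<lambda>z. ?P k z T) holomorphic_on ball 0 r1" for k using inv[of k] T by auto
      fix z :: complex assume "z \<in> ball 0 r1"
      then obtain d where d: "d > 0" "cball z d \<subseteq> ball 0 r1" using open_contains_cball open_ball by metis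
      have "uniform_limit (cball z d) (\<lambda>k z. ?P k z T) (\<lambda>z. R z T) sequentially"
        unfolding uniform_limit_iff
      proof (intro allI impI)
        fix e :: real assume "e > 0"
        from uniform_limitD[OF unif this]
        show "eventually (\<lambda>k. \<forall>z\<in>cball z d. dist (?P k z T) (R z T) < e) sequentially"
        proof eventually_elim
          case (elim k)
          show ?case
          proof
            fix w assume "w \<in> cball z d"
            then have "(w, T) \<in> ?S" using d T by auto
            then show "dist (?P k w T) (R w T) < e" using elim by auto
          qed
        qed
      qed
      then show "\<exists>d>0. cball z d \<subseteq> ball 0 r1 \<and> uniform_limit (cball z d) (\<lambda>k z. ?P k z T) (\<lambda>z. R z T) sequentially"
        using d by blast
    qed auto
    show "continuous_on {0..T} (R z)" if "z \<in> ball 0 r1" for z by (rule R_cont[OF that])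
    show "norm (R z t) \<le> (r1 + r2) / 2" if "z \<in> ball 0 r1" "t \<in> {0..T}" for z t
      using R_bound[OF that] by (simp add: rm_def)
    fix z :: complex and t :: real assume z: "z \<in> ball 0 r1" and t: "t \<in> {0..T}"
    have "uniform_limit {0..t} (\<lambda>k s. F (?P k z s) s) (\<lambda>s. F (R z s) s) sequentially"
    proof (rule uniform_limitI)
      fix e :: real assume e: "e > 0"
      define L where "L = 4 * C / (r2 - r1) + 1"
      have L: "L > 0" using C r by (auto simp: L_def add_nonneg_pos)
      then have "e / L > 0" using e by simp
      from uniform_limitD[OF unifz[OF z] this]
      show "eventually (\<lambda>k. \<forall>s\<in>{0..t}. dist (F (?P k z s) s) (F (R z s) s) < e) sequentially"
      proof eventually_elim
        case (elim k)
        show ?case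
        proof
          fix s assume s: "s \<in> {0..t}"
          then have s': "s \<in> {0..T}" using t by auto
          have "dist (F (?P k z s) s) (F (R z s) s) \<le> 4 * C / (r2 - r1) * dist (?P k z s) (R z s)"
            unfolding dist_norm by (rule lip) (use s' z bnd R_bound in auto)
          also have "\<dots> \<le> L * dist (?P k z s) (R z s)" by (rule mult_right_mono) (auto simp: L_def)
          also have "\<dots> < e" using elim s' L by (auto simp: field_simps)
          finally show "dist (F (?P k z s) s) (F (R z s) s) < e" .
        qed
      qed
    qed
    then obtain I J where IJ: "\<And>k. ((\<lambda>s. F (?P k z s) s) has_integral I k) {0..t}"
      "((\<lambda>s. F (R z s) s) has_integral J) {0..t}" "I \<longlonglongrightarrow> J"
      by (rule uniform_limit_integral) (use t in \<open>auto intro: continuous_on_subset[OF contFP[OF z]]\<close>)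
    then have "(\<lambda>k. ?P (Suc k) z t) \<longlonglongrightarrow> z + \<epsilon> * integral {0..t} (\<lambda>s. F (R z s) s)"
    proof -
      have "I = (\<lambda>k. integral {0..t} (\<lambda>s. F (?P k z s) s))" "J = integral {0..t} (\<lambda>s. F (R z s) s)"
        by (rule ext, rule integral_unique[symmetric, OF IJ(1)]) (rule integral_unique[symmetric, OF IJ(2)])
      then show ?thesis using IJ(3) by (auto intro!: tendsto_intros)
    qed
    moreover have "(\<lambda>k. ?P (Suc k) z t) \<longlonglongrightarrow> R z t"
      by (rule LIMSEQ_Suc[OF tendsto_uniform_limitI[OF unifz[OF z] t]])
    ultimately show "R z t = z + \<epsilon> * integral {0..t} (\<lambda>s. F (R z s) s)" using LIMSEQ_unique by blast
  qed
qed

section \<open>Functions divisible by the radius\<close>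

text \<open>Continuity includes the boundary of the disc, so that for compact \<open>P\<close>
  bounds and uniform continuity follow from compactness; holomorphy concerns the interior.\<close>

definition regular_on :: "real \<Rightarrow> 'p::topological_space set \<Rightarrow> (complex \<Rightarrow> 'p \<Rightarrow> complex) \<Rightarrow> bool" where
  "regular_on r P F \<longleftrightarrow> continuous_on (cball 0 r \<times> P) (\<lambda>(z, p). F z p) \<and> (\<forall>p\<in>P. (\<lambda>z. F z p) holomorphic_on ball 0 r)"

text \<open>The quotient is carried along explicitly because it must be jointly continuous in radius
  and parameter, including radius 0. The class is closed under products and inverses, so it contains
  the monomials divided by powers of 1 - \<alpha> x.\<close>

definition divided_on :: "real \<Rightarrow> 'p::topological_space set \<Rightarrow> (complex \<Rightarrow> 'p \<Rightarrow> complex) \<Rightarrow> bool" where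
  "divided_on r P F \<longleftrightarrow> regular_on r P F \<and>
     (\<exists>q. regular_on r P q \<and> (\<forall>z\<in>cball 0 r. \<forall>p\<in>P. F z p = F 0 p + z * q z p))"

lemma regular_on_param: "continuous_on P c \<Longrightarrow> regular_on r P (\<lambda>z. c)"
  unfolding regular_on_def case_prod_beta
  by (auto intro!: continuous_intros continuous_on_compose2[of P c])

lemma regular_on_id: "regular_on r P (\<lambda>z p. z)"
  unfolding regular_on_def case_prod_beta by (auto intro!: continuous_intros)

lemma regular_on_mult: "regular_on r P F \<Longrightarrow> regular_on r P G \<Longrightarrow> regular_on r P (\<lambda>z p. F z p * G z p)"
  unfolding regular_on_def case_prod_beta by (auto intro!: continuous_intros holomorphic_intros)

lemma regular_on_add: "regular_on r P F \<Longrightarrow> regular_on r P G \<Longrightarrow> regular_on r P (\<lambda>z p. F z p + G z p)"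
  unfolding regular_on_def case_prod_beta by (auto intro!: continuous_intros holomorphic_intros)

lemma regular_on_diff: "regular_on r P F \<Longrightarrow> regular_on r P G \<Longrightarrow> regular_on r P (\<lambda>z p. F z p - G z p)"
  unfolding regular_on_def case_prod_beta by (auto intro!: continuous_intros holomorphic_intros)

lemma regular_on_sum: "(\<And>i. i \<in> I \<Longrightarrow> regular_on r P (F i)) \<Longrightarrow> regular_on r P (\<lambda>z p. \<Sum>i\<in>I. F i z p)"
  unfolding regular_on_def case_prod_beta by (auto intro!: continuous_intros holomorphic_intros)

lemma regular_on_divide:
  assumes "regular_on r P F" "regular_on r P G" "\<And>z p. z \<in> cball 0 r \<Longrightarrow> p \<in> P \<Longrightarrow> G z p \<noteq> 0"
  shows "regular_on r P (\<lambda>z p. F z p / G z p)"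
  using assms unfolding regular_on_def case_prod_beta by (auto intro!: continuous_intros holomorphic_intros)

lemma regular_on_at_0: 
  assumes "regular_on r P F" "0 \<le> r" shows "regular_on r P (\<lambda>z. F 0)"
proof (rule regular_on_param)
  have "continuous_on P (\<lambda>p. (\<lambda>(z, p). F z p) (0, p))"
    by (rule continuous_on_compose2[of "cball 0 r \<times> P"])
       (use assms in \<open>auto simp: regular_on_def intro!: continuous_intros\<close>)
  then show "continuous_on P (F 0)" by simp
qed

lemma divided_on_regular: "divided_on r P F \<Longrightarrow> regular_on r P F"
  by (simp add: divided_on_def)

lemma divided_on_param: "continuous_on P c \<Longrightarrow> divided_on r P (\<lambda>z. c)"
  unfolding divided_on_def
  by (intro conjI exI[of _ "\<lambda>z p. 0"] regular_on_param) auto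

lemma divided_on_affine:
  assumes "continuous_on P c" "continuous_on P d"
  shows "divided_on r P (\<lambda>z p. c p + z * d p)"
  unfolding divided_on_def
  by (intro conjI exI[of _ "\<lambda>z. d"] regular_on_add regular_on_mult regular_on_id regular_on_param assms) auto

lemma divided_on_mult:
  assumes "divided_on r P F" "divided_on r P G" "0 \<le> r"
  shows "divided_on r P (\<lambda>z p. F z p * G z p)"
proof -
  obtain f g where f: "regular_on r P f" "\<forall>z\<in>cball 0 r. \<forall>p\<in>P. F z p = F 0 p + z * f z p"
    and g: "regular_on r P g" "\<forall>z\<in>cball 0 r. \<forall>p\<in>P. G z p = G 0 p + z * g z p"
    using assms by (auto simp: divided_on_def)
  have r: "regular_on r P F" "regular_on r P G" using assms divided_on_regular by auto
  have "F z p * G z p = F 0 p * G 0 p + z * (f z p * G z p + F 0 p * g z p)" if "z \<in> cball 0 r" "p \<in> P" for z p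
  proof -
    have "F z p = F 0 p + z * f z p" "G z p = G 0 p + z * g z p" using f g that by blast+
    then show ?thesis by algebra
  qed
  then show ?thesis unfolding divided_on_def
    by (intro conjI exI[of _ "\<lambda>z p. f z p * G z p + F 0 p * g z p"] regular_on_add regular_on_mult
        regular_on_at_0 r f g assms(3)) auto
qed

lemma divided_on_power: "divided_on r P F \<Longrightarrow> 0 \<le> r \<Longrightarrow> divided_on r P (\<lambda>z p. F z p ^ k)"
  by (induction k) (auto intro: divided_on_mult divided_on_param continuous_intros)

lemma divided_on_inverse:
  assumes "divided_on r P F" "0 \<le> r" and nz: "\<And>z p. z \<in> cball 0 r \<Longrightarrow> p \<in> P \<Longrightarrow> F z p \<noteq> 0"
  shows "divided_on r P (\<lambda>z p. 1 / F z p)"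
proof -
  obtain f where f: "regular_on r P f" "\<forall>z\<in>cball 0 r. \<forall>p\<in>P. F z p = F 0 p + z * f z p"
    using assms by (auto simp: divided_on_def)
  have r: "regular_on r P F" using assms divided_on_regular by auto
  have nz0: "F 0 p \<noteq> 0" if "p \<in> P" for p using nz that \<open>0 \<le> r\<close> by simp
  have "1 / F z p = 1 / F 0 p + z * ((0 - f z p) / (F z p * F 0 p))" if "z \<in> cball 0 r" "p \<in> P" for z p
  proof -
    have e: "z * f z p = F z p - F 0 p" using f that by force
    have "z * ((0 - f z p) / (F z p * F 0 p)) = - (F z p - F 0 p) / (F z p * F 0 p)"
      unfolding e[symmetric] by simp
    moreover have "1 / x = 1 / y + - (x - y) / (x * y)" if "x \<noteq> 0" "y \<noteq> 0" for x y :: complex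
      using that by (simp add: field_simps)
    ultimately show ?thesis using nz[OF that] nz0[OF that(2)] by (simp only:)
  qed
  moreover have "regular_on r P (\<lambda>z p. (0 - f z p) / (F z p * F 0 p))"
  proof (rule regular_on_divide)
    show "regular_on r P (\<lambda>z p. 0 - f z p)"
      by (rule regular_on_diff[OF regular_on_param[OF continuous_on_const] f(1)])
    show "regular_on r P (\<lambda>z p. F z p * F 0 p)"
      by (rule regular_on_mult[OF r regular_on_at_0[OF r \<open>0 \<le> r\<close>]])
    show "F z p * F 0 p \<noteq> 0" if "z \<in> cball 0 r" "p \<in> P" for z p
      using nz[OF that] nz0[OF that(2)] by simp
  qed
  moreover have "regular_on r P (\<lambda>z p. 1 / F z p)"
    by (rule regular_on_divide[OF regular_on_param[OF continuous_on_const] r nz])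
  ultimately show ?thesis unfolding divided_on_def by blast
qed

lemma regular_on_slice:
  assumes "regular_on r P F" "continuous_on S c" "c ` S \<subseteq> P"
  shows "regular_on r S (\<lambda>z s. F z (c s))"
proof -
  have "continuous_on (cball 0 r \<times> S) (\<lambda>x. (\<lambda>(z, p). F z p) (fst x, c (snd x)))"
    by (rule continuous_on_compose2[of "cball 0 r \<times> P"])
       (use assms in \<open>auto simp: regular_on_def intro!: continuous_intros continuous_on_compose2[OF assms(2)]\<close>)
  then show ?thesis using assms by (auto simp: regular_on_def case_prod_beta)
qed

lemma regular_on_bounded:
  assumes "regular_on r P F" "compact P"
  obtains B where "B > 0" "\<And>z p. z \<in> cball 0 r \<Longrightarrow> p \<in> P \<Longrightarrow> norm (F z p) \<le> B"
proof -
  have "compact ((\<lambda>(z, p). F z p) ` (cball 0 r \<times> P))"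
    using assms by (intro compact_continuous_image compact_Times) (auto simp: regular_on_def)
  then have "bounded ((\<lambda>(z, p). F z p) ` (cball 0 r \<times> P))" by (rule compact_imp_bounded)
  then obtain B where "B > 0" "\<forall>x\<in>(\<lambda>(z, p). F z p) ` (cball 0 r \<times> P). norm x \<le> B"
    unfolding bounded_pos by blast
  then show ?thesis using that[of B] by force
qed

lemma regular_on_uniform_limit:
  fixes F :: "complex \<Rightarrow> real \<times> 'q::metric_space \<Rightarrow> complex"
  assumes "regular_on r (S \<times> E) F" "compact S" "compact E"
    and e: "e \<longlonglongrightarrow> e0" "e0 \<in> E" "\<And>k. e k \<in> E"
  shows "uniform_limit (cball 0 r \<times> S) (\<lambda>k (z, s). F z (s, e k)) (\<lambda>(z, s). F z (s, e0)) sequentially"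
proof (rule uniform_limitI)
  fix d :: real assume "d > 0"
  let ?F = "\<lambda>(z, p). F z p"
  have "uniformly_continuous_on (cball 0 r \<times> S \<times> E) ?F"
    using assms by (intro compact_uniformly_continuous compact_Times) (auto simp: regular_on_def)
  then obtain \<eta> where \<eta>: "\<eta> > 0" "\<And>x y. x \<in> cball 0 r \<times> S \<times> E \<Longrightarrow> y \<in> cball 0 r \<times> S \<times> E \<Longrightarrow> dist y x < \<eta> \<Longrightarrow> dist (?F y) (?F x) < d"
    using \<open>d > 0\<close> unfolding uniformly_continuous_on_def by metis
  show "eventually (\<lambda>k. \<forall>x\<in>cball 0 r \<times> S. dist (case x of (z, s) \<Rightarrow> F z (s, e k)) (case x of (z, s) \<Rightarrow> F z (s, e0)) < d) sequentially"
    using tendstoD[OF e(1) \<eta>(1)]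
  proof eventually_elim
    case (elim k)
    show ?case
    proof clarify
      fix z s assume "z \<in> cball (0::complex) r" "s \<in> S"
      then have "dist (?F (z, s, e k)) (?F (z, s, e0)) < d"
        using e elim by (intro \<eta>(2)) (auto simp: dist_Pair_Pair)
      then show "dist (F z (s, e k)) (F z (s, e0)) < d" by simp
    qed
  qed
qed

section \<open>Uniqueness and displacement of solutions\<close>

text \<open>Gronwall's argument: |f|^2 times \<open>exp (- 2 * M * (t - a))\<close> does not
  increase, and it starts at 0.\<close>

lemma vanishing_forward:
  fixes f :: "real \<Rightarrow> complex"
  assumes "a \<le> b" "f a = 0"
    and der: "\<And>t. t \<in> {a..b} \<Longrightarrow> (f has_vector_derivative f' t) (at t within {a..b})"
    and bd: "\<And>t. t \<in> {a..b} \<Longrightarrow> norm (f' t) \<le> M * norm (f t)"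
  shows "f b = 0"
proof (cases "a = b")
  case False
  with assms have "a < b" by simp
  define \<phi> where "\<phi> t = (f t \<bullet> f t) * exp (- 2 * M * (t - a))" for t
  have "\<phi> b \<le> \<phi> a"
  proof (rule DERIV_nonpos_imp_decreasing_open[OF \<open>a \<le> b\<close>])
    fix t assume t: "a < t" "t < b"
    then have "at t within {a..b} = at t" by (rule at_within_Icc_at)
    with der[of t] t have d: "(f has_vector_derivative f' t) (at t)" by simp
    have "((\<lambda>t. f t \<bullet> f t) has_real_derivative f t \<bullet> f' t + f' t \<bullet> f t) (at t)"
      using bounded_bilinear.has_vector_derivative[OF bounded_bilinear_inner d d]
      by (simp add: has_real_derivative_iff_has_vector_derivative)
    then have "(\<phi> has_real_derivative ((f t \<bullet> f' t + f' t \<bullet> f t) * exp (- 2 * M * (t - a)) +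
      exp (- 2 * M * (t - a)) * (- 2 * M) * (f t \<bullet> f t))) (at t)"
      unfolding \<phi>_def by (auto intro!: derivative_eq_intros)
    moreover have "(f t \<bullet> f' t + f' t \<bullet> f t) * exp (- 2 * M * (t - a)) +
      exp (- 2 * M * (t - a)) * (- 2 * M) * (f t \<bullet> f t) = 2 * exp (- 2 * M * (t - a)) * (f t \<bullet> f' t - M * (f t \<bullet> f t))"
      by (simp add: inner_commute algebra_simps)
    moreover have "f t \<bullet> f' t \<le> M * (f t \<bullet> f t)"
    proof -
      have "f t \<bullet> f' t \<le> norm (f t) * norm (f' t)" by (rule norm_cauchy_schwarz)
      also have "\<dots> \<le> norm (f t) * (M * norm (f t))" using bd[of t] t by (intro mult_left_mono) auto
      finally show ?thesis by (simp add: dot_square_norm power2_eq_square mult_ac)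
    qed
    ultimately show "\<exists>y. (\<phi> has_real_derivative y) (at t) \<and> y \<le> 0"
      by (metis diff_le_0_iff_le exp_ge_zero mult_nonneg_nonpos mult_nonneg_nonneg zero_le_numeral)
  next
    have "continuous_on {a..b} f"
      unfolding continuous_on_eq_continuous_within using der has_vector_derivative_continuous by blast
    then show "continuous_on {a..b} \<phi>" unfolding \<phi>_def by (intro continuous_intros)
  qed
  then have "(f b \<bullet> f b) * exp (- 2 * M * (b - a)) \<le> 0" by (simp add: \<phi>_def assms(2))
  then have "f b \<bullet> f b \<le> 0" by (simp add: mult_le_0_iff)
  then have "f b \<bullet> f b = 0" using inner_ge_zero[of "f b"] by linarith
  then show ?thesis by simp
qed (use assms in simp)

lemma ode_solutions_agree:
  fixes g h :: "real \<Rightarrow> complex"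
  assumes "g 0 = h 0" "t \<in> {0..T}"
    and g: "\<And>t. t \<in> {0..T} \<Longrightarrow> (g has_vector_derivative of_real \<epsilon> * F (g t) t) (at t within {0..T})"
    and h: "\<And>t. t \<in> {0..T} \<Longrightarrow> (h has_vector_derivative of_real \<epsilon> * F (h t) t) (at t within {0..T})"
    and lip: "\<And>t. t \<in> {0..T} \<Longrightarrow> norm (F (g t) t - F (h t) t) \<le> L * norm (g t - h t)"
  shows "g t = h t"
proof -
  have "(\<lambda>t. g t - h t) t = 0"
  proof (rule vanishing_forward[of 0 t _ _ "\<bar>\<epsilon>\<bar> * L"])
    fix s assume s: "s \<in> {0..t}"
    then have s': "s \<in> {0..T}" using assms by auto
    have "((\<lambda>t. g t - h t) has_vector_derivative of_real \<epsilon> * F (g s) s - of_real \<epsilon> * F (h s) s) (at s within {0..T})"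
      by (intro has_vector_derivative_diff g h s')
    then have "((\<lambda>t. g t - h t) has_vector_derivative of_real \<epsilon> * F (g s) s - of_real \<epsilon> * F (h s) s) (at s within {0..t})"
      by (rule has_vector_derivative_within_subset) (use assms in auto)
    then show "((\<lambda>t. g t - h t) has_vector_derivative of_real \<epsilon> * (F (g s) s - F (h s) s)) (at s within {0..t})"
      by (simp add: right_diff_distrib)
    show "norm (of_real \<epsilon> * (F (g s) s - F (h s) s)) \<le> \<bar>\<epsilon>\<bar> * L * norm (g s - h s)"
      using lip[OF s'] by (simp add: norm_mult mult.assoc mult_left_mono)
  qed (use assms in auto)
  then show ?thesis by simp
qed

lemma regular_on_lipschitz:
  assumes "regular_on r S F" "\<And>z t. z \<in> cball 0 r \<Longrightarrow> t \<in> S \<Longrightarrow> norm (F z t) \<le> C"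
    and "r' < r" "t \<in> S" "z \<in> cball 0 r'" "w \<in> cball 0 r'"
  shows "norm (F z t - F w t) \<le> 2 * C / (r - r') * norm (z - w)"
  using assms by (intro holomorphic_lipschitz[of "\<lambda>z. F z t"]) (auto simp: regular_on_def)

text \<open>\<open>\<epsilon> G\<close> is the displacement over time \<open>T\<close> of the equation \<open>z' = \<epsilon> F(z, t)\<close>.\<close>

lemma displacement_map:
  fixes F :: "complex \<Rightarrow> real \<Rightarrow> complex"
  assumes r: "0 < r1" "r1 < r2" and T: "T \<ge> 0" and "\<epsilon> \<noteq> 0"
    and F: "regular_on r2 {0..T} F"
    and bd: "\<And>z t. z \<in> cball 0 r2 \<Longrightarrow> t \<in> {0..T} \<Longrightarrow> norm (F z t) \<le> C"
    and small: "8 * \<bar>\<epsilon>\<bar> * C * T \<le> r2 - r1"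
  obtains G where "G holomorphic_on ball 0 r1"
    "\<And>z. z \<in> ball 0 r1 \<Longrightarrow> norm (G z) \<le> C * T"
    "\<And>z. z \<in> ball 0 r1 \<Longrightarrow> norm (G z - integral {0..T} (F z)) \<le> 4 * C / (r2 - r1) * (\<bar>\<epsilon>\<bar> * (C * T)) * T"
    "\<And>g. (\<And>t. t \<in> {0..T} \<Longrightarrow> (g has_vector_derivative of_real \<epsilon> * F (g t) t) (at t within {0..T})) \<Longrightarrow>
       (\<And>t. t \<in> {0..T} \<Longrightarrow> norm (g t) < r1) \<Longrightarrow> g T = g 0 + of_real \<epsilon> * G (g 0)"
proof -
  have cont: "continuous_on (cball 0 r2 \<times> {0..T}) (\<lambda>(z, t). F z t)"
    and hol: "\<And>t. t \<in> {0..T} \<Longrightarrow> (\<lambda>z. F z t) holomorphic_on ball 0 r2"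
    using F by (auto simp: regular_on_def)
  obtain R where R: "(\<lambda>z. R z T) holomorphic_on ball 0 r1"
    "\<And>z. z \<in> ball 0 r1 \<Longrightarrow> continuous_on {0..T} (R z)"
    "\<And>z t. z \<in> ball 0 r1 \<Longrightarrow> t \<in> {0..T} \<Longrightarrow> norm (R z t) \<le> (r1 + r2) / 2"
    "\<And>z t. z \<in> ball 0 r1 \<Longrightarrow> t \<in> {0..T} \<Longrightarrow> R z t = z + of_real \<epsilon> * integral {0..t} (\<lambda>s. F (R z s) s)"
    using picard_flow[OF r T cont hol bd small] by blast
  define rm where "rm = (r1 + r2) / 2"
  have rm: "r1 < rm" "rm < r2" using r by (auto simp: rm_def)
  have lip: "norm (F z t - F w t) \<le> 4 * C / (r2 - r1) * norm (z - w)"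
    if "t \<in> {0..T}" "norm z \<le> rm" "norm w \<le> rm" for z w t
  proof -
    have "norm (F z t - F w t) \<le> 2 * C / (r2 - rm) * norm (z - w)"
      by (rule regular_on_lipschitz[OF F bd]) (use that rm in auto)
    also have "2 * C / (r2 - rm) = 4 * C / (r2 - r1)" using r by (auto simp: rm_def field_simps)
    finally show ?thesis .
  qed
  have contFR: "continuous_on {0..T} (\<lambda>s. F (R z s) s)" if z: "z \<in> ball 0 r1" for z
  proof -
    have "continuous_on {0..T} (\<lambda>s. (\<lambda>(z, t). F z t) (R z s, s))"
    proof (rule continuous_on_compose2[OF cont])
      show "(\<lambda>s. (R z s, s)) ` {0..T} \<subseteq> cball 0 r2 \<times> {0..T}"
        using R(3)[OF z] rm by (fastforce simp: rm_def)
    qed (intro continuous_intros R z)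
    then show ?thesis by simp
  qed
  have contF: "continuous_on {0..T} (F z)" if z: "z \<in> ball 0 r1" for z
  proof -
    have "continuous_on {0..T} (\<lambda>s. (\<lambda>(z, t). F z t) (z, s))"
      by (rule continuous_on_compose2[OF cont]) (use z r in \<open>auto intro!: continuous_intros\<close>)
    then show ?thesis by simp
  qed
  have bdR: "norm (F (R z t) t) \<le> C" if "z \<in> ball 0 r1" "t \<in> {0..T}" for z t
    using R(3)[OF that] rm that by (intro bd) (auto simp: rm_def)
  have drift: "norm (R z t - z) \<le> \<bar>\<epsilon>\<bar> * (C * T)" if z: "z \<in> ball 0 r1" and t: "t \<in> {0..T}" for z t
  proof -
    have "norm (integral {0..t} (\<lambda>s. F (R z s) s)) \<le> C * T"
      by (rule norm_integral_le[OF contFR[OF z] bdR[OF z] t])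
    then have "\<bar>\<epsilon>\<bar> * norm (integral {0..t} (\<lambda>s. F (R z s) s)) \<le> \<bar>\<epsilon>\<bar> * (C * T)" by (rule mult_left_mono) auto
    then show ?thesis using R(4)[OF z t] by (simp add: norm_mult)
  qed
  define G where "G z = (R z T - z) / of_real \<epsilon>" for z
  have G: "G z = integral {0..T} (\<lambda>s. F (R z s) s)" if z: "z \<in> ball 0 r1" for z
    using R(4)[OF z, of T] T \<open>\<epsilon> \<noteq> 0\<close> by (simp add: G_def)
  show ?thesis
  proof
    show "G holomorphic_on ball 0 r1" unfolding G_def using \<open>\<epsilon> \<noteq> 0\<close> by (intro holomorphic_intros R) auto
    show "norm (G z) \<le> C * T" if z: "z \<in> ball 0 r1" for z
      unfolding G[OF z] by (rule norm_integral_le[OF contFR[OF z] bdR[OF z]]) (use T in auto)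
    show "norm (G z - integral {0..T} (F z)) \<le> 4 * C / (r2 - r1) * (\<bar>\<epsilon>\<bar> * (C * T)) * T" if z: "z \<in> ball 0 r1" for z
    proof -
      have C: "C \<ge> 0" using order_trans[OF norm_ge_zero bd[of 0 0]] T r by simp
      have "G z - integral {0..T} (F z) = integral {0..T} (\<lambda>s. F (R z s) s - F z s)"
        unfolding G[OF z]
        by (rule Henstock_Kurzweil_Integration.integral_diff[symmetric])
           (intro integrable_continuous_real contFR contF z)+
      also have "norm \<dots> \<le> 4 * C / (r2 - r1) * (\<bar>\<epsilon>\<bar> * (C * T)) * T"
      proof (rule norm_integral_le)
        show "continuous_on {0..T} (\<lambda>s. F (R z s) s - F z s)" by (intro continuous_intros contFR contF z)
        fix s assume s: "s \<in> {0..T}"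
        have "norm (F (R z s) s - F z s) \<le> 4 * C / (r2 - r1) * norm (R z s - z)"
          by (rule lip[OF s]) (use R(3)[OF z s] z rm in \<open>auto simp: rm_def\<close>)
        also have "\<dots> \<le> 4 * C / (r2 - r1) * (\<bar>\<epsilon>\<bar> * (C * T))"
          using drift[OF z s] C r by (intro mult_left_mono) auto
        finally show "norm (F (R z s) s - F z s) \<le> 4 * C / (r2 - r1) * (\<bar>\<epsilon>\<bar> * (C * T))" .
      qed (use T in auto)
      finally show ?thesis .
    qed
    fix g assume g: "\<And>t. t \<in> {0..T} \<Longrightarrow> (g has_vector_derivative of_real \<epsilon> * F (g t) t) (at t within {0..T})"
      and gb: "\<And>t. t \<in> {0..T} \<Longrightarrow> norm (g t) < r1"
    have z: "g 0 \<in> ball 0 r1" using gb[of 0] T by simp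
    have "g T = R (g 0) T"
    proof (rule ode_solutions_agree[of g "R (g 0)" T T \<epsilon> F "4 * C / (r2 - r1)"])
      show "g 0 = R (g 0) 0" using R(4)[OF z, of 0] T by simp
      fix t assume t: "t \<in> {0..T}"
      show "(R (g 0) has_vector_derivative of_real \<epsilon> * F (R (g 0) t) t) (at t within {0..T})"
      proof (rule has_vector_derivative_transform[OF t])
        show "((\<lambda>t. g 0 + of_real \<epsilon> * integral {0..t} (\<lambda>s. F (R (g 0) s) s)) has_vector_derivative
          of_real \<epsilon> * F (R (g 0) t) t) (at t within {0..T})"
          by (rule derivative_eq_intros integral_has_vector_derivative[OF contFR[OF z] t] refl | simp)+
      qed (use R(4)[OF z] in auto)
      show "norm (F (g t) t - F (R (g 0) t) t) \<le> 4 * C / (r2 - r1) * norm (g t - R (g 0) t)"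
        by (rule lip[OF t]) (use gb[OF t] R(3)[OF z t] rm in \<open>auto simp: rm_def\<close>)
    qed (use T g in auto)
    then show "g T = g 0 + of_real \<epsilon> * G (g 0)" using \<open>\<epsilon> \<noteq> 0\<close> by (simp add: G_def)
  qed
qed

text \<open>The steps of such a sequence cannot change sign. Applied to the iterates of the return map, this shows
  that an orbit closing after several turns closes after one.\<close>

lemma constant_of_slowly_varying_steps:
  fixes x :: "nat \<Rightarrow> real"
  assumes step: "\<And>j. \<bar>(x (Suc (Suc j)) - x (Suc j)) - (x (Suc j) - x j)\<bar> \<le> \<bar>x (Suc j) - x j\<bar> / 2"
    and "x k = x 0" "k \<ge> 1"
  shows "x 1 = x 0"
proof -
  have pos: False if st: "\<And>j. \<bar>(y (Suc (Suc j)) - y (Suc j)) - (y (Suc j) - y j)\<bar> \<le> \<bar>y (Suc j) - y j\<bar> / 2"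
    and "y k = y 0" "y 1 > y 0" for y :: "nat \<Rightarrow> real"
  proof -
    have inc: "y (Suc j) > y j" for j
    proof (induction j)
      case (Suc j)
      then show ?case using st[of j] by (simp add: abs_if split: if_splits)
    qed (use that in simp)
    have "0 < k" using \<open>k \<ge> 1\<close> by simp
    from lift_Suc_mono_less[of y, OF inc this] \<open>y k = y 0\<close> show False by simp
  qed
  show ?thesis
  proof (cases "x 1" "x 0" rule: linorder_cases)
    case less
    have False
    proof (rule pos[of "\<lambda>j. - x j"])
      fix j
      have e: "(- x (Suc (Suc j)) - - x (Suc j)) - (- x (Suc j) - - x j) = - ((x (Suc (Suc j)) - x (Suc j)) - (x (Suc j) - x j))"
        "- x (Suc j) - - x j = - (x (Suc j) - x j)" by simp_all
      show "\<bar>(- x (Suc (Suc j)) - - x (Suc j)) - (- x (Suc j) - - x j)\<bar> \<le> \<bar>- x (Suc j) - - x j\<bar> / 2"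
        unfolding e(1) unfolding e(2) abs_minus_cancel by (rule step)
    qed (use assms(2) less in simp_all)
    then show ?thesis ..
  next
    case greater
    have False by (rule pos[OF step assms(2) greater])
    then show ?thesis ..
  qed
qed

section \<open>The equation in polar coordinates\<close>

text \<open>The exponent \<open>Suc m\<close> stands for m1 + m2: as \<alpha>1 = \<alpha>2, the two
  factors of the denominator merge.\<close>

definition perturbation :: "nat \<Rightarrow> real \<Rightarrow> nat \<Rightarrow> coeffs \<Rightarrow> real \<Rightarrow> real \<Rightarrow> real" where
  "perturbation m \<alpha> n a x y = (\<Sum>(i, j)\<in>indices n. a i j * (x ^ i * y ^ j * (1 / (1 - \<alpha> * x)) ^ Suc m))"

definition complex_monomial :: "nat \<Rightarrow> real \<Rightarrow> nat \<Rightarrow> nat \<Rightarrow> complex \<Rightarrow> complex \<Rightarrow> complex" where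
  "complex_monomial m \<alpha> i j x y = x ^ i * y ^ j * (1 / (1 - of_real \<alpha> * x)) ^ Suc m"

text \<open>With \<open>x = e\<^sub>1 + r sin \<theta>\<close>, \<open>y = e\<^sub>2 + r cos \<theta>\<close>, where \<open>(e\<^sub>1, e\<^sub>2)\<close> is the equilibrium, an orbit
  satisfies \<open>dr/d\<theta> = \<epsilon> polar_speed\<close>. The quotients by \<open>r\<close> are bounded near \<open>r = 0\<close>.\<close>

definition polar_speed :: "nat \<Rightarrow> real \<Rightarrow> nat \<Rightarrow> real \<Rightarrow> coeffs \<Rightarrow> coeffs \<Rightarrow> real \<times> real \<Rightarrow> real \<Rightarrow> real \<Rightarrow> real" where
  "polar_speed m \<alpha> n \<epsilon> a b e r t =
    (let d = (\<lambda>c. (perturbation m \<alpha> n c (fst e + r * sin t) (snd e + r * cos t) - perturbation m \<alpha> n c (fst e) (snd e)) / r)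
     in r * (sin t * d a + cos t * d b) / (1 + \<epsilon> * (cos t * d a - sin t * d b)))"

text \<open>The pairs (r, \<theta>) and (-r, \<theta> + \<pi>) are the same point, so every solution
  has a reflected one. The initial value of the reflected solution is the negative zero that belongs
  to an orbit.\<close>

lemma polar_speed_opposite: "polar_speed m \<alpha> n \<epsilon> a b e (- r) (t + pi) = - polar_speed m \<alpha> n \<epsilon> a b e r t"
  by (simp add: polar_speed_def Let_def)

lemma polar_speed_period: "polar_speed m \<alpha> n \<epsilon> a b e r (t + 2 * pi) = polar_speed m \<alpha> n \<epsilon> a b e r t"
  by (simp add: polar_speed_def)

lemma uniform_limit_of_tendsto:
  assumes "(c \<longlongrightarrow> l) F" shows "uniform_limit S (\<lambda>k x. c k) (\<lambda>x. l) F"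
  unfolding uniform_limit_iff using tendstoD[OF assms] by (auto elim: eventually_mono)

text \<open>Uniform convergence of products needs bounded limits, so the two properties travel
  together.\<close>

definition bounded_uniform_limit :: "'a set \<Rightarrow> (nat \<Rightarrow> 'a \<Rightarrow> complex) \<Rightarrow> ('a \<Rightarrow> complex) \<Rightarrow> bool" where
  "bounded_uniform_limit S f l \<longleftrightarrow> uniform_limit S f l sequentially \<and> bounded (l ` S)"

lemma bounded_uniform_limit_mult:
  "bounded_uniform_limit S f l \<Longrightarrow> bounded_uniform_limit S g m \<Longrightarrow> bounded_uniform_limit S (\<lambda>k x. f k x * g k x) (\<lambda>x. l x * m x)"
  unfolding bounded_uniform_limit_def
proof (intro conjI uniform_lim_mult; (elim conjE)?)
  assume "bounded (l ` S)" "bounded (m ` S)"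
  then obtain A B where "\<forall>x\<in>S. norm (l x) \<le> A" "\<forall>x\<in>S. norm (m x) \<le> B" by (auto simp: bounded_iff)
  then have "norm (l x * m x) \<le> A * B" if "x \<in> S" for x
    using that unfolding norm_mult by (intro mult_mono) (auto intro: order_trans[OF norm_ge_zero])
  then show "bounded ((\<lambda>x. l x * m x) ` S)" by (intro boundedI[of _ "A * B"]) auto
qed assumption+

lemma bounded_uniform_limit_add:
  "bounded_uniform_limit S f l \<Longrightarrow> bounded_uniform_limit S g m \<Longrightarrow> bounded_uniform_limit S (\<lambda>k x. f k x + g k x) (\<lambda>x. l x + m x)"
  unfolding bounded_uniform_limit_def
  by (auto intro!: uniform_limit_intros bounded_plus_comp)

lemma bounded_uniform_limit_diff:
  "bounded_uniform_limit S f l \<Longrightarrow> bounded_uniform_limit S g m \<Longrightarrow> bounded_uniform_limit S (\<lambda>k x. f k x - g k x) (\<lambda>x. l x - m x)"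
  unfolding bounded_uniform_limit_def
  by (auto intro!: uniform_limit_intros bounded_minus_comp)

lemma bounded_uniform_limit_const: "bounded (l ` S) \<Longrightarrow> bounded_uniform_limit S (\<lambda>k. l) l"
  unfolding bounded_uniform_limit_def by (auto intro!: uniform_limit_intros)

lemma bounded_uniform_limit_tendsto: "c \<longlonglongrightarrow> l \<Longrightarrow> bounded_uniform_limit S (\<lambda>k x. c k) (\<lambda>x. l)"
  unfolding bounded_uniform_limit_def by (auto intro!: uniform_limit_of_tendsto boundedI[of _ "norm l"])

lemma bounded_uniform_limit_sum:
  "finite I \<Longrightarrow> (\<And>i. i \<in> I \<Longrightarrow> bounded_uniform_limit S (\<lambda>k. f k i) (l i)) \<Longrightarrow>
   bounded_uniform_limit S (\<lambda>k x. \<Sum>i\<in>I. f k i x) (\<lambda>x. \<Sum>i\<in>I. l i x)"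
  by (induction I rule: finite_induct)
     (auto intro!: bounded_uniform_limit_add bounded_uniform_limit_const boundedI[of _ 0])

section \<open>The complexified polar equation\<close>

text \<open>The quotients \<open>q\<close> are fixed before the coefficients, \<epsilon> and the
  centre are chosen, which makes the estimates uniform in these. The condition \<open>small\<close>
  keeps 1 - \<alpha> x away from 0 for complex radii up to \<open>r\<close> and every centre in the
  square of half side \<eta>.\<close>

locale polar_quotients =
  fixes m n :: nat and \<alpha> r \<eta> :: real and q :: "nat \<Rightarrow> nat \<Rightarrow> complex \<Rightarrow> real \<times> (real \<times> real) \<Rightarrow> complex"
  assumes r: "0 < r" and \<eta>: "0 \<le> \<eta>" and small: "\<bar>\<alpha>\<bar> * (\<eta> + r) < 1"
    and regular: "regular_on r ({0..2 * pi} \<times> ({-\<eta>..\<eta>} \<times> {-\<eta>..\<eta>})) (q i j)"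
    and quotient: "z \<in> cball 0 r \<Longrightarrow> t \<in> {0..2 * pi} \<Longrightarrow> e \<in> {-\<eta>..\<eta>} \<times> {-\<eta>..\<eta>} \<Longrightarrow>
      complex_monomial m \<alpha> i j (of_real (fst e) + z * of_real (sin t)) (of_real (snd e) + z * of_real (cos t)) =
      complex_monomial m \<alpha> i j (of_real (fst e)) (of_real (snd e)) + z * q i j z (t, e)"
begin

abbreviation "E \<equiv> {-\<eta>..\<eta>} \<times> {-\<eta>..\<eta>}"

definition quot_sum :: "coeffs \<Rightarrow> real \<times> real \<Rightarrow> complex \<Rightarrow> real \<Rightarrow> complex" where
  "quot_sum a e z t = (\<Sum>(i, j)\<in>indices n. of_real (a i j) * q i j z (t, e))"

text \<open>The extension of \<open>polar_speed\<close> to complex radius. It also makes sense at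
  radius 0, as \<open>q\<close> replaces the division.\<close>

definition polar_field :: "real \<Rightarrow> coeffs \<Rightarrow> coeffs \<Rightarrow> real \<times> real \<Rightarrow> complex \<Rightarrow> real \<Rightarrow> complex" where
  "polar_field \<epsilon> a b e z t = z * (of_real (sin t) * quot_sum a e z t + of_real (cos t) * quot_sum b e z t) /
     (1 + of_real \<epsilon> * (of_real (cos t) * quot_sum a e z t - of_real (sin t) * quot_sum b e z t))"

lemma quot_sum_of_real:
  assumes "x \<noteq> 0" "\<bar>x\<bar> \<le> r" "t \<in> {0..2 * pi}" "e \<in> E"
  shows "quot_sum a e (of_real x) t = of_real ((perturbation m \<alpha> n a (fst e + x * sin t) (snd e + x * cos t) -
    perturbation m \<alpha> n a (fst e) (snd e)) / x)"
proof -
  have "of_real x * quot_sum a e (of_real x) t = (\<Sum>(i, j)\<in>indices n. of_real (a i j) * (of_real x * q i j (of_real x) (t, e)))"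
    by (simp add: quot_sum_def sum_distrib_left case_prod_beta mult_ac)
  moreover have "of_real x * q i j (of_real x) (t, e) =
      complex_monomial m \<alpha> i j (of_real (fst e) + of_real x * of_real (sin t)) (of_real (snd e) + of_real x * of_real (cos t)) -
      complex_monomial m \<alpha> i j (of_real (fst e)) (of_real (snd e))" for i j
    using quotient[of "of_real x" t e i j] assms by simp
  moreover have "(\<Sum>(i, j)\<in>indices n. of_real (a i j) *
      (complex_monomial m \<alpha> i j (of_real (fst e) + of_real x * of_real (sin t)) (of_real (snd e) + of_real x * of_real (cos t)) -
      complex_monomial m \<alpha> i j (of_real (fst e)) (of_real (snd e)))) =
      of_real (perturbation m \<alpha> n a (fst e + x * sin t) (snd e + x * cos t) - perturbation m \<alpha> n a (fst e) (snd e))"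
    by (simp add: perturbation_def complex_monomial_def sum_subtractf[symmetric] right_diff_distrib case_prod_beta)
  ultimately have "of_real x * quot_sum a e (of_real x) t =
    of_real (perturbation m \<alpha> n a (fst e + x * sin t) (snd e + x * cos t) - perturbation m \<alpha> n a (fst e) (snd e))"
    by simp
  then show ?thesis using assms(1) by (simp add: field_simps)
qed

lemma polar_field_of_real:
  assumes "x \<noteq> 0" "\<bar>x\<bar> \<le> r" "t \<in> {0..2 * pi}" "e \<in> E"
  shows "polar_field \<epsilon> a b e (of_real x) t = of_real (polar_speed m \<alpha> n \<epsilon> a b e x t)"
  unfolding polar_field_def quot_sum_of_real[OF assms] polar_speed_def Let_def by simp

lemma quot_sum_bounded:
  obtains B where "B > 0" "\<And>a b z t e. (a, b) \<in> coeff_box n K \<Longrightarrow> z \<in> cball 0 r \<Longrightarrow> t \<in> {0..2 * pi} \<Longrightarrow> e \<in> E \<Longrightarrow>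
    norm (quot_sum a e z t) \<le> B \<and> norm (quot_sum b e z t) \<le> B"
proof -
  have "\<exists>B>0. \<forall>z\<in>cball 0 r. \<forall>p\<in>{0..2 * pi} \<times> E. norm (q i j z p) \<le> B" for i j
    using regular_on_bounded[OF regular[of i j] compact_Times[OF compact_Icc compact_Times[OF compact_Icc compact_Icc]]] by metis
  then obtain C where C: "\<And>i j. C i j > 0" "\<And>i j z p. z \<in> cball 0 r \<Longrightarrow> p \<in> {0..2 * pi} \<times> E \<Longrightarrow> norm (q i j z p) \<le> C i j"
    by metis
  define B where "B = (\<Sum>(i, j)\<in>indices n. \<bar>K\<bar> * C i j) + 1"
  have bd: "norm (quot_sum a e z t) \<le> B"
    if "\<And>i j. i + j \<le> n \<Longrightarrow> \<bar>a i j\<bar> \<le> K" "z \<in> cball 0 r" "t \<in> {0..2 * pi}" "e \<in> E" for a e z t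
  proof -
    have "norm (quot_sum a e z t) \<le> (\<Sum>(i, j)\<in>indices n. \<bar>K\<bar> * C i j)"
      unfolding quot_sum_def case_prod_beta
    proof (rule sum_norm_le)
      fix x assume "x \<in> indices n"
      then have "\<bar>a (fst x) (snd x)\<bar> \<le> \<bar>K\<bar>" using that(1)[of "fst x" "snd x"] by (auto simp: indices_def)
      moreover have "norm (q (fst x) (snd x) z (t, e)) \<le> C (fst x) (snd x)" using that by (intro C(2)) auto
      ultimately show "norm (of_real (a (fst x) (snd x)) * q (fst x) (snd x) z (t, e)) \<le> \<bar>K\<bar> * C (fst x) (snd x)"
        by (simp add: norm_mult mult_mono)
    qed
    then show ?thesis by (simp add: B_def)
  qed
  have "B > 0" unfolding B_def using C(1) by (intro add_nonneg_pos sum_nonneg) (auto simp: less_imp_le)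
  with bd show ?thesis using that[of B] by (force simp: coeff_box_def)
qed

lemma quot_sum_regular: "e \<in> E \<Longrightarrow> regular_on r {0..2 * pi} (quot_sum a e)"
proof -
  assume e: "e \<in> E"
  have "regular_on r {0..2 * pi} (\<lambda>z t. q i j z (t, e))" for i j
    by (rule regular_on_slice[OF regular]) (use e in \<open>auto intro!: continuous_intros\<close>)
  then have "regular_on r {0..2 * pi} (\<lambda>z t. \<Sum>(i, j)\<in>indices n. of_real (a i j) * q i j z (t, e))"
    unfolding case_prod_beta by (intro regular_on_sum regular_on_mult regular_on_param continuous_on_const)
  then show ?thesis by (simp add: quot_sum_def[abs_def])
qed

lemma trig_combination_norm_le:
  assumes "norm (u::complex) \<le> B" "norm v \<le> B" "\<bar>c\<bar> \<le> 1" "\<bar>s\<bar> \<le> 1"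
  shows "norm (of_real c * u + of_real s * v) \<le> 2 * B" "norm (of_real c * u - of_real s * v) \<le> 2 * B"
proof -
  have *: "norm (of_real c * u) \<le> B" "norm (of_real s * v) \<le> B"
    using mult_mono[of "\<bar>c\<bar>" 1 "norm u" B] mult_mono[of "\<bar>s\<bar>" 1 "norm v" B] assms by (auto simp: norm_mult)
  show "norm (of_real c * u + of_real s * v) \<le> 2 * B"
    using * norm_triangle_ineq[of "of_real c * u" "of_real s * v"] by linarith
  show "norm (of_real c * u - of_real s * v) \<le> 2 * B"
    using * norm_triangle_ineq4[of "of_real c * u" "of_real s * v"] by linarith
qed

lemma polar_field_denominator:
  assumes "norm (quot_sum a e z t) \<le> B" "norm (quot_sum b e z t) \<le> B" "4 * \<bar>\<epsilon>\<bar> * B \<le> 1"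
  shows "norm (1 + of_real \<epsilon> * (of_real (cos t) * quot_sum a e z t - of_real (sin t) * quot_sum b e z t)) \<ge> 1 / 2"
proof -
  let ?w = "of_real (cos t) * quot_sum a e z t - of_real (sin t) * quot_sum b e z t"
  have "norm ?w \<le> 2 * B" by (rule trig_combination_norm_le) (use assms in auto)
  then have "\<bar>\<epsilon>\<bar> * norm ?w \<le> \<bar>\<epsilon>\<bar> * (2 * B)" by (rule mult_left_mono) auto
  then have "norm (of_real \<epsilon> * ?w) \<le> 1 / 2" using assms(3) by (simp add: norm_mult)
  then show ?thesis using norm_triangle_ineq4[of "1 + of_real \<epsilon> * ?w" "of_real \<epsilon> * ?w"] by simp
qed

text \<open>One constant serves both as smallness condition on \<epsilon> and as bound:
  \<open>4 * Q\<close> keeps the denominator at least 1/2, and then \<open>4 * r * Q\<close> bounds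
  the whole fraction.\<close>

lemma polar_field_bounded:
  obtains B where "B > 0" "\<And>a b \<epsilon> e. (a, b) \<in> coeff_box n K \<Longrightarrow> B * \<bar>\<epsilon>\<bar> \<le> 1 \<Longrightarrow> e \<in> E \<Longrightarrow>
    regular_on r {0..2 * pi} (polar_field \<epsilon> a b e) \<and>
    (\<forall>z\<in>cball 0 r. \<forall>t\<in>{0..2 * pi}. norm (polar_field \<epsilon> a b e z t) \<le> B)"
proof -
  obtain Q where Q: "Q > 0" "\<And>a b z t e. (a, b) \<in> coeff_box n K \<Longrightarrow> z \<in> cball 0 r \<Longrightarrow> t \<in> {0..2 * pi} \<Longrightarrow> e \<in> E \<Longrightarrow>
    norm (quot_sum a e z t) \<le> Q \<and> norm (quot_sum b e z t) \<le> Q" using quot_sum_bounded by blast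
  define B where "B = max (4 * Q) (4 * r * Q)"
  show ?thesis
  proof
    show "B > 0" using Q by (simp add: B_def)
    fix a b \<epsilon> e assume ab: "(a, b) \<in> coeff_box n K" and "B * \<bar>\<epsilon>\<bar> \<le> 1" and e: "e \<in> E"
    have "4 * Q * \<bar>\<epsilon>\<bar> \<le> B * \<bar>\<epsilon>\<bar>" by (rule mult_right_mono) (auto simp: B_def)
    with \<open>B * \<bar>\<epsilon>\<bar> \<le> 1\<close> have \<epsilon>: "4 * \<bar>\<epsilon>\<bar> * Q \<le> 1" by (simp add: mult_ac)
    have den: "norm (1 + of_real \<epsilon> * (of_real (cos t) * quot_sum a e z t - of_real (sin t) * quot_sum b e z t)) \<ge> 1 / 2"
      if "z \<in> cball 0 r" "t \<in> {0..2 * pi}" for z t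
      using Q(2)[OF ab that e] \<epsilon> by (intro polar_field_denominator) auto
    have "regular_on r {0..2 * pi} (polar_field \<epsilon> a b e)"
      unfolding polar_field_def[abs_def]
    proof (rule regular_on_divide)
      fix z :: complex and t :: real assume "z \<in> cball 0 r" "t \<in> {0..2 * pi}"
      from den[OF this] show "1 + of_real \<epsilon> * (of_real (cos t) * quot_sum a e z t - of_real (sin t) * quot_sum b e z t) \<noteq> 0" by force
    qed (intro regular_on_add regular_on_diff regular_on_mult regular_on_id quot_sum_regular e regular_on_param; intro continuous_intros)+
    moreover have "norm (polar_field \<epsilon> a b e z t) \<le> B" if zt: "z \<in> cball 0 r" "t \<in> {0..2 * pi}" for z t
    proof -
      let ?w = "of_real (sin t) * quot_sum a e z t + of_real (cos t) * quot_sum b e z t"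
      have "norm ?w \<le> 2 * Q" using Q(2)[OF ab zt e] by (intro trig_combination_norm_le) auto
      then have "norm (z * ?w) \<le> r * (2 * Q)" using zt r unfolding norm_mult by (intro mult_mono) auto
      then have "norm (polar_field \<epsilon> a b e z t) \<le> r * (2 * Q) / (1 / 2)"
        unfolding polar_field_def norm_divide using den[OF zt] Q r by (intro frac_le) auto
      then show ?thesis by (simp add: B_def)
    qed
    ultimately show "regular_on r {0..2 * pi} (polar_field \<epsilon> a b e) \<and>
      (\<forall>z\<in>cball 0 r. \<forall>t\<in>{0..2 * pi}. norm (polar_field \<epsilon> a b e z t) \<le> B)" by blast
  qed
qed

lemma polar_field_uniform_limit:
  assumes a: "\<And>i j. (\<lambda>k. a k i j) \<longlonglongrightarrow> a0 i j" and b: "\<And>i j. (\<lambda>k. b k i j) \<longlonglongrightarrow> b0 i j"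
    and e: "e \<longlonglongrightarrow> (0, 0)" "\<And>k. e k \<in> E" and \<epsilon>: "\<epsilon> \<longlonglongrightarrow> 0"
  shows "uniform_limit (cball 0 r \<times> {0..2 * pi}) (\<lambda>k (z, t). polar_field (\<epsilon> k) (a k) (b k) (e k) z t)
    (\<lambda>(z, t). polar_field 0 a0 b0 (0, 0) z t) sequentially"
proof -
  let ?S = "cball (0::complex) r \<times> {0..2 * pi}"
  have q: "bounded_uniform_limit ?S (\<lambda>k (z, t). q i j z (t, e k)) (\<lambda>(z, t). q i j z (t, (0, 0)))" for i j
  proof -
    have "uniform_limit ?S (\<lambda>k (z, t). q i j z (t, e k)) (\<lambda>(z, t). q i j z (t, (0, 0))) sequentially"
      by (rule regular_on_uniform_limit[OF regular]) (use e \<eta> in \<open>auto intro!: compact_Times\<close>)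
    moreover obtain B where "\<And>z p. z \<in> cball 0 r \<Longrightarrow> p \<in> {0..2 * pi} \<times> E \<Longrightarrow> norm (q i j z p) \<le> B"
      using regular_on_bounded[OF regular[of i j] compact_Times[OF compact_Icc compact_Times[OF compact_Icc compact_Icc]]] by metis
    then have "bounded ((\<lambda>(z, t). q i j z (t, (0, 0))) ` ?S)" using \<eta> by (intro boundedI[of _ B]) auto
    ultimately show ?thesis by (simp add: bounded_uniform_limit_def)
  qed
  have qs: "bounded_uniform_limit ?S (\<lambda>k x. quot_sum (c k) (e k) (fst x) (snd x)) (\<lambda>x. quot_sum c0 (0, 0) (fst x) (snd x))"
    if "\<And>i j. (\<lambda>k. c k i j) \<longlonglongrightarrow> c0 i j" for c c0
    unfolding quot_sum_def case_prod_beta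
    by (intro bounded_uniform_limit_sum finite_indices bounded_uniform_limit_mult bounded_uniform_limit_tendsto
       tendsto_of_real that q[unfolded case_prod_beta])
  have bdd: "bounded ((\<lambda>x. of_real (sin (snd x)) :: complex) ` ?S)" "bounded ((\<lambda>x. of_real (cos (snd x)) :: complex) ` ?S)"
    "bounded (fst ` ?S)"
    by (rule boundedI[of _ 1], force)+ (rule boundedI[of _ r], force)
  note intros = bounded_uniform_limit_add bounded_uniform_limit_diff bounded_uniform_limit_mult
     qs[OF a] qs[OF b] bounded_uniform_limit_const[OF bdd(1)] bounded_uniform_limit_const[OF bdd(2)] bounded_uniform_limit_const[OF bdd(3)]
     bounded_uniform_limit_tendsto
  have num: "bounded_uniform_limit ?S
     (\<lambda>k x. fst x * (of_real (sin (snd x)) * quot_sum (a k) (e k) (fst x) (snd x) + of_real (cos (snd x)) * quot_sum (b k) (e k) (fst x) (snd x)))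
     (\<lambda>x. fst x * (of_real (sin (snd x)) * quot_sum a0 (0, 0) (fst x) (snd x) + of_real (cos (snd x)) * quot_sum b0 (0, 0) (fst x) (snd x)))"
    by (intro intros)
  have den: "bounded_uniform_limit ?S
     (\<lambda>k x. 1 + of_real (\<epsilon> k) * (of_real (cos (snd x)) * quot_sum (a k) (e k) (fst x) (snd x) - of_real (sin (snd x)) * quot_sum (b k) (e k) (fst x) (snd x)))
     (\<lambda>x. 1 + of_real 0 * (of_real (cos (snd x)) * quot_sum a0 (0, 0) (fst x) (snd x) - of_real (sin (snd x)) * quot_sum b0 (0, 0) (fst x) (snd x)))"
    by (intro intros tendsto_of_real \<epsilon> tendsto_const)
  show ?thesis
    unfolding polar_field_def case_prod_beta
    by (rule uniform_lim_divide[where b = 1]) (use num den in \<open>auto simp: bounded_uniform_limit_def\<close>)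
qed

text \<open>The values at the centre, subtracted to make the perturbation divisible by z, contribute
  constant multiples of sine and cosine, which integrate to 0 over a period. What remains is the
  integrand of \<open>averaged\<close>.\<close>

lemma integral_polar_field_0:
  assumes z: "z \<in> cball 0 r"
  shows "integral {0..2 * pi} (polar_field 0 a b (0, 0) z) = averaged m \<alpha> n a b z"
proof -
  have nz: "1 - of_real \<alpha> * z * of_real (sin t) \<noteq> 0" for t :: real
  proof -
    have "norm (of_real \<alpha> * z * of_real (sin t)) \<le> \<bar>\<alpha>\<bar> * r * 1"
      using z r unfolding norm_mult by (intro mult_mono) auto
    also have "\<dots> \<le> \<bar>\<alpha>\<bar> * (\<eta> + r)" using \<eta> by (simp add: mult_left_mono)
    finally show ?thesis using small by auto
  qed
  define C where "C c t = (\<Sum>(i, j)\<in>indices n. of_real (c i j) * complex_monomial m \<alpha> i j (z * of_real (sin t)) (z * of_real (cos t)))" for c :: coeffs and t :: real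
  define C0 where "C0 c = (\<Sum>(i, j)\<in>indices n. of_real (c i j) * complex_monomial m \<alpha> i j 0 0)" for c :: coeffs
  have zq: "z * quot_sum c (0, 0) z t = C c t - C0 c" if "t \<in> {0..2 * pi}" for c t
  proof -
    have "z * quot_sum c (0, 0) z t = (\<Sum>(i, j)\<in>indices n. of_real (c i j) * (z * q i j z (t, (0, 0))))"
      by (simp add: quot_sum_def sum_distrib_left case_prod_beta mult_ac)
    moreover have "z * q i j z (t, (0, 0)) = complex_monomial m \<alpha> i j (z * of_real (sin t)) (z * of_real (cos t)) -
      complex_monomial m \<alpha> i j 0 0" for i j
      using quotient[of z t "(0, 0)" i j] that z \<eta> by simp
    ultimately show ?thesis by (simp add: C_def C0_def right_diff_distrib sum_subtractf case_prod_beta)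
  qed
  have tq: "((\<lambda>t. of_real (sin t ^ k * cos t ^ l) / (1 - of_real \<alpha> * z * of_real (sin t)) ^ Suc m) has_integral trig_quotient m \<alpha> k l z) {0..2 * pi}" for k l
    unfolding trig_quotient_def using nz by (intro integrable_integral integrable_continuous_real continuous_intros) auto
  have mono: "complex_monomial m \<alpha> i j (z * of_real (sin t)) (z * of_real (cos t)) =
    z ^ (i + j) * (of_real (sin t ^ i * cos t ^ j) / (1 - of_real \<alpha> * z * of_real (sin t)) ^ Suc m)" for i j t
    by (simp add: complex_monomial_def power_mult_distrib power_add power_divide mult_ac)
  have total: "((\<lambda>t. (\<Sum>(i, j)\<in>indices n. z ^ (i + j) *
     (of_real (a i j) * (of_real (sin t ^ (i + 1) * cos t ^ j) / (1 - of_real \<alpha> * z * of_real (sin t)) ^ Suc m) +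
      of_real (b i j) * (of_real (sin t ^ i * cos t ^ (j + 1)) / (1 - of_real \<alpha> * z * of_real (sin t)) ^ Suc m)))
     - of_real (sin t) * C0 a - of_real (cos t) * C0 b) has_integral averaged m \<alpha> n a b z - 0 * C0 a - 0 * C0 b) {0..2 * pi}"
  proof -
    have "((\<lambda>t. complex_of_real (sin t)) has_integral of_real (- cos (2 * pi) - - cos 0)) {0..2 * pi}"
      by (rule has_integral_of_real, rule fundamental_theorem_of_calculus)
         (auto intro!: derivative_eq_intros simp: has_real_derivative_iff_has_vector_derivative[symmetric])
    then have s: "((\<lambda>t. complex_of_real (sin t)) has_integral 0) {0..2 * pi}" by simp
    have "((\<lambda>t. complex_of_real (cos t)) has_integral of_real (sin (2 * pi) - sin 0)) {0..2 * pi}"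
      by (rule has_integral_of_real, rule fundamental_theorem_of_calculus)
         (auto intro!: derivative_eq_intros simp: has_real_derivative_iff_has_vector_derivative[symmetric])
    then have c: "((\<lambda>t. complex_of_real (cos t)) has_integral 0) {0..2 * pi}" by simp
    show ?thesis unfolding averaged_def case_prod_beta
      by (intro has_integral_diff has_integral_mult_left s c has_integral_sum finite_indices has_integral_mult_right has_integral_add tq)
  qed
  have eq: "(\<Sum>(i, j)\<in>indices n. z ^ (i + j) *
     (of_real (a i j) * (of_real (sin t ^ (i + 1) * cos t ^ j) / (1 - of_real \<alpha> * z * of_real (sin t)) ^ Suc m) +
      of_real (b i j) * (of_real (sin t ^ i * cos t ^ (j + 1)) / (1 - of_real \<alpha> * z * of_real (sin t)) ^ Suc m)))
     - of_real (sin t) * C0 a - of_real (cos t) * C0 b = polar_field 0 a b (0, 0) z t" if t: "t \<in> {0..2 * pi}" for t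
  proof -
    have "polar_field 0 a b (0, 0) z t = of_real (sin t) * (z * quot_sum a (0, 0) z t) + of_real (cos t) * (z * quot_sum b (0, 0) z t)"
      by (simp add: polar_field_def algebra_simps)
    also have "\<dots> = of_real (sin t) * C a t + of_real (cos t) * C b t - of_real (sin t) * C0 a - of_real (cos t) * C0 b"
      unfolding zq[OF t] by (simp add: algebra_simps)
    also have "of_real (sin t) * C a t + of_real (cos t) * C b t = (\<Sum>(i, j)\<in>indices n. z ^ (i + j) *
     (of_real (a i j) * (of_real (sin t ^ (i + 1) * cos t ^ j) / (1 - of_real \<alpha> * z * of_real (sin t)) ^ Suc m) +
      of_real (b i j) * (of_real (sin t ^ i * cos t ^ (j + 1)) / (1 - of_real \<alpha> * z * of_real (sin t)) ^ Suc m)))"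
      unfolding C_def mono sum_distrib_left sum.distrib[symmetric] case_prod_beta
      by (intro sum.cong refl) (simp add: distrib_left mult_ac)
    finally show ?thesis by simp
  qed
  from integral_unique[OF has_integral_eq[OF eq total]] show ?thesis by simp
qed

end

lemma polar_quotients_exist:
  assumes "0 < r" "0 \<le> \<eta>" and small: "\<bar>\<alpha>\<bar> * (\<eta> + r) < 1"
  shows "\<exists>q. polar_quotients m \<alpha> r \<eta> q"
proof -
  let ?P = "{0..2 * pi} \<times> ({-\<eta>..\<eta>} \<times> {-\<eta>..\<eta>})"
  let ?x = "\<lambda>z p. of_real (fst (snd p)) + z * of_real (sin (fst p)) :: complex"
  let ?y = "\<lambda>z p. of_real (snd (snd p)) + z * of_real (cos (fst p)) :: complex"
  have x: "divided_on r ?P ?x" and y: "divided_on r ?P ?y"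
    by (intro divided_on_affine continuous_intros)+
  have w: "divided_on r ?P (\<lambda>z p. (1 - of_real \<alpha> * of_real (fst (snd p))) + z * (- of_real \<alpha> * of_real (sin (fst p))))"
    by (intro divided_on_affine continuous_intros)
  have nz: "(1 - of_real \<alpha> * of_real (fst (snd p))) + z * (- of_real \<alpha> * of_real (sin (fst p))) \<noteq> (0 :: complex)"
    if "z \<in> cball 0 r" "p \<in> ?P" for z p
  proof -
    have "norm (?x z p) \<le> norm (of_real (fst (snd p)) :: complex) + norm (z * of_real (sin (fst p)))" by (rule norm_triangle_ineq)
    also have "\<dots> \<le> \<eta> + r * 1" unfolding norm_mult by (intro add_mono mult_mono) (use that assms in auto)
    finally have "norm (of_real \<alpha> * ?x z p) \<le> \<bar>\<alpha>\<bar> * (\<eta> + r)" by (simp add: norm_mult mult_left_mono)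
    then have "of_real \<alpha> * ?x z p \<noteq> 1" using small by auto
    then show ?thesis by (simp add: algebra_simps)
  qed
  have "divided_on r ?P (\<lambda>z p. complex_monomial m \<alpha> i j (?x z p) (?y z p))" for i j
  proof -
    have "divided_on r ?P (\<lambda>z p. ?x z p ^ i * ?y z p ^ j *
      (1 / ((1 - of_real \<alpha> * of_real (fst (snd p))) + z * (- of_real \<alpha> * of_real (sin (fst p))))) ^ Suc m)"
      by (intro divided_on_mult divided_on_power divided_on_inverse x y w nz) (use assms in auto)
    then show ?thesis by (simp add: complex_monomial_def algebra_simps)
  qed
  then have "\<forall>i j. \<exists>q. regular_on r ?P q \<and> (\<forall>z\<in>cball 0 r. \<forall>p\<in>?P. complex_monomial m \<alpha> i j (?x z p) (?y z p) =
     complex_monomial m \<alpha> i j (?x 0 p) (?y 0 p) + z * q z p)"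
    unfolding divided_on_def by blast
  then obtain q where q: "\<And>i j. regular_on r ?P (q i j)" "\<And>i j z p. z \<in> cball 0 r \<Longrightarrow> p \<in> ?P \<Longrightarrow> complex_monomial m \<alpha> i j (?x z p) (?y z p) =
     complex_monomial m \<alpha> i j (?x 0 p) (?y 0 p) + z * q i j z p"
    by metis
  have "polar_quotients m \<alpha> r \<eta> q"
  proof
    fix z t e i j assume "z \<in> cball (0::complex) r" "t \<in> {0..2 * pi}" "e \<in> {-\<eta>..\<eta>} \<times> {-\<eta>..\<eta>}"
    with q(2)[of z "(t, e)" i j] show "complex_monomial m \<alpha> i j (of_real (fst e) + z * of_real (sin t)) (of_real (snd e) + z * of_real (cos t)) =
      complex_monomial m \<alpha> i j (of_real (fst e)) (of_real (snd e)) + z * q i j z (t, e)" by simp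
  qed (use assms q(1) in auto)
  then show ?thesis by blast
qed

section \<open>Solutions of the polar equation over several turns\<close>

definition polar_solution :: "nat \<Rightarrow> real \<Rightarrow> nat \<Rightarrow> real \<Rightarrow> coeffs \<Rightarrow> coeffs \<Rightarrow> real \<times> real \<Rightarrow> real \<Rightarrow> (real \<Rightarrow> real) \<Rightarrow> bool" where
  "polar_solution m \<alpha> n \<epsilon> a b e \<rho> g \<longleftrightarrow>
     (\<forall>t. g t \<noteq> 0 \<and> \<bar>g t\<bar> \<le> \<rho> \<and> (g has_real_derivative \<epsilon> * polar_speed m \<alpha> n \<epsilon> a b e (g t) t) (at t))"

lemma polar_solution_shift:
  assumes "polar_solution m \<alpha> n \<epsilon> a b e \<rho> g"
  shows "polar_solution m \<alpha> n \<epsilon> a b e \<rho> (\<lambda>t. g (t + 2 * pi))"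
  unfolding polar_solution_def
proof (intro allI conjI)
  fix t
  have "(g has_real_derivative \<epsilon> * polar_speed m \<alpha> n \<epsilon> a b e (g (t + 2 * pi)) t) (at (t + 2 * pi))"
    using assms polar_speed_period by (metis polar_solution_def)
  then show "((\<lambda>t. g (t + 2 * pi)) has_real_derivative \<epsilon> * polar_speed m \<alpha> n \<epsilon> a b e (g (t + 2 * pi)) t) (at t)"
    by (simp add: DERIV_shift)
qed (use assms in \<open>auto simp: polar_solution_def\<close>)

lemma polar_solution_opposite:
  assumes "polar_solution m \<alpha> n \<epsilon> a b e \<rho> g"
  shows "polar_solution m \<alpha> n \<epsilon> a b e \<rho> (\<lambda>t. - g (t + pi))"
  unfolding polar_solution_def
proof (intro allI conjI)
  fix t
  have "(g has_real_derivative \<epsilon> * polar_speed m \<alpha> n \<epsilon> a b e (g (t + pi)) (t + pi)) (at (t + pi))"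
    using assms by (auto simp: polar_solution_def)
  then have "((\<lambda>t. g (t + pi)) has_real_derivative \<epsilon> * polar_speed m \<alpha> n \<epsilon> a b e (g (t + pi)) (t + pi)) (at t)"
    by (simp add: DERIV_shift)
  moreover have "polar_speed m \<alpha> n \<epsilon> a b e (g (t + pi)) (t + pi) = - polar_speed m \<alpha> n \<epsilon> a b e (- g (t + pi)) t"
    using polar_speed_opposite[of m \<alpha> n \<epsilon> a b e "- g (t + pi)" t] by simp
  ultimately show "((\<lambda>t. - g (t + pi)) has_real_derivative \<epsilon> * polar_speed m \<alpha> n \<epsilon> a b e (- g (t + pi)) t) (at t)"
    by (auto intro!: derivative_eq_intros)
qed (use assms in \<open>auto simp: polar_solution_def\<close>)

lemma polar_solution_shift_multiple:
  "polar_solution m \<alpha> n \<epsilon> a b e \<rho> g \<Longrightarrow> polar_solution m \<alpha> n \<epsilon> a b e \<rho> (\<lambda>t. g (t + 2 * pi * real j))"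
proof (induction j)
  case (Suc j)
  from polar_solution_shift[OF Suc.IH[OF Suc.prems]] show ?case by (simp add: algebra_simps)
qed simp

context polar_quotients
begin

lemma polar_solution_complex:
  assumes "polar_solution m \<alpha> n \<epsilon> a b e \<rho> g" "\<rho> \<le> r" "t \<in> {0..2 * pi}" "e \<in> E"
  shows "((\<lambda>t. complex_of_real (g t)) has_vector_derivative of_real \<epsilon> * polar_field \<epsilon> a b e (of_real (g t)) t) (at t within {0..2 * pi})"
proof -
  have g: "g t \<noteq> 0" "\<bar>g t\<bar> \<le> r" "(g has_real_derivative \<epsilon> * polar_speed m \<alpha> n \<epsilon> a b e (g t) t) (at t)"
    using assms by (auto simp: polar_solution_def intro: order_trans)
  have "((\<lambda>t. complex_of_real (g t)) has_vector_derivative of_real (\<epsilon> * polar_speed m \<alpha> n \<epsilon> a b e (g t) t)) (at t within {0..2 * pi})"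
    by (rule has_vector_derivative_of_real)
       (use g(3) in \<open>simp add: has_field_derivative_at_within has_real_derivative_iff_has_vector_derivative has_vector_derivative_at_within\<close>)
  then show ?thesis using polar_field_of_real[OF g(1,2) assms(3,4)] by simp
qed

text \<open>The constants \<delta> and \<open>C\<close> are uniform in coefficients and centre. The
  radii have separate roles: solutions stay within \<rho>, the displacement \<open>G\<close> is
  holomorphic on radius \<open>r1\<close>, and the field is controlled up to \<open>r\<close>; the
  two gaps pay for the Lipschitz constants.\<close>

lemma polar_displacement:
  assumes \<rho>: "0 < \<rho>" "\<rho> < r1" "r1 < r"
  obtains \<delta> C where "\<delta> > 0"
    "\<And>\<epsilon> a b e. 0 < \<bar>\<epsilon>\<bar> \<Longrightarrow> \<bar>\<epsilon>\<bar> < \<delta> \<Longrightarrow> (a, b) \<in> coeff_box n K \<Longrightarrow> e \<in> E \<Longrightarrow>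
       continuous_on (cball 0 r \<times> {0..2 * pi}) (\<lambda>(z, t). polar_field \<epsilon> a b e z t)"
    "\<And>\<epsilon> a b e. 0 < \<bar>\<epsilon>\<bar> \<Longrightarrow> \<bar>\<epsilon>\<bar> < \<delta> \<Longrightarrow> (a, b) \<in> coeff_box n K \<Longrightarrow> e \<in> E \<Longrightarrow>
       \<exists>G. G holomorphic_on ball 0 r1 \<and>
         (\<forall>z\<in>ball 0 r1. norm (G z - integral {0..2 * pi} (polar_field \<epsilon> a b e z)) \<le> C * \<bar>\<epsilon>\<bar>) \<and>
         (\<forall>g k. polar_solution m \<alpha> n \<epsilon> a b e \<rho> g \<longrightarrow> k \<ge> (1::nat) \<longrightarrow> g (2 * pi * real k) = g 0 \<longrightarrow> G (of_real (g 0)) = 0)"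
    "\<And>\<epsilon> a b e g h t. 0 < \<bar>\<epsilon>\<bar> \<Longrightarrow> \<bar>\<epsilon>\<bar> < \<delta> \<Longrightarrow> (a, b) \<in> coeff_box n K \<Longrightarrow> e \<in> E \<Longrightarrow>
       polar_solution m \<alpha> n \<epsilon> a b e \<rho> g \<Longrightarrow> polar_solution m \<alpha> n \<epsilon> a b e \<rho> h \<Longrightarrow> g 0 = h 0 \<Longrightarrow> 0 \<le> t \<Longrightarrow> g t = h t"
proof -
  obtain B where B: "B > 0" "\<And>a b \<epsilon> e. (a, b) \<in> coeff_box n K \<Longrightarrow> B * \<bar>\<epsilon>\<bar> \<le> 1 \<Longrightarrow> e \<in> E \<Longrightarrow>
    regular_on r {0..2 * pi} (polar_field \<epsilon> a b e) \<and>
    (\<forall>z\<in>cball 0 r. \<forall>t\<in>{0..2 * pi}. norm (polar_field \<epsilon> a b e z t) \<le> B)"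
    using polar_field_bounded by blast
  \<comment> \<open>The three bounds make the polar field regular, admit Picard iteration over one
    turn, and give \<epsilon> G the Lipschitz constant 1/2 on the disc of radius \<rho>.\<close>
  define \<delta> where "\<delta> = min (1 / B) (min ((r - r1) / (16 * pi * B)) ((r1 - \<rho>) / (8 * pi * B)))"
  have \<delta>: "\<delta> > 0" using B \<rho> by (simp add: \<delta>_def)
  have \<epsilon>: "B * \<bar>\<epsilon>\<bar> \<le> 1" "8 * \<bar>\<epsilon>\<bar> * B * (2 * pi) \<le> r - r1" "\<bar>\<epsilon>\<bar> * (2 * (B * (2 * pi)) / (r1 - \<rho>)) \<le> 1 / 2" if "\<bar>\<epsilon>\<bar> < \<delta>" for \<epsilon>
  proof -
    have "\<bar>\<epsilon>\<bar> \<le> 1 / B" "\<bar>\<epsilon>\<bar> \<le> (r - r1) / (16 * pi * B)" "\<bar>\<epsilon>\<bar> \<le> (r1 - \<rho>) / (8 * pi * B)"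
      using that by (auto simp: \<delta>_def)
    then show "B * \<bar>\<epsilon>\<bar> \<le> 1" "8 * \<bar>\<epsilon>\<bar> * B * (2 * pi) \<le> r - r1" "\<bar>\<epsilon>\<bar> * (2 * (B * (2 * pi)) / (r1 - \<rho>)) \<le> 1 / 2"
      using B(1) \<rho> by (auto simp: field_simps)
  qed
  define C where "C = 4 * B / (r - r1) * (B * (2 * pi)) * (2 * pi)"
  show ?thesis
  proof (rule that[of \<delta> C, OF \<delta>])
    fix \<epsilon> a b e assume "0 < \<bar>\<epsilon>\<bar>" "\<bar>\<epsilon>\<bar> < \<delta>" "(a, b) \<in> coeff_box n K" "e \<in> E"
    then show "continuous_on (cball 0 r \<times> {0..2 * pi}) (\<lambda>(z, t). polar_field \<epsilon> a b e z t)"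
      using B(2) \<epsilon>(1) by (auto simp: regular_on_def)
  next
    fix \<epsilon> a b e assume e0: "0 < \<bar>\<epsilon>\<bar>" and e1: "\<bar>\<epsilon>\<bar> < \<delta>" and ab: "(a, b) \<in> coeff_box n K" and e: "e \<in> E"
    note F = B(2)[OF ab \<epsilon>(1)[OF e1] e]
    obtain G where G: "G holomorphic_on ball 0 r1"
      "\<And>z. z \<in> ball 0 r1 \<Longrightarrow> norm (G z) \<le> B * (2 * pi)"
      "\<And>z. z \<in> ball 0 r1 \<Longrightarrow> norm (G z - integral {0..2 * pi} (polar_field \<epsilon> a b e z)) \<le> 4 * B / (r - r1) * (\<bar>\<epsilon>\<bar> * (B * (2 * pi))) * (2 * pi)"
      "\<And>g. (\<And>t. t \<in> {0..2 * pi} \<Longrightarrow> (g has_vector_derivative of_real \<epsilon> * polar_field \<epsilon> a b e (g t) t) (at t within {0..2 * pi})) \<Longrightarrow>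
         (\<And>t. t \<in> {0..2 * pi} \<Longrightarrow> norm (g t) < r1) \<Longrightarrow> g (2 * pi) = g 0 + of_real \<epsilon> * G (g 0)"
      using displacement_map[of r1 r "2 * pi" \<epsilon> "polar_field \<epsilon> a b e" B] F \<epsilon>(2)[OF e1] e0 \<rho> by auto
    have step: "complex_of_real (g (2 * pi)) = of_real (g 0) + of_real \<epsilon> * G (of_real (g 0))"
      if g: "polar_solution m \<alpha> n \<epsilon> a b e \<rho> g" for g
    proof (rule G(4))
      show "norm (complex_of_real (g t)) < r1" for t using g \<rho> by (auto simp: polar_solution_def intro: le_less_trans)
    qed (use polar_solution_complex[OF g _ _ e] \<rho> in auto)
    have "G (of_real (g 0)) = 0" if g: "polar_solution m \<alpha> n \<epsilon> a b e \<rho> g" and k: "k \<ge> (1::nat)" "g (2 * pi * real k) = g 0" for g k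
    proof -
      define x where "x j = g (2 * pi * real j)" for j
      have xb: "\<bar>x j\<bar> \<le> \<rho>" for j using g by (auto simp: x_def polar_solution_def)
      have xs: "complex_of_real (x (Suc j)) - of_real (x j) = of_real \<epsilon> * G (of_real (x j))" for j
        using step[OF polar_solution_shift_multiple[OF g, of j]] by (simp add: x_def algebra_simps)
      have "x 1 = x 0"
      proof (rule constant_of_slowly_varying_steps)
        fix j
        have "complex_of_real ((x (Suc (Suc j)) - x (Suc j)) - (x (Suc j) - x j)) =
          of_real \<epsilon> * (G (of_real (x (Suc j))) - G (of_real (x j)))"
          using xs[of j] xs[of "Suc j"] by (simp add: algebra_simps)
        then have "\<bar>(x (Suc (Suc j)) - x (Suc j)) - (x (Suc j) - x j)\<bar> = \<bar>\<epsilon>\<bar> * norm (G (of_real (x (Suc j))) - G (of_real (x j)))"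
          by (metis norm_mult norm_of_real)
        also have "\<dots> \<le> \<bar>\<epsilon>\<bar> * (2 * (B * (2 * pi)) / (r1 - \<rho>) * norm (complex_of_real (x (Suc j)) - of_real (x j)))"
          by (intro mult_left_mono holomorphic_lipschitz[OF G(1,2)]) (use xb \<rho> in auto)
        also have "\<dots> = (\<bar>\<epsilon>\<bar> * (2 * (B * (2 * pi)) / (r1 - \<rho>))) * \<bar>x (Suc j) - x j\<bar>"
          by (simp flip: of_real_diff)
        also have "\<dots> \<le> 1 / 2 * \<bar>x (Suc j) - x j\<bar>" by (rule mult_right_mono[OF \<epsilon>(3)[OF e1]]) simp
        finally show "\<bar>(x (Suc (Suc j)) - x (Suc j)) - (x (Suc j) - x j)\<bar> \<le> \<bar>x (Suc j) - x j\<bar> / 2" by simp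
      qed (use k in \<open>auto simp: x_def\<close>)
      then show ?thesis using xs[of 0] e0 by (simp add: x_def)
    qed
    then show "\<exists>G. G holomorphic_on ball 0 r1 \<and>
       (\<forall>z\<in>ball 0 r1. norm (G z - integral {0..2 * pi} (polar_field \<epsilon> a b e z)) \<le> C * \<bar>\<epsilon>\<bar>) \<and>
       (\<forall>g k. polar_solution m \<alpha> n \<epsilon> a b e \<rho> g \<longrightarrow> k \<ge> (1::nat) \<longrightarrow> g (2 * pi * real k) = g 0 \<longrightarrow> G (of_real (g 0)) = 0)"
      using G(1,3) by (intro exI[of _ G]) (auto simp: C_def mult_ac)
  next
    fix \<epsilon> a b e g h and t :: real
    assume e0: "0 < \<bar>\<epsilon>\<bar>" and e1: "\<bar>\<epsilon>\<bar> < \<delta>" and ab: "(a, b) \<in> coeff_box n K" and e: "e \<in> E"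
      and gh: "polar_solution m \<alpha> n \<epsilon> a b e \<rho> g" "polar_solution m \<alpha> n \<epsilon> a b e \<rho> h" "g 0 = h 0" and t: "0 \<le> t"
    note F = B(2)[OF ab \<epsilon>(1)[OF e1] e]
    have one: "u s = v s" if uv: "polar_solution m \<alpha> n \<epsilon> a b e \<rho> u" "polar_solution m \<alpha> n \<epsilon> a b e \<rho> v" "u 0 = v 0"
      and s: "s \<in> {0..2 * pi}" for u v s
    proof -
      have "complex_of_real (u s) = of_real (v s)"
      proof (rule ode_solutions_agree[of "\<lambda>t. of_real (u t)" "\<lambda>t. of_real (v t)" s "2 * pi" \<epsilon> "polar_field \<epsilon> a b e" "2 * B / (r - r1)"])
        fix t assume t: "t \<in> {0..2 * pi}"
        show "norm (polar_field \<epsilon> a b e (of_real (u t)) t - polar_field \<epsilon> a b e (of_real (v t)) t) \<le>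
           2 * B / (r - r1) * norm (complex_of_real (u t) - of_real (v t))"
          by (rule regular_on_lipschitz[OF conjunct1[OF F]]) 
             (use F t uv \<rho> in \<open>auto simp: polar_solution_def intro: order_trans[OF _ less_imp_le]\<close>)
      qed (use s uv polar_solution_complex[OF uv(1) _ _ e] polar_solution_complex[OF uv(2) _ _ e] \<rho> in auto)
      then show ?thesis by simp
    qed
    \<comment> \<open>The complex field is controlled for angles in one period only, so agreement is
      carried on turn by turn.\<close>
    have all: "g (s + 2 * pi * real N) = h (s + 2 * pi * real N)" if "s \<in> {0..2 * pi}" for N s
      using that
    proof (induction N arbitrary: s)
      case 0
      then show ?case using one[OF gh] by simp
    next
      case (Suc N)
      have "g (2 * pi + 2 * pi * real N) = h (2 * pi + 2 * pi * real N)" by (rule Suc.IH) auto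
      then have "g (0 + 2 * pi * real (Suc N)) = h (0 + 2 * pi * real (Suc N))" by (simp add: algebra_simps)
      from one[OF polar_solution_shift_multiple[OF gh(1)] polar_solution_shift_multiple[OF gh(2)] this Suc.prems]
      show ?case .
    qed
    define N where "N = nat \<lfloor>t / (2 * pi)\<rfloor>"
    have N: "real N = of_int \<lfloor>t / (2 * pi)\<rfloor>" using t by (simp add: N_def)
    have "real N \<le> t / (2 * pi)" "t / (2 * pi) < real N + 1" unfolding N by linarith+
    then have "t - 2 * pi * real N \<in> {0..2 * pi}" by (auto simp: field_simps)
    from all[OF this, of N] show "g t = h t" by simp
  qed
qed

end

section \<open>Periodic orbits in polar coordinates\<close>

text \<open>The region on which this is used is not convex, so Lipschitz bounds do not follow from bounds on
  derivatives.\<close>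

definition bounded_lipschitz :: "(real \<times> real) set \<Rightarrow> (real \<Rightarrow> real \<Rightarrow> real) \<Rightarrow> bool" where
  "bounded_lipschitz W f \<longleftrightarrow> (\<exists>L\<ge>0. \<forall>(x, y)\<in>W. \<forall>(x', y')\<in>W. \<bar>f x y\<bar> \<le> L \<and> \<bar>f x y - f x' y'\<bar> \<le> L * (\<bar>x - x'\<bar> + \<bar>y - y'\<bar>))"

lemma bounded_lipschitzI:
  assumes "L \<ge> 0" "\<And>x y. (x, y) \<in> W \<Longrightarrow> \<bar>f x y\<bar> \<le> L"
    "\<And>x y x' y'. (x, y) \<in> W \<Longrightarrow> (x', y') \<in> W \<Longrightarrow> \<bar>f x y - f x' y'\<bar> \<le> L * (\<bar>x - x'\<bar> + \<bar>y - y'\<bar>)"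
  shows "bounded_lipschitz W f"
  unfolding bounded_lipschitz_def using assms by blast

lemma bounded_lipschitz_mult:
  assumes "bounded_lipschitz W f" "bounded_lipschitz W g"
  shows "bounded_lipschitz W (\<lambda>x y. f x y * g x y)"
proof -
  obtain A where A: "A \<ge> 0" "\<And>x y. (x, y) \<in> W \<Longrightarrow> \<bar>f x y\<bar> \<le> A"
    "\<And>x y x' y'. (x, y) \<in> W \<Longrightarrow> (x', y') \<in> W \<Longrightarrow> \<bar>f x y - f x' y'\<bar> \<le> A * (\<bar>x - x'\<bar> + \<bar>y - y'\<bar>)"
    using assms(1) unfolding bounded_lipschitz_def by blast
  obtain B where B: "B \<ge> 0" "\<And>x y. (x, y) \<in> W \<Longrightarrow> \<bar>g x y\<bar> \<le> B"
    "\<And>x y x' y'. (x, y) \<in> W \<Longrightarrow> (x', y') \<in> W \<Longrightarrow> \<bar>g x y - g x' y'\<bar> \<le> B * (\<bar>x - x'\<bar> + \<bar>y - y'\<bar>)"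
    using assms(2) unfolding bounded_lipschitz_def by blast
  show ?thesis
  proof (rule bounded_lipschitzI[of "2 * (A * B)"])
    show "2 * (A * B) \<ge> 0" using A B by simp
    show "\<bar>f x y * g x y\<bar> \<le> 2 * (A * B)" if "(x, y) \<in> W" for x y
    proof -
      have "\<bar>f x y * g x y\<bar> \<le> A * B" unfolding abs_mult by (intro mult_mono A B that) auto
      also have "\<dots> \<le> 2 * (A * B)" using A B by simp
      finally show ?thesis .
    qed
    fix x y x' y' assume p: "(x, y) \<in> W" "(x', y') \<in> W"
    let ?d = "\<bar>x - x'\<bar> + \<bar>y - y'\<bar>"
    have "f x y * g x y - f x' y' * g x' y' = f x y * (g x y - g x' y') + g x' y' * (f x y - f x' y')"
      by (simp add: algebra_simps)
    also have "\<bar>\<dots>\<bar> \<le> \<bar>f x y\<bar> * \<bar>g x y - g x' y'\<bar> + \<bar>g x' y'\<bar> * \<bar>f x y - f x' y'\<bar>"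
      unfolding abs_mult[symmetric] by (rule abs_triangle_ineq)
    also have "\<dots> \<le> A * (B * ?d) + B * (A * ?d)"
      by (intro add_mono mult_mono A B p) (use A B in auto)
    finally show "\<bar>f x y * g x y - f x' y' * g x' y'\<bar> \<le> 2 * (A * B) * ?d" by (simp add: algebra_simps)
  qed
qed

lemma bounded_lipschitz_const: "bounded_lipschitz W (\<lambda>x y. c)"
  by (rule bounded_lipschitzI[of "\<bar>c\<bar>"]) auto

lemma bounded_lipschitz_power: "bounded_lipschitz W f \<Longrightarrow> bounded_lipschitz W (\<lambda>x y. f x y ^ k)"
  by (induction k) (auto intro: bounded_lipschitz_mult bounded_lipschitz_const)

text \<open>For \<alpha> nonzero it can have parts on both sides of the singular line x =
  1/\<alpha>, and a priori an orbit in V may lie on either side.\<close>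

definition region :: "real \<Rightarrow> real \<Rightarrow> real \<Rightarrow> (real \<times> real) set" where
  "region \<alpha> R \<delta> = {(x, y). \<bar>x\<bar> \<le> R \<and> \<bar>y\<bar> \<le> R \<and> \<delta> \<le> \<bar>1 - \<alpha> * x\<bar>}"

lemma bounded_lipschitz_inverse:
  assumes "\<delta> > 0"
  shows "bounded_lipschitz (region \<alpha> R \<delta>) (\<lambda>x y. 1 / (1 - \<alpha> * x))"
proof (rule bounded_lipschitzI[of "1 / \<delta> + \<bar>\<alpha>\<bar> / \<delta>\<^sup>2"])
  show "1 / \<delta> + \<bar>\<alpha>\<bar> / \<delta>\<^sup>2 \<ge> 0" using assms by simp
  show "\<bar>1 / (1 - \<alpha> * x)\<bar> \<le> 1 / \<delta> + \<bar>\<alpha>\<bar> / \<delta>\<^sup>2" if "(x, y) \<in> region \<alpha> R \<delta>" for x y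
  proof -
    have "\<bar>1 / (1 - \<alpha> * x)\<bar> \<le> 1 / \<delta>" unfolding abs_divide using that assms by (auto simp: region_def intro!: frac_le)
    moreover have "\<bar>\<alpha>\<bar> / \<delta>\<^sup>2 \<ge> 0" by simp
    ultimately show ?thesis by linarith
  qed
  fix x y x' y' assume p: "(x, y) \<in> region \<alpha> R \<delta>" "(x', y') \<in> region \<alpha> R \<delta>"
  then have d: "\<delta> \<le> \<bar>1 - \<alpha> * x\<bar>" "\<delta> \<le> \<bar>1 - \<alpha> * x'\<bar>" by (auto simp: region_def)
  then have nz: "1 - \<alpha> * x \<noteq> 0" "1 - \<alpha> * x' \<noteq> 0" using assms by auto
  have "1 / (1 - \<alpha> * x) - 1 / (1 - \<alpha> * x') = \<alpha> * (x - x') / ((1 - \<alpha> * x) * (1 - \<alpha> * x'))"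
    using nz by (simp add: field_simps)
  also have "\<bar>\<dots>\<bar> = \<bar>\<alpha>\<bar> * \<bar>x - x'\<bar> / (\<bar>1 - \<alpha> * x\<bar> * \<bar>1 - \<alpha> * x'\<bar>)" by (simp add: abs_mult)
  also have "\<dots> \<le> \<bar>\<alpha>\<bar> * (\<bar>x - x'\<bar> + \<bar>y - y'\<bar>) / (\<delta> * \<delta>)"
    using assms d by (intro frac_le mult_mono) auto
  also have "\<dots> = \<bar>\<alpha>\<bar> / \<delta>\<^sup>2 * (\<bar>x - x'\<bar> + \<bar>y - y'\<bar>)" by (simp add: power2_eq_square)
  also have "\<dots> \<le> (1 / \<delta> + \<bar>\<alpha>\<bar> / \<delta>\<^sup>2) * (\<bar>x - x'\<bar> + \<bar>y - y'\<bar>)"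
    using assms by (intro mult_right_mono) auto
  finally show "\<bar>1 / (1 - \<alpha> * x) - 1 / (1 - \<alpha> * x')\<bar> \<le> (1 / \<delta> + \<bar>\<alpha>\<bar> / \<delta>\<^sup>2) * (\<bar>x - x'\<bar> + \<bar>y - y'\<bar>)" .
qed

lemma bounded_lipschitz_coordinates:
  "bounded_lipschitz (region \<alpha> R \<delta>) (\<lambda>x y. x)" "bounded_lipschitz (region \<alpha> R \<delta>) (\<lambda>x y. y)"
proof -
  have *: "\<bar>d\<bar> \<le> (\<bar>R\<bar> + 1) * (\<bar>d\<bar> + \<bar>d'\<bar>)" "\<bar>d\<bar> \<le> (\<bar>R\<bar> + 1) * (\<bar>d'\<bar> + \<bar>d\<bar>)" for d d' :: real
    using mult_right_mono[of 1 "\<bar>R\<bar> + 1" "\<bar>d\<bar> + \<bar>d'\<bar>"] by (auto simp: add.commute)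
  show "bounded_lipschitz (region \<alpha> R \<delta>) (\<lambda>x y. x)"
  proof (rule bounded_lipschitzI[of "\<bar>R\<bar> + 1"])
    show "\<bar>x\<bar> \<le> \<bar>R\<bar> + 1" if "(x, y) \<in> region \<alpha> R \<delta>" for x y using that unfolding region_def by auto
    show "\<bar>x - x'\<bar> \<le> (\<bar>R\<bar> + 1) * (\<bar>x - x'\<bar> + \<bar>y - y'\<bar>)" for x y x' y' by (rule *)
  qed simp
  show "bounded_lipschitz (region \<alpha> R \<delta>) (\<lambda>x y. y)"
  proof (rule bounded_lipschitzI[of "\<bar>R\<bar> + 1"])
    show "\<bar>y\<bar> \<le> \<bar>R\<bar> + 1" if "(x, y) \<in> region \<alpha> R \<delta>" for x y using that unfolding region_def by auto
    show "\<bar>y - y'\<bar> \<le> (\<bar>R\<bar> + 1) * (\<bar>x - x'\<bar> + \<bar>y - y'\<bar>)" for x y x' y' by (rule *)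
  qed simp
qed

lemma perturbation_lipschitz:
  assumes "\<delta> > 0"
  obtains L where "L > 0"
    "\<And>c x y. (\<And>i j. i + j \<le> n \<Longrightarrow> \<bar>c i j\<bar> \<le> K) \<Longrightarrow> (x, y) \<in> region \<alpha> R \<delta> \<Longrightarrow> \<bar>perturbation m \<alpha> n c x y\<bar> \<le> L"
    "\<And>c x y x' y'. (\<And>i j. i + j \<le> n \<Longrightarrow> \<bar>c i j\<bar> \<le> K) \<Longrightarrow> (x, y) \<in> region \<alpha> R \<delta> \<Longrightarrow> (x', y') \<in> region \<alpha> R \<delta> \<Longrightarrow>
       \<bar>perturbation m \<alpha> n c x y - perturbation m \<alpha> n c x' y'\<bar> \<le> L * (\<bar>x - x'\<bar> + \<bar>y - y'\<bar>)"
proof -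
  let ?W = "region \<alpha> R \<delta>"
  let ?f = "\<lambda>i j x y. x ^ i * y ^ j * (1 / (1 - \<alpha> * x)) ^ Suc m"
  define Q where "Q i j M \<longleftrightarrow> M \<ge> 0 \<and> (\<forall>(x, y)\<in>?W. \<forall>(x', y')\<in>?W. \<bar>?f i j x y\<bar> \<le> M \<and>
    \<bar>?f i j x y - ?f i j x' y'\<bar> \<le> M * (\<bar>x - x'\<bar> + \<bar>y - y'\<bar>))" for i j M
  have "\<exists>M. Q i j M" for i j
  proof -
    have "bounded_lipschitz ?W (?f i j)"
      by (intro bounded_lipschitz_mult bounded_lipschitz_power bounded_lipschitz_coordinates bounded_lipschitz_inverse assms)
    then show ?thesis unfolding bounded_lipschitz_def Q_def .
  qed
  then obtain M where "\<And>i j. Q i j (M i j)" by metis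
  then have M: "\<And>i j. M i j \<ge> 0" "\<And>i j. \<forall>(x, y)\<in>?W. \<forall>(x', y')\<in>?W.
      \<bar>?f i j x y\<bar> \<le> M i j \<and> \<bar>?f i j x y - ?f i j x' y'\<bar> \<le> M i j * (\<bar>x - x'\<bar> + \<bar>y - y'\<bar>)"
    unfolding Q_def by blast+
  have M1: "\<bar>?f i j x y\<bar> \<le> M i j" if "(x, y) \<in> ?W" for i j x y using M(2)[of i j] that by blast
  have M2: "\<bar>?f i j x y - ?f i j x' y'\<bar> \<le> M i j * (\<bar>x - x'\<bar> + \<bar>y - y'\<bar>)" if "(x, y) \<in> ?W" "(x', y') \<in> ?W" for i j x y x' y'
    using M(2)[of i j] that by blast
  define S where "S = (\<Sum>(i, j)\<in>indices n. \<bar>K\<bar> * M i j)"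
  have S: "S \<ge> 0" unfolding S_def using M(1) by (intro sum_nonneg) auto
  show ?thesis
  proof (rule that[of "S + 1"])
    show "S + 1 > 0" using S by simp
  next
    fix c :: coeffs and x y assume c: "\<And>i j. i + j \<le> n \<Longrightarrow> \<bar>c i j\<bar> \<le> K" and xy: "(x, y) \<in> ?W"
    have "\<bar>perturbation m \<alpha> n c x y\<bar> \<le> (\<Sum>(i, j)\<in>indices n. \<bar>c i j * ?f i j x y\<bar>)"
      unfolding perturbation_def case_prod_beta by (rule sum_abs)
    also have "\<dots> \<le> S" unfolding S_def case_prod_beta
    proof (rule sum_mono)
      fix p assume "p \<in> indices n"
      then have "\<bar>c (fst p) (snd p)\<bar> \<le> \<bar>K\<bar>" using c[of "fst p" "snd p"] by (auto simp: indices_def)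
      then show "\<bar>c (fst p) (snd p) * ?f (fst p) (snd p) x y\<bar> \<le> \<bar>K\<bar> * M (fst p) (snd p)"
        unfolding abs_mult[of "c _ _"] using M1[OF xy] M(1) by (intro mult_mono) auto
    qed
    finally show "\<bar>perturbation m \<alpha> n c x y\<bar> \<le> S + 1" by simp
  next
    fix c :: coeffs and x y x' y' assume c: "\<And>i j. i + j \<le> n \<Longrightarrow> \<bar>c i j\<bar> \<le> K" and p: "(x, y) \<in> ?W" "(x', y') \<in> ?W"
    let ?d = "\<bar>x - x'\<bar> + \<bar>y - y'\<bar>"
    have diff: "perturbation m \<alpha> n c x y - perturbation m \<alpha> n c x' y' = (\<Sum>(i, j)\<in>indices n. c i j * (?f i j x y - ?f i j x' y'))"
      unfolding perturbation_def case_prod_beta right_diff_distrib sum_subtractf by (rule refl)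
    have "\<bar>perturbation m \<alpha> n c x y - perturbation m \<alpha> n c x' y'\<bar> \<le> (\<Sum>(i, j)\<in>indices n. \<bar>c i j * (?f i j x y - ?f i j x' y')\<bar>)"
      unfolding diff case_prod_beta by (rule sum_abs)
    also have "\<dots> \<le> (\<Sum>(i, j)\<in>indices n. \<bar>K\<bar> * M i j * ?d)" unfolding case_prod_beta
    proof (rule sum_mono)
      fix q assume "q \<in> indices n"
      then have "\<bar>c (fst q) (snd q)\<bar> \<le> \<bar>K\<bar>" using c[of "fst q" "snd q"] by (auto simp: indices_def)
      then show "\<bar>c (fst q) (snd q) * (?f (fst q) (snd q) x y - ?f (fst q) (snd q) x' y')\<bar> \<le> \<bar>K\<bar> * M (fst q) (snd q) * ?d"
        unfolding abs_mult[of "c _ _"] mult.assoc[of "\<bar>K\<bar>"] using M2[OF p, of "fst q" "snd q"]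
        by (intro mult_mono) auto
    qed
    also have "\<dots> = S * ?d" by (simp add: S_def sum_distrib_right case_prod_beta)
    also have "\<dots> \<le> (S + 1) * ?d" by (rule mult_right_mono) auto
    finally show "\<bar>perturbation m \<alpha> n c x y - perturbation m \<alpha> n c x' y'\<bar> \<le> (S + 1) * ?d" .
  qed
qed

section \<open>The perturbed equilibrium and the polar form of orbits\<close>

text \<open>Equilibria are the fixed points of (x, y) to (\<epsilon> B, - \<epsilon> A), a
  contraction of the square with factor 1/2. The bound linear in \<epsilon> later sends the centre
  to the origin.\<close>

lemma equilibrium_exists:
  fixes A B :: "real \<Rightarrow> real \<Rightarrow> real"
  assumes "\<eta> > 0" "L > 0"
    and A: "\<And>x y. \<bar>x\<bar> \<le> \<eta> \<Longrightarrow> \<bar>y\<bar> \<le> \<eta> \<Longrightarrow> \<bar>A x y\<bar> \<le> L"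
      "\<And>x y x' y'. \<bar>x\<bar> \<le> \<eta> \<Longrightarrow> \<bar>y\<bar> \<le> \<eta> \<Longrightarrow> \<bar>x'\<bar> \<le> \<eta> \<Longrightarrow> \<bar>y'\<bar> \<le> \<eta> \<Longrightarrow> \<bar>A x y - A x' y'\<bar> \<le> L * (\<bar>x - x'\<bar> + \<bar>y - y'\<bar>)"
    and B: "\<And>x y. \<bar>x\<bar> \<le> \<eta> \<Longrightarrow> \<bar>y\<bar> \<le> \<eta> \<Longrightarrow> \<bar>B x y\<bar> \<le> L"
      "\<And>x y x' y'. \<bar>x\<bar> \<le> \<eta> \<Longrightarrow> \<bar>y\<bar> \<le> \<eta> \<Longrightarrow> \<bar>x'\<bar> \<le> \<eta> \<Longrightarrow> \<bar>y'\<bar> \<le> \<eta> \<Longrightarrow> \<bar>B x y - B x' y'\<bar> \<le> L * (\<bar>x - x'\<bar> + \<bar>y - y'\<bar>)"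
    and small: "\<bar>\<epsilon>\<bar> * L \<le> \<eta>" "8 * \<bar>\<epsilon>\<bar> * L \<le> 1"
  shows "\<exists>e1 e2. e1 = \<epsilon> * B e1 e2 \<and> e2 = - \<epsilon> * A e1 e2 \<and> \<bar>e1\<bar> \<le> L * \<bar>\<epsilon>\<bar> \<and> \<bar>e2\<bar> \<le> L * \<bar>\<epsilon>\<bar> \<and> \<bar>e1\<bar> \<le> \<eta> \<and> \<bar>e2\<bar> \<le> \<eta>"
proof -
  let ?S = "{-\<eta>..\<eta>} \<times> {-\<eta>..\<eta>}"
  let ?T = "\<lambda>p. (\<epsilon> * B (fst p) (snd p), - \<epsilon> * A (fst p) (snd p))"
  have bound: "\<bar>\<epsilon> * u\<bar> \<le> L * \<bar>\<epsilon>\<bar>" if "\<bar>u\<bar> \<le> L" for u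
    using mult_left_mono[OF that abs_ge_zero[of \<epsilon>]] by (simp add: abs_mult mult.commute)
  have "\<exists>!p\<in>?S. ?T p = p"
  proof (rule Banach_fix[where c = "1 / 2" and f = ?T])
    show "complete ?S" by (intro compact_imp_complete compact_Times compact_Icc)
    show "?S \<noteq> {}" using \<open>\<eta> > 0\<close> by auto
    show "?T ` ?S \<subseteq> ?S"
    proof (rule image_subsetI)
      fix p assume "p \<in> ?S"
      then have "\<bar>fst p\<bar> \<le> \<eta>" "\<bar>snd p\<bar> \<le> \<eta>" by (auto simp: abs_le_iff)
      then have "\<bar>A (fst p) (snd p)\<bar> \<le> L" "\<bar>B (fst p) (snd p)\<bar> \<le> L" using A(1) B(1) by blast+
      from this[THEN bound] have "\<bar>\<epsilon> * A (fst p) (snd p)\<bar> \<le> \<eta>" "\<bar>\<epsilon> * B (fst p) (snd p)\<bar> \<le> \<eta>"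
        using small(1) by (auto simp: mult.commute)
      then show "?T p \<in> ?S" by (auto simp: abs_le_iff)
    qed
    fix p p' assume p: "p \<in> ?S" "p' \<in> ?S"
    let ?d = "\<bar>fst p - fst p'\<bar> + \<bar>snd p - snd p'\<bar>"
    have in_box: "\<bar>fst p\<bar> \<le> \<eta>" "\<bar>snd p\<bar> \<le> \<eta>" "\<bar>fst p'\<bar> \<le> \<eta>" "\<bar>snd p'\<bar> \<le> \<eta>" using p by (auto simp: abs_le_iff)
    have d: "?d \<le> 2 * dist p p'"
      using dist_fst_le[of p p'] dist_snd_le[of p p'] by (simp add: dist_real_def)
    have "dist (?T p) (?T p') \<le> dist (\<epsilon> * B (fst p) (snd p)) (\<epsilon> * B (fst p') (snd p')) + dist (- \<epsilon> * A (fst p) (snd p)) (- \<epsilon> * A (fst p') (snd p'))"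
      unfolding dist_Pair_Pair by (rule order_trans[OF sqrt_sum_squares_le_sum]) auto
    also have "\<dots> = \<bar>\<epsilon>\<bar> * \<bar>B (fst p) (snd p) - B (fst p') (snd p')\<bar> + \<bar>\<epsilon>\<bar> * \<bar>A (fst p) (snd p) - A (fst p') (snd p')\<bar>"
      unfolding dist_real_def abs_mult[symmetric] right_diff_distrib by (simp add: abs_minus_commute)
    also have "\<dots> \<le> \<bar>\<epsilon>\<bar> * (L * ?d) + \<bar>\<epsilon>\<bar> * (L * ?d)"
      using in_box by (intro add_mono mult_left_mono A(2) B(2)) auto
    also have "\<dots> \<le> \<bar>\<epsilon>\<bar> * (L * (2 * dist p p')) + \<bar>\<epsilon>\<bar> * (L * (2 * dist p p'))"
      using d \<open>L > 0\<close> by (intro add_mono mult_left_mono) auto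
    also have "\<dots> = 8 * \<bar>\<epsilon>\<bar> * L * (dist p p' / 2)" by simp
    also have "\<dots> \<le> 1 * (dist p p' / 2)" by (rule mult_right_mono[OF small(2)]) simp
    finally show "dist (?T p) (?T p') \<le> 1 / 2 * dist p p'" by simp
  qed simp_all
  then obtain p where p: "p \<in> ?S" "?T p = p" by blast
  have box: "\<bar>fst p\<bar> \<le> \<eta>" "\<bar>snd p\<bar> \<le> \<eta>" using p(1) by (auto simp: abs_le_iff)
  have eq1: "fst p = \<epsilon> * B (fst p) (snd p)"
    using arg_cong[OF p(2), of fst] unfolding fst_conv by (rule sym)
  have eq2: "snd p = - \<epsilon> * A (fst p) (snd p)"
    using arg_cong[OF p(2), of snd] unfolding snd_conv by (rule sym)
  have b1: "\<bar>fst p\<bar> \<le> L * \<bar>\<epsilon>\<bar>"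
    using bound[OF B(1)[OF box]] unfolding eq1[symmetric] .
  have "\<bar>snd p\<bar> = \<bar>- \<epsilon> * A (fst p) (snd p)\<bar>" by (rule arg_cong[OF eq2])
  also have "\<dots> = \<bar>\<epsilon> * A (fst p) (snd p)\<bar>" by (simp only: mult_minus_left abs_minus_cancel)
  finally have b2: "\<bar>snd p\<bar> \<le> L * \<bar>\<epsilon>\<bar>" using bound[OF A(1)[OF box]] by (simp only:)
  show ?thesis
    by (rule exI[of _ "fst p"], rule exI[of _ "snd p"], intro conjI) (fact eq1 eq2 b1 b2 box)+
qed

text \<open>Gronwall's argument in both directions of time: an orbit other than the equilibrium
  never reaches it, so its polar angle is always defined.\<close>

lemma orbit_never_vanishes:
  fixes Z :: "real \<Rightarrow> complex"
  assumes der: "\<And>t. (Z has_vector_derivative Z' t) (at t)" and bd: "\<And>t. norm (Z' t) \<le> M * norm (Z t)"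
    and "Z t0 \<noteq> 0"
  shows "Z t \<noteq> 0"
proof
  assume "Z t = 0"
  show False
  proof (cases "t \<le> t0")
    case True
    have "Z t0 = 0"
      by (rule vanishing_forward[where f = Z and f' = Z' and M = M, OF True \<open>Z t = 0\<close>]) (use der bd in \<open>auto intro: has_vector_derivative_at_within\<close>)
    then show False using assms by simp
  next
    case False
    have "(\<lambda>s. Z (- s)) (- t0) = 0"
    proof (rule vanishing_forward[where f = "\<lambda>s. Z (- s)" and a = "- t" and b = "- t0" and f' = "\<lambda>s. - Z' (- s)" and M = M])
      fix s
      have "(Z \<circ> uminus has_vector_derivative (- 1) *\<^sub>R Z' (- s)) (at s)"
        by (rule vector_diff_chain_at) (auto intro!: derivative_eq_intros der)
      then show "((\<lambda>s. Z (- s)) has_vector_derivative - Z' (- s)) (at s within {- t..- t0})"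
        by (simp add: o_def has_vector_derivative_at_within)
    qed (use False \<open>Z t = 0\<close> bd in auto)
    then show False using assms by simp
  qed
qed

text \<open>Polar coordinates: a global logarithm of \<open>Y + \<i> X\<close> yields radius and angle at once.\<close>

lemma orbit_polar_form:
  fixes X Y p q :: "real \<Rightarrow> real"
  assumes X: "\<And>t. (X has_real_derivative Y t + \<epsilon> * p t) (at t)"
    and Y: "\<And>t. (Y has_real_derivative - X t + \<epsilon> * q t) (at t)"
    and p: "\<And>t. \<bar>p t\<bar> \<le> M * (\<bar>X t\<bar> + \<bar>Y t\<bar>)" "continuous_on UNIV p"
    and q: "\<And>t. \<bar>q t\<bar> \<le> M * (\<bar>X t\<bar> + \<bar>Y t\<bar>)" "continuous_on UNIV q"
    and M: "M \<ge> 0" "8 * \<bar>\<epsilon>\<bar> * M \<le> 1"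
    and per: "T > 0" "\<And>t. X (t + T) = X t" "\<And>t. Y (t + T) = Y t" "\<And>t. p (t + T) = p t" "\<And>t. q (t + T) = q t"
    and nz: "(X t0, Y t0) \<noteq> (0, 0)"
  obtains g \<theta> :: "real \<Rightarrow> real" and k :: nat where
    "\<And>t. X t = g (\<theta> t) * sin (\<theta> t)" "\<And>t. Y t = g (\<theta> t) * cos (\<theta> t)" "surj \<theta>"
    "\<And>s. g s > 0" "k \<ge> 1" "\<And>s. g (s + 2 * pi * real k) = g s"
    "\<And>s t. s \<le> t \<Longrightarrow> g t \<le> g s * exp (8 * M * \<bar>\<epsilon>\<bar> * (t - s))"
    "\<And>t. (g has_real_derivative \<epsilon> * (g (\<theta> t) * (sin (\<theta> t) * (p t / g (\<theta> t)) + cos (\<theta> t) * (q t / g (\<theta> t))) /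
       (1 + \<epsilon> * (cos (\<theta> t) * (p t / g (\<theta> t)) - sin (\<theta> t) * (q t / g (\<theta> t)))))) (at (\<theta> t))"
proof -
  define Z where "Z t = complex_of_real (Y t) + \<i> * of_real (X t)" for t
  define w where "w t = complex_of_real (q t) + \<i> * of_real (p t)" for t
  have Zd: "(Z has_vector_derivative \<i> * Z t + of_real \<epsilon> * w t) (at t)" for t
  proof -
    have "(Z has_vector_derivative of_real (- X t + \<epsilon> * q t) + \<i> * of_real (Y t + \<epsilon> * p t)) (at t)"
      unfolding Z_def
      by (intro has_vector_derivative_add has_vector_derivative_mult_right has_vector_derivative_of_real)
         (use X Y in \<open>auto simp: has_real_derivative_iff_has_vector_derivative\<close>)
    moreover have "of_real (- X t + \<epsilon> * q t) + \<i> * of_real (Y t + \<epsilon> * p t) = \<i> * Z t + of_real \<epsilon> * w t"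
      by (simp add: Z_def w_def algebra_simps)
    ultimately show ?thesis by simp
  qed
  have w: "norm (w t) \<le> 4 * M * norm (Z t)" for t
  proof -
    have "norm (w t) \<le> \<bar>q t\<bar> + \<bar>p t\<bar>" unfolding w_def by (rule order_trans[OF norm_triangle_ineq]) (simp add: norm_mult)
    also have "\<dots> \<le> M * (\<bar>X t\<bar> + \<bar>Y t\<bar>) + M * (\<bar>X t\<bar> + \<bar>Y t\<bar>)" by (intro add_mono p q)
    also have "\<bar>X t\<bar> + \<bar>Y t\<bar> \<le> 2 * norm (Z t)"
      using abs_Re_le_cmod[of "Z t"] abs_Im_le_cmod[of "Z t"] by (simp add: Z_def)
    then have "M * (\<bar>X t\<bar> + \<bar>Y t\<bar>) + M * (\<bar>X t\<bar> + \<bar>Y t\<bar>) \<le> M * (2 * norm (Z t)) + M * (2 * norm (Z t))"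
      using M by (intro add_mono mult_left_mono) auto
    finally show ?thesis by simp
  qed
  have Z0: "Z t \<noteq> 0" for t
  proof (rule orbit_never_vanishes[OF Zd, of "1 + \<bar>\<epsilon>\<bar> * (4 * M)" t0])
    fix t
    have "norm (\<i> * Z t + of_real \<epsilon> * w t) \<le> norm (Z t) + \<bar>\<epsilon>\<bar> * norm (w t)"
      by (rule order_trans[OF norm_triangle_ineq]) (simp add: norm_mult)
    also have "\<dots> \<le> norm (Z t) + \<bar>\<epsilon>\<bar> * (4 * M * norm (Z t))" by (intro add_left_mono mult_left_mono w) simp
    finally show "norm (\<i> * Z t + of_real \<epsilon> * w t) \<le> (1 + \<bar>\<epsilon>\<bar> * (4 * M)) * norm (Z t)" by (simp add: algebra_simps)
  next
    show "Z t0 \<noteq> 0" using nz by (auto simp: Z_def complex_eq_iff)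
  qed
  define u where "u t = w t / Z t" for t
  \<comment> \<open>The logarithmic derivative of \<open>Z\<close>: its imaginary part is the
    angular speed, close to 1, and its real part is the relative growth of the radius.\<close>
  define h where "h t = \<i> + of_real \<epsilon> * u t" for t
  have u_bd: "\<bar>\<epsilon>\<bar> * norm (u t) \<le> 4 * M * \<bar>\<epsilon>\<bar>" for t
    using mult_left_mono[OF w[of t], of "\<bar>\<epsilon>\<bar>"] Z0[of t] by (simp add: u_def norm_divide field_simps)
  have Zh: "\<i> * Z t + of_real \<epsilon> * w t = h t * Z t" for t
    using Z0[of t] by (simp add: h_def u_def field_simps)
  have contZ: "continuous_on UNIV Z"
    unfolding Z_def by (intro continuous_intros DERIV_continuous_on[of UNIV X] DERIV_continuous_on[of UNIV Y])
      (use X Y in auto)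
  have conth: "continuous_on UNIV h" unfolding h_def u_def w_def by (intro continuous_intros contZ p q) (use Z0 in auto)
  obtain \<Lambda>0 where \<Lambda>0: "\<And>t. (\<Lambda>0 has_vector_derivative h t) (at t)"
    using einterval_antiderivative[of "-\<infinity>" "\<infinity>" h] conth by (auto simp: continuous_on_eq_continuous_at)
  \<comment> \<open>The constant makes \<open>\<Lambda>\<close> a logarithm of \<open>Z\<close> at
    time 0. As \<open>Z t * exp (- \<Lambda> t)\<close> has derivative 0, it is one at all
    times.\<close>
  define \<Lambda> where "\<Lambda> t = \<Lambda>0 t + (Ln (Z 0) - \<Lambda>0 0)" for t
  have \<Lambda>: "(\<Lambda> has_vector_derivative h t) (at t)" for t
    unfolding \<Lambda>_def using has_vector_derivative_add[OF \<Lambda>0 has_vector_derivative_const] by simp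
  have expL: "exp (\<Lambda> t) = Z t" for t
  proof -
    have "((\<lambda>t. Z t * exp (- \<Lambda> t)) has_vector_derivative 0) (at t)" for t
    proof -
      have "((exp \<circ> (\<lambda>t. - \<Lambda> t)) has_vector_derivative (- h t) * exp (- \<Lambda> t)) (at t)"
        by (rule field_vector_diff_chain_at) (intro has_vector_derivative_minus \<Lambda> DERIV_exp)+
      then have "((\<lambda>t. Z t * exp (- \<Lambda> t)) has_vector_derivative (Z t * ((- h t) * exp (- \<Lambda> t)) + (\<i> * Z t + of_real \<epsilon> * w t) * exp (- \<Lambda> t))) (at t)"
        by (intro has_vector_derivative_mult Zd) (simp add: o_def)
      then show ?thesis unfolding Zh by (simp add: algebra_simps)
    qed
    then obtain c where c: "\<And>t. Z t * exp (- \<Lambda> t) = c"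
      using has_vector_derivative_zero_constant[of UNIV "\<lambda>t. Z t * exp (- \<Lambda> t)"] by auto
    have "c = 1" using c[of 0] Z0[of 0] by (simp add: \<Lambda>_def exp_minus field_simps)
    then show ?thesis using c[of t] by (simp add: exp_minus field_simps)
  qed
  define \<theta> where "\<theta> t = Im (\<Lambda> t)" for t
  have \<theta>d: "(\<theta> has_real_derivative Im (h t)) (at t)" for t
    unfolding \<theta>_def has_real_derivative_iff_has_vector_derivative
    by (rule bounded_linear.has_vector_derivative[OF bounded_linear_Im \<Lambda>])
  have Rd: "((\<lambda>t. Re (\<Lambda> t)) has_real_derivative Re (h t)) (at t)" for t
    unfolding has_real_derivative_iff_has_vector_derivative
    by (rule bounded_linear.has_vector_derivative[OF bounded_linear_Re \<Lambda>])
  have Imh: "Im (h t) \<ge> 1 / 2" for t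
  proof -
    have "\<bar>\<epsilon> * Im (u t)\<bar> \<le> \<bar>\<epsilon>\<bar> * norm (u t)" unfolding abs_mult by (intro mult_left_mono abs_Im_le_cmod) auto
    then have "\<bar>\<epsilon> * Im (u t)\<bar> \<le> 1 / 2" using u_bd[of t] M(2) by (simp add: mult_ac)
    then show ?thesis by (simp add: h_def)
  qed
  have Reh: "Re (h t) / Im (h t) \<le> 8 * M * \<bar>\<epsilon>\<bar>" for t
  proof -
    have "Re (h t) \<le> \<bar>\<epsilon>\<bar> * norm (u t)"
      using abs_ge_self[of "\<epsilon> * Re (u t)"] mult_left_mono[OF abs_Re_le_cmod[of "u t"], of "\<bar>\<epsilon>\<bar>"] by (simp add: h_def abs_mult)
    then have "Re (h t) \<le> 4 * M * \<bar>\<epsilon>\<bar>" using u_bd[of t] by simp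
    also have "4 * M * \<bar>\<epsilon>\<bar> = 8 * M * \<bar>\<epsilon>\<bar> * (1 / 2)" by simp
    also have "\<dots> \<le> 8 * M * \<bar>\<epsilon>\<bar> * Im (h t)" using Imh[of t] M(1) by (intro mult_left_mono) auto
    finally show ?thesis using Imh[of t] by (simp add: divide_le_eq)
  qed
  have grow: "\<theta> t - \<theta> s \<ge> (t - s) / 2" if "s \<le> t" for s t
  proof -
    have "\<theta> s - s / 2 \<le> \<theta> t - t / 2"
    proof (rule DERIV_nonneg_imp_nondecreasing[OF that])
      fix x
      have "((\<lambda>t. \<theta> t - t / 2) has_real_derivative Im (h x) - 1 / 2) (at x)"
        by (auto intro!: derivative_eq_intros \<theta>d)
      then show "\<exists>y. ((\<lambda>t. \<theta> t - t / 2) has_real_derivative y) (at x) \<and> 0 \<le> y" using Imh[of x] by force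
    qed
    then show ?thesis by (simp add: field_simps)
  qed
  have cont\<theta>: "isCont \<theta> t" for t using \<theta>d DERIV_isCont by blast
  have inj: "inj \<theta>"
  proof (rule injI)
    fix s t assume eq: "\<theta> s = \<theta> t"
    show "s = t"
    proof (cases "s \<le> t")
      case True
      have "(t - s) / 2 \<le> 0" using grow[OF True] unfolding eq by simp
      then show ?thesis using True by simp
    next
      case False
      then have "t \<le> s" by simp
      have "(s - t) / 2 \<le> 0" using grow[OF \<open>t \<le> s\<close>] unfolding eq by simp
      then show ?thesis using \<open>t \<le> s\<close> by simp
    qed
  qed
  have surj: "surj \<theta>"
  unfolding surj_def
  proof
    fix v
    define C where "C = 2 * (\<bar>v\<bar> + \<bar>\<theta> 0\<bar>)"
    have "C \<ge> 0" by (simp add: C_def)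
    then have "\<theta> (- C) \<le> v" "v \<le> \<theta> C"
    proof -
      assume "C \<ge> 0"
      then have "C / 2 \<le> \<theta> 0 - \<theta> (- C)" "C / 2 \<le> \<theta> C - \<theta> 0" using grow[of "- C" 0] grow[of 0 C] by simp_all
      moreover have "C / 2 = \<bar>v\<bar> + \<bar>\<theta> 0\<bar>" by (simp add: C_def)
      ultimately show "\<theta> (- C) \<le> v" "v \<le> \<theta> C" by linarith+
    qed
    then have "\<exists>t\<ge>- C. t \<le> C \<and> \<theta> t = v"
      by (intro IVT) (use cont\<theta> \<open>C \<ge> 0\<close> in auto)
    then show "\<exists>t. v = \<theta> t" by metis
  qed
  \<comment> \<open>The angle grows with speed at least 1/2 and hence is a bijection of the real
    line. Its inverse turns the angle into the independent variable.\<close>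
  define \<tau> where "\<tau> = inv \<theta>"
  have \<tau>: "\<tau> (\<theta> t) = t" "\<theta> (\<tau> s) = s" for s t
    using inj surj by (auto simp: \<tau>_def surj_f_inv_f)
  have \<tau>d: "(\<tau> has_real_derivative inverse (Im (h (\<tau> s)))) (at s)" for s
  proof -
    have "(\<tau> has_real_derivative inverse (Im (h (\<tau> s)))) (at (\<theta> (\<tau> s)))"
      by (rule has_field_derivative_inverse_strong[where S = UNIV])
         (use \<theta>d Imh[of "\<tau> s"] \<tau> cont\<theta> in \<open>auto simp: continuous_on_eq_continuous_at\<close>)
    then show ?thesis by (simp add: \<tau>)
  qed
  have logd: "((\<lambda>s. Re (\<Lambda> (\<tau> s))) has_real_derivative Re (h (\<tau> s)) / Im (h (\<tau> s))) (at s)" for s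
    using DERIV_chain2[OF Rd \<tau>d] by (simp add: divide_inverse)
  define g where "g s = exp (Re (\<Lambda> (\<tau> s)))" for s
  have gd: "(g has_real_derivative g s * (Re (h (\<tau> s)) / Im (h (\<tau> s)))) (at s)" for s
    unfolding g_def by (rule DERIV_chain2[OF DERIV_exp logd])
  have polar: "Y t = g (\<theta> t) * cos (\<theta> t)" "X t = g (\<theta> t) * sin (\<theta> t)" for t
  proof -
    have "Y t = Re (exp (\<Lambda> t))" "X t = Im (exp (\<Lambda> t))" unfolding expL by (simp_all add: Z_def)
    moreover have "g (\<theta> t) = exp (Re (\<Lambda> t))" by (simp add: g_def \<tau>)
    ultimately show "Y t = g (\<theta> t) * cos (\<theta> t)" "X t = g (\<theta> t) * sin (\<theta> t)"
      unfolding Re_exp Im_exp \<theta>_def[symmetric] by simp_all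
  qed
  have "((\<lambda>t. \<Lambda> (t + T) - \<Lambda> t) has_vector_derivative 0) (at t)" for t
  proof -
    have "Z (t + T) = Z t" "w (t + T) = w t" using per by (simp_all add: Z_def w_def)
    then have hT: "h (t + T) = h t" by (simp add: h_def u_def)
    have "((\<Lambda> \<circ> (\<lambda>t. t + T)) has_vector_derivative 1 *\<^sub>R h (t + T)) (at t)"
      by (rule vector_diff_chain_at) (auto intro!: derivative_eq_intros \<Lambda>)
    then have "((\<lambda>t. \<Lambda> (t + T)) has_vector_derivative h t) (at t)" by (simp add: o_def hT)
    from has_vector_derivative_diff[OF this \<Lambda>] show ?thesis by simp
  qed
  then obtain c where c: "\<And>t. \<Lambda> (t + T) - \<Lambda> t = c"
    using has_vector_derivative_zero_constant[of UNIV "\<lambda>t. \<Lambda> (t + T) - \<Lambda> t"] by auto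
  have "Z T = Z 0" using per(2,3)[of 0] by (simp add: Z_def)
  then have "exp c = 1" using c[of 0] Z0[of 0] by (simp add: exp_diff expL flip: c[of 0])
  \<comment> \<open>During a period the logarithm changes by 2 \<pi> \<i> \<open>N\<close>. The
    angle increases, so \<open>N\<close> is positive; it is the number of turns of the orbit around
    the equilibrium, not yet known to be 1.\<close>
  then obtain N :: int where N: "Re c = 0" "Im c = of_int (2 * N) * pi" by (auto simp: exp_eq_1)
  have cRe: "Re (\<Lambda> (t + T)) = Re (\<Lambda> t)" and cIm: "\<theta> (t + T) = \<theta> t + of_int (2 * N) * pi" for t
    using c[of t] N by (auto simp: \<theta>_def complex_eq_iff algebra_simps)
  have "of_int (2 * N) * pi = \<theta> T - \<theta> 0" using cIm[of 0] by simp
  moreover have "(T - 0) / 2 \<le> \<theta> T - \<theta> 0" by (rule grow) (use per(1) in simp)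
  then have "\<theta> T - \<theta> 0 > 0" using per(1) by simp
  ultimately have "of_int (2 * N) * pi > 0" by metis
  then have "N > 0" by (simp add: zero_less_mult_iff)
  define k where "k = nat N"
  have k: "k \<ge> 1" "real k = of_int N" using \<open>N > 0\<close> by (auto simp: k_def)
  have "\<tau> (s + 2 * pi * real k) = \<tau> s + T" for s
    using cIm[of "\<tau> s"] \<tau>(1)[of "\<tau> s + T"] by (simp add: \<tau> k(2) algebra_simps)
  then have gper: "g (s + 2 * pi * real k) = g s" for s by (simp add: g_def cRe)
  have growth: "g t \<le> g s * exp (8 * M * \<bar>\<epsilon>\<bar> * (t - s))" if "s \<le> t" for s t
  proof -
    have "Re (\<Lambda> (\<tau> t)) - 8 * M * \<bar>\<epsilon>\<bar> * t \<le> Re (\<Lambda> (\<tau> s)) - 8 * M * \<bar>\<epsilon>\<bar> * s"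
    proof (rule DERIV_nonpos_imp_nonincreasing[OF that])
      fix x
      have "((\<lambda>t. Re (\<Lambda> (\<tau> t)) - 8 * M * \<bar>\<epsilon>\<bar> * t) has_real_derivative Re (h (\<tau> x)) / Im (h (\<tau> x)) - 8 * M * \<bar>\<epsilon>\<bar>) (at x)"
        by (rule DERIV_diff[OF logd DERIV_cmult_Id])
      then show "\<exists>y. ((\<lambda>t. Re (\<Lambda> (\<tau> t)) - 8 * M * \<bar>\<epsilon>\<bar> * t) has_real_derivative y) (at x) \<and> y \<le> 0"
        using Reh[of "\<tau> x"] by force
    qed
    then have "Re (\<Lambda> (\<tau> t)) \<le> Re (\<Lambda> (\<tau> s)) + 8 * M * \<bar>\<epsilon>\<bar> * (t - s)" by (simp add: algebra_simps)
    then show ?thesis by (simp add: g_def flip: exp_add)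
  qed
  show ?thesis
  proof (rule that[of g \<theta> k])
    fix t
    let ?g = "g (\<theta> t)" and ?s = "sin (\<theta> t)" and ?c = "cos (\<theta> t)"
    have gp: "?g > 0" by (simp add: g_def)
    have "Z t = of_real ?g * cis (\<theta> t)" by (simp add: Z_def polar complex_eq_iff)
    then have ut: "u t = w t * cis (- \<theta> t) / of_real ?g" 
      unfolding u_def by (simp add: divide_inverse cis_inverse)
    have "Re (u t) = ?s * (p t / ?g) + ?c * (q t / ?g)" "Im (u t) = ?c * (p t / ?g) - ?s * (q t / ?g)"
      unfolding ut Re_divide_of_real Im_divide_of_real
      by (simp_all add: w_def add_divide_distrib diff_divide_distrib mult.commute)
    then have "Re (h t) = \<epsilon> * (?s * (p t / ?g) + ?c * (q t / ?g))" "Im (h t) = 1 + \<epsilon> * (?c * (p t / ?g) - ?s * (q t / ?g))"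
      by (simp_all add: h_def)
    with gd[of "\<theta> t"] show "(g has_real_derivative \<epsilon> * (?g * (?s * (p t / ?g) + ?c * (q t / ?g)) /
       (1 + \<epsilon> * (?c * (p t / ?g) - ?s * (q t / ?g))))) (at (\<theta> t))"
      by (simp add: \<tau> mult_ac)
  qed (use polar surj k gper growth in \<open>auto simp: g_def\<close>)
qed

section \<open>A uniform bound on the radius of orbits in V\<close>

lemma vector_field_perturbation:
  assumes "m1 + m2 = Suc m"
  shows "vector_field m1 m2 \<alpha> \<alpha> n a b \<epsilon> (x, y) =
    (y + \<epsilon> * perturbation m \<alpha> n a x y, - x + \<epsilon> * perturbation m \<alpha> n b x y)"
proof -
  have d: "\<epsilon> / denom m1 m2 \<alpha> \<alpha> x = \<epsilon> * (1 / (1 - \<alpha> * x)) ^ Suc m"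
    unfolding denom_def power_add[symmetric] assms by (simp add: power_divide)
  have "\<epsilon> / denom m1 m2 \<alpha> \<alpha> x * (\<Sum>(i, j)\<in>indices n. c i j * x ^ i * y ^ j) = \<epsilon> * perturbation m \<alpha> n c x y" for c
    unfolding d perturbation_def mult.assoc sum_distrib_left case_prod_beta
    by (intro sum.cong refl) (simp only: mult_ac)
  then show ?thesis by (simp add: vector_field_def)
qed

text \<open>The conditions \<open>\<delta> \<le> 1 / 2\<close> and \<open>R0 \<le> R\<close> allow
  the region to contain also a square around the origin, in which the equilibrium is sought.\<close>

lemma compact_in_region:
  assumes "compact V" "V \<subseteq> Omega m1 m2 \<alpha> \<alpha>" "m1 + m2 = Suc m"
  obtains R \<delta> where "0 < \<delta>" "\<delta> \<le> 1 / 2" "R0 \<le> R" "V \<subseteq> region \<alpha> R \<delta>"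
proof -
  have nz: "1 - \<alpha> * fst v \<noteq> 0" if "v \<in> V" for v
  proof
    assume "1 - \<alpha> * fst v = 0"
    then have "denom m1 m2 \<alpha> \<alpha> (fst v) = 0"
      unfolding denom_def power_add[symmetric] assms(3) by simp
    then show False using assms(2) that by (cases v) (auto simp: Omega_def)
  qed
  obtain B where B: "\<And>v. v \<in> V \<Longrightarrow> norm v \<le> B"
    using compact_imp_bounded[OF assms(1)] by (auto simp: bounded_iff)
  obtain d where d: "d > 0" "\<And>v. v \<in> V \<Longrightarrow> d \<le> \<bar>1 - \<alpha> * fst v\<bar>"
  proof (cases "V = {}")
    case False
    then obtain w where "w \<in> V" "\<forall>v\<in>V. \<bar>1 - \<alpha> * fst w\<bar> \<le> \<bar>1 - \<alpha> * fst v\<bar>"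
      using continuous_attains_inf[OF assms(1), of "\<lambda>v. \<bar>1 - \<alpha> * fst v\<bar>"] by (force intro!: continuous_intros)
    then show ?thesis using nz that[of "\<bar>1 - \<alpha> * fst w\<bar>"] by auto
  qed (use that[of 1] in auto)
  have "V \<subseteq> region \<alpha> (max R0 B) (min d (1 / 2))"
  proof
    fix v assume v: "v \<in> V"
    have "\<bar>fst v\<bar> \<le> norm v" "\<bar>snd v\<bar> \<le> norm v"
      using norm_fst_le[of "fst v" "snd v"] norm_snd_le[of "snd v" "fst v"] by auto
    then show "v \<in> region \<alpha> (max R0 B) (min d (1 / 2))"
      using B[OF v] d(2)[OF v] by (auto simp: region_def case_prod_beta)
  qed
  then show ?thesis using d by (intro that[of "min d (1 / 2)" "max R0 B"]) auto
qed

text \<open>At such an angle the radius vector points straight at the singular line, so a distance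
  from that line limits the radius. Each turn contains such an angle.\<close>

lemma sin_eq_sgn_nearby:
  assumes "\<alpha> \<noteq> (0::real)"
  obtains s' where "s - 2 * pi \<le> s'" "s' \<le> s" "sin s' = sgn \<alpha>"
proof -
  define N where "N = \<lfloor>(s - sgn \<alpha> * (pi / 2)) / (2 * pi)\<rfloor>"
  have "of_int N \<le> (s - sgn \<alpha> * (pi / 2)) / (2 * pi)" "(s - sgn \<alpha> * (pi / 2)) / (2 * pi) < of_int N + 1"
    unfolding N_def by linarith+
  then have "s - 2 * pi \<le> sgn \<alpha> * (pi / 2) + (2 * pi) * of_int N" "sgn \<alpha> * (pi / 2) + (2 * pi) * of_int N \<le> s"
    by (simp_all add: field_simps)
  moreover have "sin (sgn \<alpha> * (pi / 2) + (2 * pi) * of_int N) = sgn \<alpha>"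
    unfolding sin_add cos_int_2pin sin_int_2pin using assms by (simp add: sgn_if)
  ultimately show ?thesis using that by blast
qed

text \<open>An orbit cannot cross the line, and beyond it \<alpha> x > 1 outweighs the perturbation,
  so \<open>\<alpha> * y\<close> would decrease strictly and \<open>y\<close> could not return to
  its initial value. For negative \<alpha>, the side meant is again that of the origin.\<close>

lemma orbit_left_of_line:
  fixes x y :: "real \<Rightarrow> real"
  assumes x: "\<And>t. (x has_real_derivative x' t) (at t)" and y: "\<And>t. (y has_real_derivative - x t + q t) (at t)"
    and nz: "\<And>t. 1 - \<alpha> * x t \<noteq> 0" and q: "\<And>t. \<bar>\<alpha> * q t\<bar> \<le> 1" and "T > 0" "y T = y 0"
  shows "1 - \<alpha> * x t > 0"
proof (rule ccontr)
  assume "\<not> ?thesis"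
  then have neg: "1 - \<alpha> * x t < 0" using nz[of t] by linarith
  have neg_all: "1 - \<alpha> * x s < 0" for s
  proof (rule ccontr)
    assume "\<not> ?thesis"
    then have pos: "1 - \<alpha> * x s > 0" using nz[of s] by linarith
    have "connected ((\<lambda>t. 1 - \<alpha> * x t) ` UNIV)"
      by (intro connected_continuous_image connected_UNIV continuous_intros DERIV_continuous_on[of UNIV x]) (use x in auto)
    then have "{1 - \<alpha> * x t..1 - \<alpha> * x s} \<subseteq> range (\<lambda>t. 1 - \<alpha> * x t)"
      by (rule connected_contains_Icc) auto
    then have "0 \<in> range (\<lambda>t. 1 - \<alpha> * x t)" using neg pos by auto
    then obtain u where "0 = 1 - \<alpha> * x u" by blast
    then show False using nz[of u] by simp
  qed
  have "\<alpha> * y T < \<alpha> * y 0"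
  proof (rule DERIV_neg_imp_decreasing[OF \<open>T > 0\<close>, of "\<lambda>t. \<alpha> * y t"])
    fix s
    have "((\<lambda>t. \<alpha> * y t) has_real_derivative \<alpha> * (- x s + q s)) (at s)" by (intro DERIV_cmult y)
    moreover have "\<alpha> * (- x s + q s) = \<alpha> * q s - \<alpha> * x s" by (simp add: algebra_simps)
    then have "\<alpha> * (- x s + q s) < 0" using neg_all[of s] q[of s] by linarith
    ultimately show "\<exists>d. ((\<lambda>t. \<alpha> * y t) has_real_derivative d) (at s) \<and> d < 0" by blast
  qed
  then show False using assms by simp
qed

definition polar_orbit ::
  "nat \<Rightarrow> real \<Rightarrow> nat \<Rightarrow> real \<Rightarrow> coeffs \<Rightarrow> coeffs \<Rightarrow> real \<Rightarrow> real \<times> real \<Rightarrow> (real \<times> real) set \<Rightarrow> bool" where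
  "polar_orbit m \<alpha> n \<epsilon> a b \<rho> e \<gamma> \<longleftrightarrow> (\<exists>g k. k \<ge> (1::nat) \<and> polar_solution m \<alpha> n \<epsilon> a b e \<rho> g \<and>
     (\<forall>t. g t > 0) \<and> (\<forall>t. g (t + 2 * pi * real k) = g t) \<and>
     \<gamma> = range (\<lambda>t. (fst e + g t * sin t, snd e + g t * cos t)))"

text \<open>The radius bound has to be below 1/|\<alpha>|, uniformly in \<epsilon> and the
  coefficients. At an angle pointing at the singular line, \<alpha> x \<le> 1 - \<delta> bounds
  |\<alpha>| g by 1 - \<delta> up to the displacement of the centre, and within the following turn g
  grows at most by the factor \<open>exp (16 * pi * L * \<bar>\<epsilon>\<bar>)\<close>.\<close>

lemma periodic_orbits_polar:
  assumes "\<alpha> \<noteq> 0" and m: "m1 + m2 = Suc m" and V: "compact V" "V \<subseteq> Omega m1 m2 \<alpha> \<alpha>"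
  obtains \<delta>0 \<rho> C where "\<delta>0 > 0" "0 < \<rho>" "\<bar>\<alpha>\<bar> * \<rho> < 1" "C > 0"
    "\<And>\<epsilon> a b. \<bar>\<epsilon>\<bar> < \<delta>0 \<Longrightarrow> (a, b) \<in> coeff_box n K \<Longrightarrow> \<exists>e. \<bar>fst e\<bar> \<le> C * \<bar>\<epsilon>\<bar> \<and> \<bar>snd e\<bar> \<le> C * \<bar>\<epsilon>\<bar> \<and>
       (\<forall>\<gamma>. periodic_orbit (vector_field m1 m2 \<alpha> \<alpha> n a b \<epsilon>) (Omega m1 m2 \<alpha> \<alpha>) \<gamma> \<and> \<gamma> \<subseteq> V \<longrightarrow>
         polar_orbit m \<alpha> n \<epsilon> a b \<rho> e \<gamma>)"
proof -
  \<comment> \<open>Half the distance of the origin from the singular line, so that 1 - \<alpha> x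
    \<ge> 1/2 on the square.\<close>
  define \<eta> where "\<eta> = 1 / (2 * \<bar>\<alpha>\<bar>)"
  have \<eta>: "\<eta> > 0" using \<open>\<alpha> \<noteq> 0\<close> by (simp add: \<eta>_def)
  obtain R \<delta> where R: "0 < \<delta>" "\<delta> \<le> 1 / 2" "\<eta> \<le> R" "V \<subseteq> region \<alpha> R \<delta>"
    using compact_in_region[OF V m] by metis
  have box: "(x, y) \<in> region \<alpha> R \<delta>" if "\<bar>x\<bar> \<le> \<eta>" "\<bar>y\<bar> \<le> \<eta>" for x y
  proof -
    have "\<bar>\<alpha> * x\<bar> \<le> \<bar>\<alpha>\<bar> * \<eta>" unfolding abs_mult by (rule mult_left_mono[OF that(1)]) simp
    also have "\<dots> = 1 / 2" using \<open>\<alpha> \<noteq> 0\<close> by (simp add: \<eta>_def)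
    finally show ?thesis using that R by (auto simp: region_def)
  qed
  obtain L where L: "L > 0"
    "\<And>c x y. (\<And>i j. i + j \<le> n \<Longrightarrow> \<bar>c i j\<bar> \<le> K) \<Longrightarrow> (x, y) \<in> region \<alpha> R \<delta> \<Longrightarrow> \<bar>perturbation m \<alpha> n c x y\<bar> \<le> L"
    "\<And>c x y x' y'. (\<And>i j. i + j \<le> n \<Longrightarrow> \<bar>c i j\<bar> \<le> K) \<Longrightarrow> (x, y) \<in> region \<alpha> R \<delta> \<Longrightarrow> (x', y') \<in> region \<alpha> R \<delta> \<Longrightarrow>
       \<bar>perturbation m \<alpha> n c x y - perturbation m \<alpha> n c x' y'\<bar> \<le> L * (\<bar>x - x'\<bar> + \<bar>y - y'\<bar>)"
    using perturbation_lipschitz[OF R(1)] by metis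
  \<comment> \<open>Below \<open>s0\<close>, the displacement of the centre and the growth of the
    radius together use up at most half of the gap \<delta>; the other half is the margin in
    \<rho>.\<close>
  have "((\<lambda>s. (1 - \<delta> + \<bar>\<alpha>\<bar> * L * s) * exp (16 * pi * L * s)) \<longlongrightarrow> (1 - \<delta> + \<bar>\<alpha>\<bar> * L * 0) * exp (16 * pi * L * 0)) (nhds 0)"
    by (intro tendsto_intros filterlim_ident)
  then have "eventually (\<lambda>s. (1 - \<delta> + \<bar>\<alpha>\<bar> * L * s) * exp (16 * pi * L * s) < 1 - \<delta> / 2) (nhds 0)"
    by (rule order_tendstoD) (use R in auto)
  then obtain s0 where s0: "s0 > 0" "\<And>s. \<bar>s\<bar> < s0 \<Longrightarrow> (1 - \<delta> + \<bar>\<alpha>\<bar> * L * s) * exp (16 * pi * L * s) < 1 - \<delta> / 2"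
    by (auto simp: eventually_nhds_metric dist_real_def)
  define \<delta>0 where "\<delta>0 = min s0 (min (\<eta> / L) (min (1 / (8 * L)) (1 / (\<bar>\<alpha>\<bar> * L))))"
  define \<rho> where "\<rho> = (1 - \<delta> / 2) / \<bar>\<alpha>\<bar>"
  show ?thesis
  proof (rule that[of \<delta>0 \<rho> L])
    show "\<delta>0 > 0" using s0 \<eta> L \<open>\<alpha> \<noteq> 0\<close> by (simp add: \<delta>0_def)
    show "\<rho> > 0" "\<bar>\<alpha>\<bar> * \<rho> < 1" using R \<open>\<alpha> \<noteq> 0\<close> by (auto simp: \<rho>_def)
    show "L > 0" by fact
    fix \<epsilon> a b assume "\<bar>\<epsilon>\<bar> < \<delta>0" and ab: "(a, b) \<in> coeff_box n K"
    then have "\<bar>\<epsilon>\<bar> < s0" "\<bar>\<epsilon>\<bar> < \<eta> / L" "\<bar>\<epsilon>\<bar> < 1 / (8 * L)" "\<bar>\<epsilon>\<bar> < 1 / (\<bar>\<alpha>\<bar> * L)" by (auto simp: \<delta>0_def)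
    then have \<epsilon>: "\<bar>\<epsilon>\<bar> < s0" "\<bar>\<epsilon>\<bar> * L \<le> \<eta>" "8 * \<bar>\<epsilon>\<bar> * L \<le> 1" "\<bar>\<alpha>\<bar> * (\<bar>\<epsilon>\<bar> * L) \<le> 1"
      using L(1) \<open>\<alpha> \<noteq> 0\<close> by (auto simp: field_simps)
    let ?A = "perturbation m \<alpha> n a" and ?B = "perturbation m \<alpha> n b"
    have ca: "\<bar>a i j\<bar> \<le> K" and cb: "\<bar>b i j\<bar> \<le> K" if "i + j \<le> n" for i j using ab that by (auto simp: coeff_box_def)
    note LA = L(2)[of a, OF ca] L(3)[of a, OF ca] and LB = L(2)[of b, OF cb] L(3)[of b, OF cb]
    have "\<exists>e1 e2. e1 = \<epsilon> * ?B e1 e2 \<and> e2 = - \<epsilon> * ?A e1 e2 \<and> \<bar>e1\<bar> \<le> L * \<bar>\<epsilon>\<bar> \<and> \<bar>e2\<bar> \<le> L * \<bar>\<epsilon>\<bar> \<and> \<bar>e1\<bar> \<le> \<eta> \<and> \<bar>e2\<bar> \<le> \<eta>"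
      by (rule equilibrium_exists[OF \<eta> L(1)]) (intro LA LB box \<epsilon>; assumption)+
    then obtain e1 e2 where e: "e1 = \<epsilon> * ?B e1 e2" "e2 = - \<epsilon> * ?A e1 e2" "\<bar>e1\<bar> \<le> L * \<bar>\<epsilon>\<bar>" "\<bar>e2\<bar> \<le> L * \<bar>\<epsilon>\<bar>" "\<bar>e1\<bar> \<le> \<eta>" "\<bar>e2\<bar> \<le> \<eta>"
      by blast
    have e_in: "(e1, e2) \<in> region \<alpha> R \<delta>" by (rule box[OF e(5,6)])
    show "\<exists>e. \<bar>fst e\<bar> \<le> L * \<bar>\<epsilon>\<bar> \<and> \<bar>snd e\<bar> \<le> L * \<bar>\<epsilon>\<bar> \<and>
       (\<forall>\<gamma>. periodic_orbit (vector_field m1 m2 \<alpha> \<alpha> n a b \<epsilon>) (Omega m1 m2 \<alpha> \<alpha>) \<gamma> \<and> \<gamma> \<subseteq> V \<longrightarrow>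
         polar_orbit m \<alpha> n \<epsilon> a b \<rho> e \<gamma>)"
    proof (rule exI[of _ "(e1, e2)"], unfold fst_conv snd_conv, intro conjI allI impI e(3,4))
      fix \<gamma> assume \<gamma>: "periodic_orbit (vector_field m1 m2 \<alpha> \<alpha> n a b \<epsilon>) (Omega m1 m2 \<alpha> \<alpha>) \<gamma> \<and> \<gamma> \<subseteq> V"
      then obtain z T where z: "\<And>t. (z has_vector_derivative vector_field m1 m2 \<alpha> \<alpha> n a b \<epsilon> (z t)) (at t)"
        and T: "T > 0" "\<And>t. z (t + T) = z t" and nc: "\<not> z constant_on UNIV" and \<gamma>z: "\<gamma> = range z"
        unfolding periodic_orbit_def is_solution_def by blast
      define x where "x t = fst (z t)" for t
      define y where "y t = snd (z t)" for t
      have zxy: "z t = (x t, y t)" for t by (simp add: x_def y_def)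
      have zr: "(x t, y t) \<in> region \<alpha> R \<delta>" for t using \<gamma> \<gamma>z R(4) zxy by (metis range_subsetD subset_trans)
      have xd: "(x has_real_derivative y t + \<epsilon> * ?A (x t) (y t)) (at t)"
        and yd: "(y has_real_derivative - x t + \<epsilon> * ?B (x t) (y t)) (at t)" for t
        unfolding has_real_derivative_iff_has_vector_derivative
        using bounded_linear.has_vector_derivative[OF bounded_linear_fst z[of t]]
          bounded_linear.has_vector_derivative[OF bounded_linear_snd z[of t]]
        unfolding zxy vector_field_perturbation[OF m] x_def[symmetric, abs_def] y_def[symmetric, abs_def] by simp_all
      have nzx: "1 - \<alpha> * x t \<noteq> 0" for t using zr[of t] R(1) by (auto simp: region_def)
      have left: "1 - \<alpha> * x t > 0" for t
      proof (rule orbit_left_of_line[OF xd yd nzx _ T(1)])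
        fix t
        have "\<bar>\<alpha> * (\<epsilon> * ?B (x t) (y t))\<bar> = \<bar>\<alpha>\<bar> * (\<bar>\<epsilon>\<bar> * \<bar>?B (x t) (y t)\<bar>)" by (simp add: abs_mult)
        also have "\<dots> \<le> \<bar>\<alpha>\<bar> * (\<bar>\<epsilon>\<bar> * L)" by (intro mult_left_mono LB zr) auto
        finally show "\<bar>\<alpha> * (\<epsilon> * ?B (x t) (y t))\<bar> \<le> 1" using \<epsilon>(4) by linarith
      next
        show "y T = y 0" using T(2)[of 0] by (simp add: y_def)
      qed
      have right: "\<alpha> * x t \<le> 1 - \<delta>" for t using left[of t] zr[of t] by (auto simp: region_def)
      define X where "X t = x t - e1" for t
      define Y where "Y t = y t - e2" for t
      define p where "p t = ?A (x t) (y t) - ?A e1 e2" for t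
      define q where "q t = ?B (x t) (y t) - ?B e1 e2" for t
      have cxy: "continuous_on UNIV x" "continuous_on UNIV y"
        using xd yd by (auto intro!: DERIV_continuous_on[of UNIV])
      have ccont: "continuous_on UNIV (\<lambda>t. perturbation m \<alpha> n c (x t) (y t))" for c
        unfolding perturbation_def case_prod_beta by (intro continuous_intros cxy) (use nzx in auto)
      have "\<exists>t0. (X t0, Y t0) \<noteq> (0, 0)"
      proof (rule ccontr)
        assume "\<not> ?thesis"
        then have "z t = (e1, e2)" for t by (auto simp: zxy X_def Y_def)
        then show False using nc by (auto simp: constant_on_def)
      qed
      then obtain t0 where t0: "(X t0, Y t0) \<noteq> (0, 0)" by blast
      have Xd: "(X has_real_derivative Y t + \<epsilon> * p t) (at t)" for t
      proof -
        have "(X has_real_derivative y t + \<epsilon> * ?A (x t) (y t) - 0) (at t)"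
          unfolding X_def by (intro DERIV_diff xd DERIV_const)
        moreover have "Y t + \<epsilon> * p t = y t - e2 + \<epsilon> * ?A (x t) (y t) - \<epsilon> * ?A e1 e2" by (simp add: Y_def p_def algebra_simps)
        moreover have "\<epsilon> * ?A e1 e2 = - e2" using e(2) by (metis minus_minus mult_minus_left)
        ultimately show ?thesis by simp
      qed
      have Yd: "(Y has_real_derivative - X t + \<epsilon> * q t) (at t)" for t
      proof -
        have "(Y has_real_derivative - x t + \<epsilon> * ?B (x t) (y t) - 0) (at t)"
          unfolding Y_def by (intro DERIV_diff yd DERIV_const)
        moreover have "- X t + \<epsilon> * q t = - x t + e1 + \<epsilon> * ?B (x t) (y t) - \<epsilon> * ?B e1 e2" by (simp add: X_def q_def algebra_simps)
        moreover have "\<epsilon> * ?B e1 e2 = e1" by (rule e(1)[symmetric])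
        ultimately show ?thesis by simp
      qed
      have pL: "\<bar>p t\<bar> \<le> L * (\<bar>X t\<bar> + \<bar>Y t\<bar>)" for t
        unfolding p_def X_def Y_def by (rule LA(2)[OF _ zr e_in])
      have qL: "\<bar>q t\<bar> \<le> L * (\<bar>X t\<bar> + \<bar>Y t\<bar>)" for t
        unfolding q_def X_def Y_def by (rule LB(2)[OF _ zr e_in])
      have per: "x (t + T) = x t" "y (t + T) = y t" for t using T(2) by (simp_all add: x_def y_def)
      obtain g \<theta> k where g: "\<And>t. X t = g (\<theta> t) * sin (\<theta> t)" "\<And>t. Y t = g (\<theta> t) * cos (\<theta> t)" "surj \<theta>"
        "\<And>s. g s > 0" "k \<ge> (1::nat)" "\<And>s. g (s + 2 * pi * real k) = g s"
        "\<And>s t. s \<le> t \<Longrightarrow> g t \<le> g s * exp (8 * L * \<bar>\<epsilon>\<bar> * (t - s))"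
        "\<And>t. (g has_real_derivative \<epsilon> * (g (\<theta> t) * (sin (\<theta> t) * (p t / g (\<theta> t)) + cos (\<theta> t) * (q t / g (\<theta> t))) /
           (1 + \<epsilon> * (cos (\<theta> t) * (p t / g (\<theta> t)) - sin (\<theta> t) * (q t / g (\<theta> t)))))) (at (\<theta> t))"
      proof (rule orbit_polar_form[of X Y \<epsilon> p q L T t0])
        show "continuous_on UNIV p" "continuous_on UNIV q" unfolding p_def q_def by (intro continuous_intros ccont)+
        show "p (t + T) = p t" "q (t + T) = q t" "X (t + T) = X t" "Y (t + T) = Y t" for t
          by (simp_all add: p_def q_def X_def Y_def per)
      qed (use Xd Yd pL qL L(1) \<epsilon>(3) T(1) t0 in auto)
      have xg: "x t = e1 + g (\<theta> t) * sin (\<theta> t)" and yg: "y t = e2 + g (\<theta> t) * cos (\<theta> t)" for t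
        using g(1,2)[of t] by (simp_all add: X_def Y_def)
      have g_le: "g s \<le> \<rho>" for s
      proof -
        obtain s' where s': "s - 2 * pi \<le> s'" "s' \<le> s" "sin s' = sgn \<alpha>" using sin_eq_sgn_nearby[OF \<open>\<alpha> \<noteq> 0\<close>] by blast
        obtain t where t: "s' = \<theta> t" using g(3) by (metis surjD)
        have "\<alpha> * e1 + \<bar>\<alpha>\<bar> * g s' = \<alpha> * x t" using xg[of t] s'(3) by (simp add: t[symmetric] algebra_simps abs_sgn)
        then have "\<bar>\<alpha>\<bar> * g s' \<le> 1 - \<delta> - \<alpha> * e1" using right[of t] by simp
        also have "- (\<alpha> * e1) \<le> \<bar>\<alpha>\<bar> * (L * \<bar>\<epsilon>\<bar>)"
          using mult_left_mono[OF e(3), of "\<bar>\<alpha>\<bar>"] by (simp add: abs_mult[symmetric])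
        then have "1 - \<delta> - \<alpha> * e1 \<le> 1 - \<delta> + \<bar>\<alpha>\<bar> * L * \<bar>\<epsilon>\<bar>" by simp
        finally have s'_le: "\<bar>\<alpha>\<bar> * g s' \<le> 1 - \<delta> + \<bar>\<alpha>\<bar> * L * \<bar>\<epsilon>\<bar>" .
        have "g s \<le> g s' * exp (8 * L * \<bar>\<epsilon>\<bar> * (s - s'))" by (rule g(7)[OF s'(2)])
        also have "\<dots> \<le> g s' * exp (16 * pi * L * \<bar>\<epsilon>\<bar>)"
        proof -
          have "8 * L * \<bar>\<epsilon>\<bar> * (s - s') \<le> 8 * L * \<bar>\<epsilon>\<bar> * (2 * pi)" using s' L(1) by (intro mult_left_mono) auto
          then show ?thesis using g(4)[of s'] by (intro mult_left_mono) (auto simp: mult_ac)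
        qed
        finally have "\<bar>\<alpha>\<bar> * g s \<le> \<bar>\<alpha>\<bar> * (g s' * exp (16 * pi * L * \<bar>\<epsilon>\<bar>))" by (rule mult_left_mono) simp
        also have "\<dots> = (\<bar>\<alpha>\<bar> * g s') * exp (16 * pi * L * \<bar>\<epsilon>\<bar>)" by simp
        also have "\<dots> \<le> (1 - \<delta> + \<bar>\<alpha>\<bar> * L * \<bar>\<epsilon>\<bar>) * exp (16 * pi * L * \<bar>\<epsilon>\<bar>)" by (rule mult_right_mono[OF s'_le]) simp
        also have "\<dots> \<le> 1 - \<delta> / 2" using s0(2)[of "\<bar>\<epsilon>\<bar>"] \<epsilon>(1) by simp
        finally show ?thesis using \<open>\<alpha> \<noteq> 0\<close> by (simp add: \<rho>_def field_simps)
      qed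
      have "polar_solution m \<alpha> n \<epsilon> a b (e1, e2) \<rho> g"
        unfolding polar_solution_def
      proof (intro allI conjI)
        fix s
        show "g s \<noteq> 0" "\<bar>g s\<bar> \<le> \<rho>" using g(4)[of s] g_le[of s] by auto
        obtain t where t: "s = \<theta> t" using g(3) by (metis surjD)
        show "(g has_real_derivative \<epsilon> * polar_speed m \<alpha> n \<epsilon> a b (e1, e2) (g s) s) (at s)"
          using g(8)[of t] unfolding t polar_speed_def Let_def fst_conv snd_conv xg[symmetric] yg[symmetric] p_def q_def .
      qed
      moreover have "\<gamma> = range (\<lambda>t. (e1 + g t * sin t, e2 + g t * cos t))"
      proof -
        have "z = (\<lambda>t. (e1 + g t * sin t, e2 + g t * cos t)) \<circ> \<theta>" by (auto simp: zxy xg yg)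
        then have "\<gamma> = (\<lambda>t. (e1 + g t * sin t, e2 + g t * cos t)) ` range \<theta>" unfolding \<gamma>z by (simp add: image_comp)
        then show ?thesis using g(3) by simp
      qed
      ultimately show "polar_orbit m \<alpha> n \<epsilon> a b \<rho> (e1, e2) \<gamma>"
        unfolding polar_orbit_def fst_conv snd_conv
        using g(4,5,6) by blast
    qed
  qed
qed

section \<open>The bound on the number of limit cycles\<close>

text \<open>Half a turn changes the radius only by a multiple of \<epsilon>, so the two zeros
  \<open>g 0\<close> and \<open>- g pi\<close> of one orbit have opposite limits.\<close>

lemma (in polar_quotients) polar_drift:
  assumes "\<rho> \<le> r"
  obtains B where "B > 0" "\<And>\<epsilon> a b e g. (a, b) \<in> coeff_box n K \<Longrightarrow> B * \<bar>\<epsilon>\<bar> \<le> 1 \<Longrightarrow> e \<in> E \<Longrightarrow>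
    polar_solution m \<alpha> n \<epsilon> a b e \<rho> g \<Longrightarrow> \<bar>g pi - g 0\<bar> \<le> B * pi * \<bar>\<epsilon>\<bar>"
proof -
  obtain B where B: "B > 0" "\<And>a b \<epsilon> e. (a, b) \<in> coeff_box n K \<Longrightarrow> B * \<bar>\<epsilon>\<bar> \<le> 1 \<Longrightarrow> e \<in> E \<Longrightarrow>
    regular_on r {0..2 * pi} (polar_field \<epsilon> a b e) \<and>
    (\<forall>z\<in>cball 0 r. \<forall>t\<in>{0..2 * pi}. norm (polar_field \<epsilon> a b e z t) \<le> B)"
    using polar_field_bounded by blast
  show ?thesis
  proof (rule that[OF B(1)])
    fix \<epsilon> a b e g assume ab: "(a, b) \<in> coeff_box n K" and \<epsilon>: "B * \<bar>\<epsilon>\<bar> \<le> 1" and e: "e \<in> E"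
      and g: "polar_solution m \<alpha> n \<epsilon> a b e \<rho> g"
    have "norm (g pi - g 0) \<le> (\<bar>\<epsilon>\<bar> * B) * norm (pi - 0)"
    proof (rule field_differentiable_bound[of "{0..pi}" g "\<lambda>t. \<epsilon> * polar_speed m \<alpha> n \<epsilon> a b e (g t) t"])
      fix t assume t: "t \<in> {0..pi}"
      then have t2: "t \<in> {0..2 * pi}" using pi_gt_zero by auto
      show "(g has_real_derivative \<epsilon> * polar_speed m \<alpha> n \<epsilon> a b e (g t) t) (at t within {0..pi})"
        using g by (auto simp: polar_solution_def intro: has_field_derivative_at_within)
      have gt: "g t \<noteq> 0" "\<bar>g t\<bar> \<le> r" using g assms by (auto simp: polar_solution_def intro: order_trans)
      have "norm (polar_field \<epsilon> a b e (of_real (g t)) t) \<le> B" using B(2)[OF ab \<epsilon> e] t2 gt by auto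
      then have "\<bar>polar_speed m \<alpha> n \<epsilon> a b e (g t) t\<bar> \<le> B" unfolding polar_field_of_real[OF gt t2 e] by simp
      then show "norm (\<epsilon> * polar_speed m \<alpha> n \<epsilon> a b e (g t) t) \<le> \<bar>\<epsilon>\<bar> * B" by (simp add: abs_mult mult_left_mono)
    qed auto
    then show "\<bar>g pi - g 0\<bar> \<le> B * pi * \<bar>\<epsilon>\<bar>" by (simp add: mult_ac)
  qed
qed

lemma holomorphic_averaged:
  assumes "\<bar>\<alpha>\<bar> * r \<le> 1"
  shows "averaged m \<alpha> n a b holomorphic_on ball 0 r"
proof (rule power_series_holomorphic)
  fix w :: complex assume w: "w \<in> ball 0 r"
  have "norm (of_real \<alpha> * w) < 1"
  proof (cases "\<alpha> = 0")
    case False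
    have "\<bar>\<alpha>\<bar> * norm w < \<bar>\<alpha>\<bar> * r" using w False by (intro mult_strict_left_mono) auto
    then show ?thesis using assms by (simp add: norm_mult)
  qed auto
  then show "(\<lambda>N. of_real (averaged_series m \<alpha> n a b N) * (w - 0) ^ N) sums averaged m \<alpha> n a b w"
    using sums_averaged by simp
qed

text \<open>The two periods may be different numbers of turns; shifts by large common multiples
  bring every \<open>t\<close> into the range of agreement.\<close>

lemma eq_of_eventually_eq_periodic:
  fixes g h :: "real \<Rightarrow> 'a"
  assumes eq: "\<And>t. t \<ge> c \<Longrightarrow> g t = h t" and "k \<ge> (1::nat)" "l \<ge> (1::nat)" and "p > 0"
    and g: "\<And>t. g (t + p * real k) = g t" and h: "\<And>t. h (t + p * real l) = h t"
  shows "g = h"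
proof
  fix t
  have shift: "f (t + p * real j * real N) = f t" if "\<And>t. f (t + p * real j) = f t" for f :: "real \<Rightarrow> 'a" and j N
  proof (induction N)
    case (Suc N)
    have "t + p * real j * real (Suc N) = (t + p * real j * real N) + p * real j" by (simp add: algebra_simps)
    then show ?case using that[of "t + p * real j * real N"] Suc.IH by metis
  qed simp
  have "p * real k * real l > 0" using assms by auto
  then obtain N :: nat where "real N * (p * real k * real l) > c - t" using reals_Archimedean3 by blast
  then have "t + p * real k * real (l * N) \<ge> c" by (simp add: algebra_simps)
  then have "g (t + p * real k * real (l * N)) = h (t + p * real l * real (k * N))" using eq by (simp add: mult_ac)
  then show "g t = h t" unfolding shift[of g, OF g] shift[of h, OF h] .
qed

lemma finite_family_convergent_subsequence:
  fixes z :: "nat \<Rightarrow> 'i \<Rightarrow> real"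
  assumes "finite I" "\<And>k i. i \<in> I \<Longrightarrow> z k i \<in> {l..u}"
  shows "\<exists>s \<zeta>. strict_mono (s :: nat \<Rightarrow> nat) \<and> (\<forall>i\<in>I. (\<lambda>k. z (s k) i) \<longlonglongrightarrow> \<zeta> i)"
  using assms
proof (induction I rule: finite_induct)
  case empty
  then show ?case by (auto intro: strict_mono_id[unfolded id_def])
next
  case (insert a I)
  then obtain s \<zeta> where s: "strict_mono (s :: nat \<Rightarrow> nat)" "\<forall>i\<in>I. (\<lambda>k. z (s k) i) \<longlonglongrightarrow> \<zeta> i" by auto
  obtain x s' where s': "strict_mono (s' :: nat \<Rightarrow> nat)" "((\<lambda>k. z (s k) a) \<circ> s') \<longlonglongrightarrow> x"
    using compact_Icc[of l u] insert.prems unfolding compact_def by (metis insertI1)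
  have "(\<lambda>k. z ((s \<circ> s') k) i) \<longlonglongrightarrow> (\<zeta>(a := x)) i" if "i \<in> insert a I" for i
  proof (cases "i = a")
    case True
    then show ?thesis using s'(2) by (simp add: o_def)
  next
    case False
    then show ?thesis using LIMSEQ_subseq_LIMSEQ[OF _ s'(1), of "\<lambda>k. z (s k) i" "\<zeta> i"] s(2) that by (simp add: o_def)
  qed
  moreover have "strict_mono (s \<circ> s')" using s(1) s'(1) by (rule strict_mono_o)
  ultimately show ?case by blast
qed

lemma many_distinct_elements:
  assumes "\<not> (finite S \<and> card S \<le> n)"
  obtains f :: "nat \<Rightarrow> 'a" where "inj_on f {..n}" "\<And>i. i \<le> n \<Longrightarrow> f i \<in> S"
proof -
  obtain T where T: "T \<subseteq> S" "finite T" "card T = Suc n"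
  proof (cases "finite S")
    case True
    then have "Suc n \<le> card S" using assms by auto
    from obtain_subset_with_card_n[OF this] show ?thesis using that by blast
  next
    case False
    from infinite_arbitrarily_large[OF this, of "Suc n"] show ?thesis using that by blast
  qed
  obtain f where "bij_betw f {0..<card T} T" using ex_bij_betw_nat_finite[OF T(2)] by blast
  then have f: "bij_betw f {..n} T" by (simp add: T(3) atLeast0LessThan lessThan_Suc_atMost)
  show ?thesis
  proof (rule that)
    show "inj_on f {..n}" using f by (rule bij_betw_imp_inj_on)
    show "f i \<in> S" if "i \<le> n" for i using bij_betwE[OF f] T(1) that by auto
  qed
qed

theorem theorem2p2:
  fixes m1 m2 n :: nat and \<alpha>1 \<alpha>2 K :: real
    and V :: "(real \<times> real) set" and D :: "(coeffs \<times> coeffs) set"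
  assumes "m1 > 0" and "m2 > 0"
    and "\<alpha>1 * \<alpha>2 \<noteq> 0" and "\<alpha>1 = \<alpha>2"
    and "K > 0"
    and "compact V" and "V \<subseteq> Omega m1 m2 \<alpha>1 \<alpha>2"
    and "compact D" and "D \<subseteq> coeff_box n K"
    and "\<forall>(a, b)\<in>D. \<exists>h. 0 \<le> h \<and> h < H0 \<alpha>1 \<alpha>2 \<and> melnikov m1 m2 \<alpha>1 \<alpha>2 n a b h \<noteq> 0"
  shows "\<exists>\<epsilon>0>0. \<forall>\<epsilon>. 0 < \<bar>\<epsilon>\<bar> \<and> \<bar>\<epsilon>\<bar> < \<epsilon>0 \<longrightarrow> (\<forall>(a, b)\<in>D.
           finite {\<gamma>. limit_cycle (vector_field m1 m2 \<alpha>1 \<alpha>2 n a b \<epsilon>) (Omega m1 m2 \<alpha>1 \<alpha>2) \<gamma> \<and> \<gamma> \<subseteq> V} \<and>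
           card {\<gamma>. limit_cycle (vector_field m1 m2 \<alpha>1 \<alpha>2 n a b \<epsilon>) (Omega m1 m2 \<alpha>1 \<alpha>2) \<gamma> \<and> \<gamma> \<subseteq> V} \<le> n)"
proof (rule ccontr)
  assume contra: "\<not> ?thesis"
  define \<alpha> where "\<alpha> = \<alpha>1"
  have \<alpha>: "\<alpha>1 = \<alpha>" "\<alpha>2 = \<alpha>" "\<alpha> \<noteq> 0" using assms(3,4) by (auto simp: \<alpha>_def)
  define m where "m = m1 + m2 - 1"
  have m: "m1 + m2 = Suc m" using assms(1) by (simp add: m_def)
  let ?vf = "\<lambda>a b \<epsilon>. vector_field m1 m2 \<alpha> \<alpha> n a b \<epsilon>" and ?\<Omega> = "Omega m1 m2 \<alpha> \<alpha>"
  let ?S = "\<lambda>a b \<epsilon>. {\<gamma>. limit_cycle (?vf a b \<epsilon>) ?\<Omega> \<gamma> \<and> \<gamma> \<subseteq> V}"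
  let ?curve = "\<lambda>e g. range (\<lambda>t. (fst e + g t * sin t, snd e + g t * cos t))"
  obtain \<delta>0 \<rho> C0 where polar: "\<delta>0 > 0" "0 < \<rho>" "\<bar>\<alpha>\<bar> * \<rho> < 1" "C0 > 0"
    "\<And>\<epsilon> a b. \<bar>\<epsilon>\<bar> < \<delta>0 \<Longrightarrow> (a, b) \<in> coeff_box n K \<Longrightarrow> \<exists>e. \<bar>fst e\<bar> \<le> C0 * \<bar>\<epsilon>\<bar> \<and> \<bar>snd e\<bar> \<le> C0 * \<bar>\<epsilon>\<bar> \<and>
       (\<forall>\<gamma>. periodic_orbit (?vf a b \<epsilon>) ?\<Omega> \<gamma> \<and> \<gamma> \<subseteq> V \<longrightarrow>
         polar_orbit m \<alpha> n \<epsilon> a b \<rho> e \<gamma>)"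
    by (rule periodic_orbits_polar[OF \<alpha>(3) m assms(6) assms(7)[unfolded \<alpha>], where n = n and K = K]) (rule that; assumption)
  \<comment> \<open>A fifth of the gap between \<rho> and 1/|\<alpha>|. The radii \<open>rz\<close>,
    \<open>r1\<close>, \<open>r\<close> lie one, two and three such steps beyond \<rho>; a
    displacement of the centre by \<eta> takes the fourth, and one step is left.\<close>
  define \<eta> where "\<eta> = (1 / \<bar>\<alpha>\<bar> - \<rho>) / 5"
  have \<eta>_pos: "\<eta> > 0" "1 / \<bar>\<alpha>\<bar> = \<rho> + 5 * \<eta>" using polar(3) \<alpha>(3) by (auto simp: \<eta>_def field_simps)
  have \<alpha>\<eta>: "\<bar>\<alpha>\<bar> * (\<rho> + 5 * \<eta>) = 1" using \<alpha>(3) unfolding \<eta>_pos(2)[symmetric] by simp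
  define rz where "rz = \<rho> + \<eta>"
  define r1 where "r1 = \<rho> + 2 * \<eta>"
  define r where "r = \<rho> + 3 * \<eta>"
  have radii: "\<rho> < rz" "rz < r1" "\<rho> < r1" "r1 < r" "\<rho> \<le> r" "0 < r" "0 < r1" "rz \<le> r"
    using \<eta>_pos polar(2) by (auto simp: rz_def r1_def r_def)
  have "\<bar>\<alpha>\<bar> * (\<eta> + r) < \<bar>\<alpha>\<bar> * (\<rho> + 5 * \<eta>)" using \<eta>_pos(1) \<alpha>(3) by (intro mult_strict_left_mono) (auto simp: r_def)
  then have "\<bar>\<alpha>\<bar> * (\<eta> + r) < 1" using \<alpha>\<eta> by simp
  then obtain q where "polar_quotients m \<alpha> r \<eta> q"
    using polar_quotients_exist[of r \<eta> \<alpha> m] radii \<eta>_pos(1) by auto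
  then interpret polar_quotients m n \<alpha> r \<eta> q .
  obtain \<delta> C where disp: "\<delta> > 0"
    "\<And>\<epsilon> a b e. 0 < \<bar>\<epsilon>\<bar> \<Longrightarrow> \<bar>\<epsilon>\<bar> < \<delta> \<Longrightarrow> (a, b) \<in> coeff_box n K \<Longrightarrow> e \<in> E \<Longrightarrow>
       continuous_on (cball 0 r \<times> {0..2 * pi}) (\<lambda>(z, t). polar_field \<epsilon> a b e z t)"
    "\<And>\<epsilon> a b e. 0 < \<bar>\<epsilon>\<bar> \<Longrightarrow> \<bar>\<epsilon>\<bar> < \<delta> \<Longrightarrow> (a, b) \<in> coeff_box n K \<Longrightarrow> e \<in> E \<Longrightarrow>
       \<exists>G. G holomorphic_on ball 0 r1 \<and>
         (\<forall>z\<in>ball 0 r1. norm (G z - integral {0..2 * pi} (polar_field \<epsilon> a b e z)) \<le> C * \<bar>\<epsilon>\<bar>) \<and>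
         (\<forall>g k. polar_solution m \<alpha> n \<epsilon> a b e \<rho> g \<longrightarrow> k \<ge> (1::nat) \<longrightarrow> g (2 * pi * real k) = g 0 \<longrightarrow> G (of_real (g 0)) = 0)"
    "\<And>\<epsilon> a b e g h t. 0 < \<bar>\<epsilon>\<bar> \<Longrightarrow> \<bar>\<epsilon>\<bar> < \<delta> \<Longrightarrow> (a, b) \<in> coeff_box n K \<Longrightarrow> e \<in> E \<Longrightarrow>
       polar_solution m \<alpha> n \<epsilon> a b e \<rho> g \<Longrightarrow> polar_solution m \<alpha> n \<epsilon> a b e \<rho> h \<Longrightarrow> g 0 = h 0 \<Longrightarrow> 0 \<le> t \<Longrightarrow> g t = h t"
    by (rule polar_displacement[OF polar(2) radii(3,4), of K]) (rule that; assumption)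
  obtain B where drift: "B > 0" "\<And>\<epsilon> a b e g. (a, b) \<in> coeff_box n K \<Longrightarrow> B * \<bar>\<epsilon>\<bar> \<le> 1 \<Longrightarrow> e \<in> E \<Longrightarrow>
    polar_solution m \<alpha> n \<epsilon> a b e \<rho> g \<Longrightarrow> \<bar>g pi - g 0\<bar> \<le> B * pi * \<bar>\<epsilon>\<bar>"
    by (rule polar_drift[OF radii(5), of K]) (rule that; assumption)
  define \<mu> where "\<mu> = min \<delta>0 (min \<delta> (min (\<eta> / C0) (1 / B)))"
  have \<mu>: "\<mu> > 0" using polar(1,4) disp(1) drift(1) \<eta>_pos(1) by (simp add: \<mu>_def)
  \<comment> \<open>All data for one \<epsilon> below \<mu> / (k + 1) are packed into a single
    predicate, so that they can be chosen together for every \<open>k\<close>.\<close>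
  define P where "P k \<epsilon> a b e G g \<longleftrightarrow> 0 < \<bar>\<epsilon>\<bar> \<and> \<bar>\<epsilon>\<bar> < \<mu> / real (Suc k) \<and> (a, b) \<in> D \<and> e \<in> E \<and>
      \<bar>fst e\<bar> \<le> C0 * \<bar>\<epsilon>\<bar> \<and> \<bar>snd e\<bar> \<le> C0 * \<bar>\<epsilon>\<bar> \<and> G holomorphic_on ball 0 r1 \<and>
      continuous_on (cball 0 r \<times> {0..2 * pi}) (\<lambda>(z, t). polar_field \<epsilon> a b e z t) \<and>
      (\<forall>z\<in>ball 0 r1. norm (G z - integral {0..2 * pi} (polar_field \<epsilon> a b e z)) \<le> C * \<bar>\<epsilon>\<bar>) \<and>
      (\<forall>i\<le>n. 0 < g i 0 \<and> g i 0 \<le> \<rho> \<and> 0 < g i pi \<and> g i pi \<le> \<rho> \<and> \<bar>g i pi - g i 0\<bar> \<le> B * pi * \<bar>\<epsilon>\<bar> \<and>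
         G (of_real (g i 0)) = 0 \<and> G (of_real (- g i pi)) = 0) \<and>
      inj_on (\<lambda>i. g i 0) {..n} \<and> inj_on (\<lambda>i. g i pi) {..n}"
    for k :: nat and \<epsilon> a b e G and g :: "nat \<Rightarrow> real \<Rightarrow> real"
  have "\<exists>\<epsilon> a b e G g. P k \<epsilon> a b e G g" for k
  proof -
    have "\<mu> / real (Suc k) > 0" using \<mu> by simp
    then obtain \<epsilon> a b where \<epsilon>: "0 < \<bar>\<epsilon>\<bar>" "\<bar>\<epsilon>\<bar> < \<mu> / real (Suc k)" and ab: "(a, b) \<in> D"
      and many: "\<not> (finite (?S a b \<epsilon>) \<and> card (?S a b \<epsilon>) \<le> n)"
      using contra unfolding \<alpha> by blast
    have box: "(a, b) \<in> coeff_box n K" using ab assms(9) by blast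
    have "\<mu> / real (Suc k) \<le> \<mu>" using \<mu> by (simp add: field_simps)
    then have "\<bar>\<epsilon>\<bar> < \<mu>" using \<epsilon>(2) by linarith
    then have lt: "\<bar>\<epsilon>\<bar> < \<delta>0" "\<bar>\<epsilon>\<bar> < \<delta>" "\<bar>\<epsilon>\<bar> < \<eta> / C0" "\<bar>\<epsilon>\<bar> < 1 / B" by (auto simp: \<mu>_def)
    have C0\<epsilon>: "C0 * \<bar>\<epsilon>\<bar> \<le> \<eta>" and B\<epsilon>: "B * \<bar>\<epsilon>\<bar> \<le> 1" using lt(3,4) polar(4) drift(1) by (auto simp: field_simps)
    obtain e where e: "\<bar>fst e\<bar> \<le> C0 * \<bar>\<epsilon>\<bar>" "\<bar>snd e\<bar> \<le> C0 * \<bar>\<epsilon>\<bar>"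
       "\<And>\<gamma>. periodic_orbit (?vf a b \<epsilon>) ?\<Omega> \<gamma> \<Longrightarrow> \<gamma> \<subseteq> V \<Longrightarrow>
         polar_orbit m \<alpha> n \<epsilon> a b \<rho> e \<gamma>"
      using polar(5)[OF lt(1) box] by blast
    have eE: "e \<in> E" using e(1,2) C0\<epsilon> by (cases e) auto
    obtain G where G: "G holomorphic_on ball 0 r1"
      "\<And>z. z \<in> ball 0 r1 \<Longrightarrow> norm (G z - integral {0..2 * pi} (polar_field \<epsilon> a b e z)) \<le> C * \<bar>\<epsilon>\<bar>"
      "\<And>g k. polar_solution m \<alpha> n \<epsilon> a b e \<rho> g \<Longrightarrow> k \<ge> (1::nat) \<Longrightarrow> g (2 * pi * real k) = g 0 \<Longrightarrow> G (of_real (g 0)) = 0"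
      using disp(3)[OF \<epsilon>(1) lt(2) box eE] by blast
    obtain \<gamma> where \<gamma>: "inj_on \<gamma> {..n}" "\<And>i. i \<le> n \<Longrightarrow> \<gamma> i \<in> ?S a b \<epsilon>"
      using many_distinct_elements[OF many] by blast
    define W where "W i g k \<longleftrightarrow> k \<ge> (1::nat) \<and> polar_solution m \<alpha> n \<epsilon> a b e \<rho> g \<and> (\<forall>t. g t > 0) \<and>
      (\<forall>t. g (t + 2 * pi * real k) = g t) \<and> \<gamma> i = ?curve e g" for i g k
    have "\<exists>g k. W i g k" if "i \<le> n" for i
    proof -
      have "polar_orbit m \<alpha> n \<epsilon> a b \<rho> e (\<gamma> i)"
        using \<gamma>(2)[OF that] by (intro e(3)) (auto simp: limit_cycle_def)
      then show ?thesis by (simp only: W_def polar_orbit_def)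
    qed
    then obtain g l where "\<And>i. i \<le> n \<Longrightarrow> W i (g i) (l i)" by metis
    then have g: "\<And>i. i \<le> n \<Longrightarrow> l i \<ge> (1::nat)" "\<And>i. i \<le> n \<Longrightarrow> polar_solution m \<alpha> n \<epsilon> a b e \<rho> (g i)"
      "\<And>i t. i \<le> n \<Longrightarrow> g i t > 0" "\<And>i t. i \<le> n \<Longrightarrow> g i (t + 2 * pi * real (l i)) = g i t" "\<And>i. i \<le> n \<Longrightarrow> \<gamma> i = ?curve e (g i)"
      unfolding W_def by blast+
    \<comment> \<open>Solutions that agree from some angle on trace the same curve. By forward
      uniqueness, different orbits therefore have different radii at angle 0, and also at angle
      \<pi>.\<close>
    have distinct: "i = j" if "i \<le> n" "j \<le> n" "\<And>t. t \<ge> c \<Longrightarrow> g i t = g j t" for i j c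
    proof -
      have "g i = g j"
        by (rule eq_of_eventually_eq_periodic[where p = "2 * pi", OF that(3) g(1)[OF that(1)] g(1)[OF that(2)]]) (use g(4) that in auto)
      then show ?thesis using g(5) \<gamma>(1) that by (auto simp: inj_on_def)
    qed
    have "P k \<epsilon> a b e G g"
      unfolding P_def
    proof (intro conjI allI impI ballI \<epsilon> ab eE e(1,2) G(1,2) disp(2)[OF \<epsilon>(1) lt(2) box eE])
      fix i assume i: "i \<le> n"
      show "0 < g i 0" "0 < g i pi" using g(3)[OF i] by auto
      show "g i 0 \<le> \<rho>" "g i pi \<le> \<rho>" using g(2)[OF i] by (auto simp: polar_solution_def abs_le_iff)
      show "\<bar>g i pi - g i 0\<bar> \<le> B * pi * \<bar>\<epsilon>\<bar>" by (rule drift(2)[OF box B\<epsilon> eE g(2)[OF i]])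
      show "G (of_real (g i 0)) = 0" using g(4)[OF i, of 0] by (intro G(3)[OF g(2)[OF i] g(1)[OF i]]) simp
      show "G (of_real (- g i pi)) = 0"
        using G(3)[OF polar_solution_opposite[OF g(2)[OF i]] g(1)[OF i]] g(4)[OF i, of pi] by (simp add: add.commute)
    next
      show "inj_on (\<lambda>i. g i 0) {..n}"
      proof (rule inj_onI)
        fix i j assume ij: "i \<in> {..n}" "j \<in> {..n}" "g i 0 = g j 0"
        then have "i \<le> n" "j \<le> n" by auto
        have "g i t = g j t" if "0 \<le> t" for t
          by (rule disp(4)[OF \<epsilon>(1) lt(2) box eE g(2)[OF \<open>i \<le> n\<close>] g(2)[OF \<open>j \<le> n\<close>] ij(3) that])
        then show "i = j" by (rule distinct[OF \<open>i \<le> n\<close> \<open>j \<le> n\<close>])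
      qed
      show "inj_on (\<lambda>i. g i pi) {..n}"
      proof (rule inj_onI)
        fix i j assume ij: "i \<in> {..n}" "j \<in> {..n}" "g i pi = g j pi"
        then have "i \<le> n" "j \<le> n" by auto
        have eq: "- g i (t + pi) = - g j (t + pi)" if "0 \<le> t" for t
          by (rule disp(4)[OF \<epsilon>(1) lt(2) box eE polar_solution_opposite[OF g(2)[OF \<open>i \<le> n\<close>]]
              polar_solution_opposite[OF g(2)[OF \<open>j \<le> n\<close>]] _ that]) (simp add: ij(3))
        have "g i t = g j t" if "pi \<le> t" for t using eq[of "t - pi"] that by simp
        then show "i = j" by (rule distinct[OF \<open>i \<le> n\<close> \<open>j \<le> n\<close>])
      qed
    qed
    then show ?thesis by blast
  qed
  then obtain \<epsilon> a b e G g where P: "\<And>k. P k (\<epsilon> k) (a k) (b k) (e k) (G k) (g k)" by metis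
  have P\<epsilon>: "\<bar>\<epsilon> k\<bar> < \<mu> / real (Suc k)" and PD: "(a k, b k) \<in> D" and PE: "e k \<in> E"
    and Pe: "\<bar>fst (e k)\<bar> \<le> C0 * \<bar>\<epsilon> k\<bar>" "\<bar>snd (e k)\<bar> \<le> C0 * \<bar>\<epsilon> k\<bar>"
    and PG: "G k holomorphic_on ball 0 r1"
      "continuous_on (cball 0 r \<times> {0..2 * pi}) (\<lambda>(z, t). polar_field (\<epsilon> k) (a k) (b k) (e k) z t)"
      "\<And>z. z \<in> ball 0 r1 \<Longrightarrow> norm (G k z - integral {0..2 * pi} (polar_field (\<epsilon> k) (a k) (b k) (e k) z)) \<le> C * \<bar>\<epsilon> k\<bar>"
    and Pg: "\<And>i. i \<le> n \<Longrightarrow> 0 < g k i 0" "\<And>i. i \<le> n \<Longrightarrow> g k i 0 \<le> \<rho>" "\<And>i. i \<le> n \<Longrightarrow> 0 < g k i pi" "\<And>i. i \<le> n \<Longrightarrow> g k i pi \<le> \<rho>"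
      "\<And>i. i \<le> n \<Longrightarrow> \<bar>g k i pi - g k i 0\<bar> \<le> B * pi * \<bar>\<epsilon> k\<bar>"
      "\<And>i. i \<le> n \<Longrightarrow> G k (of_real (g k i 0)) = 0" "\<And>i. i \<le> n \<Longrightarrow> G k (of_real (- g k i pi)) = 0"
    and Pinj: "inj_on (\<lambda>i. g k i 0) {..n}" "inj_on (\<lambda>i. g k i pi) {..n}" for k
    using P[of k] unfolding P_def by blast+
  obtain ab0 s1 where s1: "ab0 \<in> D" "strict_mono (s1 :: nat \<Rightarrow> nat)" "((\<lambda>k. (a k, b k)) \<circ> s1) \<longlonglongrightarrow> ab0"
    by (rule seq_compactE[OF compact_imp_seq_compact[OF assms(8)], of "\<lambda>k. (a k, b k)"]) (use PD in auto)
  obtain a0 b0 where ab0: "ab0 = (a0, b0)" by (cases ab0)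
  have "g (s1 k) i 0 \<in> {0..\<rho>}" if "i \<in> {..n}" for k i using Pg(1,2)[of i "s1 k"] that by simp
  then have "\<exists>s \<zeta>. strict_mono (s :: nat \<Rightarrow> nat) \<and> (\<forall>i\<in>{..n}. (\<lambda>k. g (s1 (s k)) i 0) \<longlonglongrightarrow> \<zeta> i)"
    by (intro finite_family_convergent_subsequence) auto
  then obtain s2 x where s2': "strict_mono (s2 :: nat \<Rightarrow> nat)" "\<forall>i\<in>{..n}. (\<lambda>k. g (s1 (s2 k)) i 0) \<longlonglongrightarrow> x i" by blast
  then have s2: "strict_mono s2" "\<And>i. i \<le> n \<Longrightarrow> (\<lambda>k. g (s1 (s2 k)) i 0) \<longlonglongrightarrow> x i" by simp_all
  define s where "s k = s1 (s2 k)" for k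
  have s: "strict_mono s" using strict_mono_o[OF s1(2) s2(1)] by (simp add: s_def[abs_def] o_def)
  have \<epsilon>_lim: "(\<lambda>k. \<epsilon> (s k)) \<longlonglongrightarrow> 0"
  proof (rule Lim_null_comparison)
    have "norm (\<epsilon> (s k)) \<le> \<mu> * inverse (real (Suc k))" for k
    proof -
      have "norm (\<epsilon> (s k)) \<le> \<mu> * inverse (real (Suc (s k)))" using P\<epsilon>[of "s k"] by (simp add: divide_inverse)
      also have "\<dots> \<le> \<mu> * inverse (real (Suc k))"
        using strict_mono_imp_increasing[OF s, of k] \<mu> by (intro mult_left_mono le_imp_inverse_le) auto
      finally show ?thesis .
    qed
    then show "eventually (\<lambda>k. norm (\<epsilon> (s k)) \<le> \<mu> * inverse (real (Suc k))) sequentially" by (rule always_eventually[OF allI])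
    show "(\<lambda>k. \<mu> * inverse (real (Suc k))) \<longlonglongrightarrow> 0"
      using tendsto_mult_left[OF LIMSEQ_inverse_real_of_nat, of \<mu>] by simp
  qed
  have abs_\<epsilon>: "(\<lambda>k. c * \<bar>\<epsilon> (s k)\<bar>) \<longlonglongrightarrow> 0" for c
    using tendsto_mult_left[OF tendsto_rabs[OF \<epsilon>_lim], of c] by simp
  have e_lim: "(\<lambda>k. e (s k)) \<longlonglongrightarrow> (0, 0)"
  proof -
    have "(\<lambda>k. fst (e (s k))) \<longlonglongrightarrow> 0" "(\<lambda>k. snd (e (s k))) \<longlonglongrightarrow> 0"
      by (rule Lim_null_comparison[OF always_eventually[OF allI] abs_\<epsilon>[of C0]], use Pe in simp)+
    from tendsto_Pair[OF this] show ?thesis by simp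
  qed
  have "(\<lambda>k. (a (s k), b (s k))) \<longlonglongrightarrow> (a0, b0)"
    using LIMSEQ_subseq_LIMSEQ[OF s1(3) s2(1)] by (simp add: o_def ab0 s_def)
  from tendsto_fst[OF this] tendsto_snd[OF this]
  have ab_lim: "(\<lambda>k. a (s k)) \<longlonglongrightarrow> a0" "(\<lambda>k. b (s k)) \<longlonglongrightarrow> b0" by simp_all
  have coord: "(\<lambda>k. c k i j) \<longlonglongrightarrow> c0 i j" if "c \<longlonglongrightarrow> c0" for c and c0 :: coeffs and i j
  proof -
    have "(\<lambda>k. c k i) \<longlonglongrightarrow> c0 i"
      by (rule continuous_on_tendsto_compose[OF continuous_on_product_coordinates[of i] that]) simp_all
    then show ?thesis
      by (rule continuous_on_tendsto_compose[OF continuous_on_product_coordinates[of j]]) simp_all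
  qed
  have box0: "(a0, b0) \<in> coeff_box n K" using s1(1) ab0 assms(9) by auto
  let ?h = "averaged m \<alpha> n a0 b0"
  have cont0: "continuous_on (cball 0 r \<times> {0..2 * pi}) (\<lambda>(z, t). polar_field 0 a0 b0 (0, 0) z t)"
  proof (rule polar_field_bounded[of K])
    fix B assume "\<And>a b \<epsilon> e. (a, b) \<in> coeff_box n K \<Longrightarrow> B * \<bar>\<epsilon>\<bar> \<le> 1 \<Longrightarrow> e \<in> E \<Longrightarrow>
      regular_on r {0..2 * pi} (polar_field \<epsilon> a b e) \<and>
      (\<forall>z\<in>cball 0 r. \<forall>t\<in>{0..2 * pi}. norm (polar_field \<epsilon> a b e z t) \<le> B)"
    from this[OF box0, of 0 "(0, 0)"] show ?thesis using \<eta>_pos(1) by (simp add: regular_on_def)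
  qed
  \<comment> \<open>The integral of the \<open>k\<close>-th polar field over a period stands in
    between: \<open>G\<close> differs from it by a multiple of \<epsilon>, and it tends to
    \<open>averaged\<close> because the fields converge uniformly.\<close>
  have unif: "uniform_limit (cball 0 rz) (\<lambda>k. G (s k)) ?h sequentially"
  proof (rule uniform_limitI)
    fix d :: real assume d: "d > 0"
    have lim: "uniform_limit (cball 0 r \<times> {0..2 * pi}) (\<lambda>k (z, t). polar_field (\<epsilon> (s k)) (a (s k)) (b (s k)) (e (s k)) z t)
      (\<lambda>(z, t). polar_field 0 a0 b0 (0, 0) z t) sequentially"
      by (rule polar_field_uniform_limit[OF coord[OF ab_lim(1)] coord[OF ab_lim(2)] e_lim PE \<epsilon>_lim])
    have "d / (8 * pi) > 0" using d by simp
    from uniform_limitD[OF lim this] order_tendstoD(2)[OF abs_\<epsilon>[of C] half_gt_zero[OF d]]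
    show "eventually (\<lambda>k. \<forall>z\<in>cball 0 rz. dist (G (s k) z) (?h z) < d) sequentially"
    proof eventually_elim
      case (elim k)
      show ?case
      proof
        fix z :: complex assume z: "z \<in> cball 0 rz"
        then have zr: "z \<in> cball 0 r" "z \<in> ball 0 r1" using radii by auto
        let ?F = "polar_field (\<epsilon> (s k)) (a (s k)) (b (s k)) (e (s k)) z" and ?Flim = "polar_field 0 a0 b0 (0, 0) z"
        have slice: "continuous_on {0..2 * pi} (f z)" if "continuous_on (cball 0 r \<times> {0..2 * pi}) (\<lambda>(z, t). f z t)" for f :: "complex \<Rightarrow> real \<Rightarrow> complex"
        proof -
          have "continuous_on {0..2 * pi} (\<lambda>t. (\<lambda>(z, t). f z t) (z, t))"
            by (rule continuous_on_compose2[OF that]) (use zr in \<open>auto intro!: continuous_intros\<close>)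
          then show ?thesis by simp
        qed
        have cF: "continuous_on {0..2 * pi} ?F" by (rule slice[OF PG(2)])
        have cF0: "continuous_on {0..2 * pi} ?Flim" by (rule slice[OF cont0])
        have "norm (integral {0..2 * pi} (\<lambda>t. ?F t - ?Flim t)) \<le> d / (8 * pi) * (2 * pi - 0)"
        proof (rule integral_bound)
          fix t assume "t \<in> {0..2 * pi}"
          then have "dist (?F t) (?Flim t) < d / (8 * pi)" using elim(1) zr by auto
          then show "norm (?F t - ?Flim t) \<le> d / (8 * pi)" by (simp add: dist_norm)
        qed (auto intro!: continuous_intros cF cF0)
        then have "norm (integral {0..2 * pi} ?F - ?h z) \<le> d / 4"
          unfolding integral_polar_field_0[OF zr(1), symmetric]
          by (subst (asm) Henstock_Kurzweil_Integration.integral_diff)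
             (auto intro: integrable_continuous_real cF cF0)
        moreover have "norm (G (s k) z - integral {0..2 * pi} ?F) \<le> C * \<bar>\<epsilon> (s k)\<bar>" by (rule PG(3)[OF zr(2)])
        ultimately show "dist (G (s k) z) (?h z) < d"
          using elim(2) norm_triangle_ineq[of "G (s k) z - integral {0..2 * pi} ?F" "integral {0..2 * pi} ?F - ?h z"] d
          by (simp add: dist_norm)
      qed
    qed
  qed
  \<comment> \<open>\<open>True\<close> marks the zero at the positive radius \<open>g 0\<close>,
    \<open>False\<close> the reflected one at \<open>- g pi\<close>. The signs keep all 2n + 2 zeros
    distinct for each \<open>k\<close>, although the limits \<plusminus> \<open>x i\<close> may
    coincide, for instance at 0.\<close>
  define zero where "zero k p = complex_of_real (if snd p then g (s k) (fst p) 0 else - g (s k) (fst p) pi)" for k and p :: "nat \<times> bool"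
  define \<zeta> where "\<zeta> p = complex_of_real (if snd p then x (fst p) else - x (fst p))" for p :: "nat \<times> bool"
  have "\<exists>Q. Q holomorphic_on ball 0 r1 \<and> (\<forall>w. ?h w = (\<Prod>p\<in>{..n} \<times> UNIV. w - \<zeta> p) * Q w)"
  proof (rule converging_zeros_factor[where H = "\<lambda>k. G (s k)" and z = zero and s = \<rho> and r = rz])
    have "\<bar>\<alpha>\<bar> * r1 \<le> \<bar>\<alpha>\<bar> * (\<rho> + 5 * \<eta>)" using \<eta>_pos(1) by (intro mult_left_mono) (auto simp: r1_def)
    then show "?h holomorphic_on ball 0 r1" using \<alpha>\<eta> by (intro holomorphic_averaged) simp
    show "G (s k) holomorphic_on ball 0 r1" for k by (rule PG(1))
    fix p :: "nat \<times> bool" assume "p \<in> {..n} \<times> UNIV"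
    then have i: "fst p \<le> n" by auto
    have x1: "(\<lambda>k. g (s k) (fst p) 0) \<longlonglongrightarrow> x (fst p)" using s2(2)[OF i] by (simp add: s_def)
    have "(\<lambda>k. g (s k) (fst p) pi - g (s k) (fst p) 0) \<longlonglongrightarrow> 0"
      by (rule Lim_null_comparison[OF always_eventually[OF allI] abs_\<epsilon>[of "B * pi"]]) (use Pg(5)[OF i] in simp)
    from tendsto_add[OF this x1] have x2: "(\<lambda>k. g (s k) (fst p) pi) \<longlonglongrightarrow> x (fst p)" by simp
    show "(\<lambda>k. zero k p) \<longlonglongrightarrow> \<zeta> p"
      unfolding zero_def \<zeta>_def by (cases "snd p") (auto intro!: tendsto_intros x1 x2)
    show "norm (zero k p) \<le> \<rho>" "G (s k) (zero k p) = 0" for k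
      unfolding zero_def using Pg[OF i, of "s k"] by (auto simp: less_imp_le)
  next
    fix k
    show "inj_on (zero k) ({..n} \<times> UNIV)"
    proof (rule inj_onI)
      fix p p' assume p: "p \<in> {..n} \<times> UNIV" "p' \<in> {..n} \<times> UNIV" and eq: "zero k p = zero k p'"
      have i: "fst p \<in> {..n}" "fst p' \<in> {..n}" using p by auto
      then have pos: "g (s k) (fst p) 0 > 0" "g (s k) (fst p') 0 > 0" "g (s k) (fst p) pi > 0" "g (s k) (fst p') pi > 0"
        using Pg(1,3) by auto
      have "snd p = snd p'" using eq pos by (auto simp: zero_def of_real_eq_iff simp del: of_real_minus split: if_splits)
      moreover have "fst p = fst p'"
      proof (cases "snd p")
        case True
        then have "g (s k) (fst p) 0 = g (s k) (fst p') 0" using eq \<open>snd p = snd p'\<close> by (simp add: zero_def)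
        then show ?thesis using inj_onD[OF Pinj(1)] i by blast
      next
        case False
        then have "g (s k) (fst p) pi = g (s k) (fst p') pi" using eq \<open>snd p = snd p'\<close> by (simp add: zero_def)
        then show ?thesis using inj_onD[OF Pinj(2)] i by blast
      qed
      ultimately show "p = p'" by (simp add: prod_eq_iff)
    qed
  qed (use unif radii in auto)
  then obtain Q where Q: "Q holomorphic_on ball 0 r1" "\<And>w. ?h w = (\<Prod>p\<in>{..n} \<times> UNIV. w - \<zeta> p) * Q w" by blast
  have prod: "(\<Prod>p\<in>{..n} \<times> UNIV. w - \<zeta> p) = (\<Prod>i\<le>n. w\<^sup>2 - (of_real (x i))\<^sup>2)" for w
  proof -
    have "(\<Prod>p\<in>{..n} \<times> UNIV. w - \<zeta> p) = (\<Prod>i\<le>n. \<Prod>c\<in>UNIV. w - \<zeta> (i, c))"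
      by (simp add: prod.cartesian_product)
    also have "\<dots> = (\<Prod>i\<le>n. w\<^sup>2 - (of_real (x i))\<^sup>2)"
      by (intro prod.cong refl) (simp add: UNIV_bool \<zeta>_def power2_eq_square algebra_simps)
    finally show ?thesis .
  qed
  have "0 \<le> x i \<and> x i < r1" if "i \<le> n" for i
  proof -
    have "0 \<le> x i" by (rule LIMSEQ_le_const[OF s2(2)[OF that]]) (use Pg(1)[OF that] in \<open>auto simp: less_imp_le\<close>)
    moreover have "x i \<le> \<rho>" by (rule LIMSEQ_le_const2[OF s2(2)[OF that]]) (use Pg(2)[OF that] in auto)
    ultimately show ?thesis using radii(3) by simp
  qed
  then have zero: "?h z = 0" if "norm (of_real \<alpha> * z) < 1" for z
    by (rule averaged_eq_0[OF \<alpha>(3) radii(7) _ Q(1) _ that]) (auto simp: Q(2) prod)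
  \<comment> \<open>For h < H0 the point sqrt h lies in the disc |\<alpha> z| < 1, on which
    \<open>averaged\<close> has been shown to vanish; so the limit coefficients violate the
    hypothesis on D.\<close>
  obtain h where h: "0 \<le> h" "h < H0 \<alpha> \<alpha>" "melnikov m1 m2 \<alpha> \<alpha> n a0 b0 h \<noteq> 0"
    using assms(10) s1(1) unfolding ab0 \<alpha> by blast
  have "complex_of_real (melnikov m1 m2 \<alpha> \<alpha> n a0 b0 h) = 0"
    unfolding melnikov_averaged(1)[OF h(1,2) m \<alpha>(3)] zero[OF melnikov_averaged(2)[OF h(1,2) m \<alpha>(3)]] by simp
  then show False using h(3) by simp
qed

end
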